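(* Let $p$ be an odd prime and let $k\ge 0$ be an integer. Then $$\overline{p}_e(p^{2k})-\overline{p}_o(p^{2k})=\begin{cases}2p^k,& p\equiv 1\pmod 4,\\[2pt] \dfrac{2p^k(p+1)-4}{p-1},& p\equiv 3\pmod 4,\end{cases}$$ and $$\overline{p}_e(2p^{2k})-\overline{p}_o(2p^{2k})=\begin{cases}-4p^k,& p\equiv 1,3\pmod 8,\\[2pt] \dfrac{-4p^k(p+1)+8}{p-1},& p\equiv 5,7\pmod 8.\end{cases}$$
   Context: An overpartition of $n$ is a partition of $n$ in which the first occurrence of each number may be overlined. The rank of an overpartition is its largest part minus its number of parts. $\overline{p}_e(n)$ (resp. $\overline{p}_o(n)$) denotes the number of overpartitions of $n$ with even (resp. odd) rank. *)

theory Defs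
  imports Complex_Main "HOL-Library.Multiset" "HOL-Computational_Algebra.Primes"
    "HOL-Number_Theory.Cong"
begin

text \<open>
  Since only the first occurrence of each part size may be overlined, an overpartition is
  determined by the underlying multiset of parts together with the set of those part sizes
  whose first occurrence is overlined.
\<close>

definition overpartitions :: "nat \<Rightarrow> (nat multiset \<times> nat set) set" where
  "overpartitions n = {(M, S). 0 \<notin># M \<and> sum_mset M = n \<and> S \<subseteq> set_mset M}"

text \<open>
  The rank is an integer and may be negative. For the empty overpartition (which occurs only
  for \<open>n = 0\<close>) the value is unspecified, as \<open>Max {}\<close> is.
\<close>

definition overpartition_rank :: "nat multiset \<times> nat set \<Rightarrow> int" where
  "overpartition_rank \<pi> = int (Max (set_mset (fst \<pi>))) - int (size (fst \<pi>))"

definition p_even :: "nat \<Rightarrow> nat" where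
  "p_even n = card {\<pi> \<in> overpartitions n. even (overpartition_rank \<pi>)}"

definition p_odd :: "nat \<Rightarrow> nat" where
  "p_odd n = card {\<pi> \<in> overpartitions n. odd (overpartition_rank \<pi>)}"

lemma finite_overpartitions: "finite (overpartitions n)"
proof -
  have size_le: "size M \<le> sum_mset M" if "0 \<notin># M" for M :: "nat multiset"
    using that by (induction M) auto
  have mem_le: "x \<le> sum_mset M" if "x \<in># M" for x and M :: "nat multiset"
    using that by (auto dest: multi_member_split)
  have "overpartitions n \<subseteq>
      mset ` {xs. set xs \<subseteq> {..n} \<and> length xs \<le> n} \<times> Pow {..n}" (is "_ \<subseteq> ?B")
  proof
    fix \<pi> assume "\<pi> \<in> overpartitions n"
    then obtain M S where \<pi>: "\<pi> = (M, S)"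
      and M: "0 \<notin># M" "sum_mset M = n" and S: "S \<subseteq> set_mset M"
      by (auto simp: overpartitions_def)
    obtain xs where xs: "mset xs = M" by (metis ex_mset)
    have "set_mset M \<subseteq> {..n}" using mem_le M(2) by auto
    moreover have "length xs \<le> n" using size_le[OF M(1)] M(2) xs by auto
    ultimately show "\<pi> \<in> ?B" using \<pi> S xs by force
  qed
  moreover have "finite ?B"
    by (intro finite_cartesian_product finite_imageI finite_lists_length_le) auto
  ultimately show ?thesis by (rule finite_subset)
qed

end

theory Submission
  imports Defs "HOL-Computational_Algebra.Formal_Laurent_Series" "HOL-Number_Theory.Number_Theory"
begin

text \<open>
  Let \<open>c(N)\<close> be the difference of the two counts. Sorting overpartitions by largest part writes
  its generating function as \<open>1 + \<Sum>m\<ge>1. (-1)^m (t_m - t_(m-1))\<close> with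
  \<open>t_m = \<Prod>i\<le>m. (1 - q^i) / (1 + q^i)\<close>. A finite identity of Gauss, summed by parts, expands
  \<open>(-1)^m t_m\<close> in the partial sums of \<open>(-1)^j q^(n^2-j^2)\<close>, and the \<open>q\<close>-Gauss sum then yields
  two parallel Hecke-type series,
  \<open>1 - 2 \<Sum> (-1)^j b^w q^(n(n+w)-j^2)\<close>, where \<open>b = 1\<close> gives \<open>c\<close> and \<open>b = -1\<close> gives the cube of
  \<open>\<Sum>j. (-1)^j q^(j^2)\<close> (an identity of Andrews and Crandall). With \<open>x = |j|\<close>, \<open>y = n - |j|\<close>,
  \<open>z = n + w - |j|\<close> the exponent becomes \<open>x y + y z + z x\<close>, and the symmetry of this form shows
  that \<open>3 |c(N)|\<close> is the number of representations of \<open>N\<close> by three squares if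
  \<open>N \<equiv> 1, 2 (mod 4)\<close>.

  For \<open>N = n\<^sup>2\<close> and \<open>N = 2 n\<^sup>2\<close> the representations are sliced along a coordinate \<open>u\<close> into those
  of \<open>n\<^sup>2 - u\<^sup>2 = (n - u) (n + u)\<close> by \<open>v\<^sup>2 + D w\<^sup>2\<close>, \<open>D = 1, 2\<close>. They are counted by divisor sums
  of a quadratic character, and the resulting convolution over \<open>a + b = 2 n\<close> is evaluated by an
  identity of Liouville.
\<close>

section \<open>Overpartitions by largest part\<close>

text \<open>The expansion of \<open>(-1)^m t_m\<close> is a Bailey pair relative to
  \<open>q\<close>; both series come from it, with the parameters \<open>b\<close> and
  \<open>b q\<close>. For \<open>b = -1\<close> the transformed sum is a \<open>q\<close>-binomial
  series, hence a product. For \<open>b = 1\<close> a vanishing factor \<open>1 - b\<close> must be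
  divided out. What remains is the sum of \<open>q^m / (1 - q^m) (-1)^m t_m\<close>, and this is the
  series for \<open>c\<close>, because \<open>t_m - t_(m-1) = -2 q^m / (1 - q^m) t_m\<close>.

  No infinite product is formed: identities are proved for finite \<open>M\<close> over a field and
  then read as congruences of Laurent series modulo \<open>X^(N+1)\<close>.

  Odd squares and their doubles are 1 and 2 modulo 4, which is where the symmetry argument applies.
  Prime powers matter only at the end: the divisor sum of \<open>(n - u) (n + u)\<close> is not the
  product of the divisor sums of the factors, but for \<open>n = p^k\<close> and even
  \<open>u\<close> the factors share no prime except \<open>p\<close>. The multiplication rule then
  has one correction term, a copy of the sum for \<open>p^(k-1)\<close> times the character value at
  \<open>p\<close>; the sign of that value separates the two cases of each formula.\<close>

definition bounded_partitions :: "nat \<Rightarrow> nat \<Rightarrow> nat multiset set" where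
  "bounded_partitions m N = {M. set_mset M \<subseteq> {1..m} \<and> sum_mset M = N}"

text \<open>The power of two counts the choices of overlined sizes. A part size \<open>i\<close>
  thus contributes \<open>1 + 2 (-q^i) + 2 (-q^i)^2 + ... = (1 - q^i) / (1 + q^i)\<close>, so that
  \<open>signed_count m\<close> has the generating function \<open>t_m\<close>.\<close>

definition signed_weight :: "nat multiset \<Rightarrow> real" where
  "signed_weight M = (-1) ^ size M * 2 ^ card (set_mset M)"

definition signed_count :: "nat \<Rightarrow> nat \<Rightarrow> real" where
  "signed_count m N = (\<Sum>M\<in>bounded_partitions m N. signed_weight M)"

definition rank_diff :: "nat \<Rightarrow> real" where
  "rank_diff N = real (p_even N) - real (p_odd N)"

lemma mem_le_sum_mset: "x \<in># M \<Longrightarrow> x \<le> sum_mset M" for x :: nat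
  by (auto dest: multi_member_split)

lemma overpartitions_eq_Sigma:
  "overpartitions N = Sigma (bounded_partitions N N) (\<lambda>M. Pow (set_mset M))"
proof -
  have "x \<in> {1..sum_mset M}" if "0 \<notin># M" "x \<in># M" for x :: nat and M
  proof -
    have "x \<noteq> 0" using that by metis
    then show ?thesis using mem_le_sum_mset[OF that(2)] by simp
  qed
  then have "0 \<notin># M \<Longrightarrow> set_mset M \<subseteq> {1..sum_mset M}" for M :: "nat multiset"
    by (intro subsetI)
  moreover have "set_mset M \<subseteq> {1..k} \<Longrightarrow> 0 \<notin># M" for M :: "nat multiset" and k
    by (auto dest: subsetD)
  ultimately have "set_mset M \<subseteq> {1..N} \<and> sum_mset M = N \<longleftrightarrow> 0 \<notin># M \<and> sum_mset M = N" for M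
    by metis
  then show ?thesis by (auto simp only: overpartitions_def bounded_partitions_def)
qed

lemma bounded_partitions_mono: "m \<le> n \<Longrightarrow> bounded_partitions m N \<subseteq> bounded_partitions n N"
  by (fastforce simp: bounded_partitions_def)

lemma finite_bounded_partitions: "finite (bounded_partitions m N)"
proof -
  have "bounded_partitions m N \<subseteq> fst ` overpartitions N"
  proof
    fix M assume "M \<in> bounded_partitions m N"
    then have "(M, {}) \<in> overpartitions N"
      by (auto simp: overpartitions_def bounded_partitions_def)
    then show "M \<in> fst ` overpartitions N" by force
  qed
  then show ?thesis
    using finite_overpartitions finite_surj by blast
qed

text \<open>The rank does not depend on the overlined set, so the sum over \<open>S\<close>
  contributes only the factor \<open>2 ^ card (set_mset M)\<close>.\<close>

lemma rank_diff_eq_sum: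
  "rank_diff N = (\<Sum>M\<in>bounded_partitions N N. (-1) ^ Max (set_mset M) * signed_weight M)"
proof -
  let ?s = "\<lambda>\<pi>. if even (overpartition_rank \<pi>) then 1 else (-1::real)"
  let ?E = "{\<pi> \<in> overpartitions N. even (overpartition_rank \<pi>)}"
  let ?O = "{\<pi> \<in> overpartitions N. odd (overpartition_rank \<pi>)}"
  have fin: "finite ?E" "finite ?O" using finite_overpartitions[of N] by simp_all
  have "overpartitions N = ?E \<union> ?O" by blast
  moreover have "sum ?s (?E \<union> ?O) = sum ?s ?E + sum ?s ?O"
    using fin by (rule sum.union_disjoint) blast
  moreover have "sum ?s ?E = p_even N" "sum ?s ?O = - real (p_odd N)"
    by (simp_all add: p_even_def p_odd_def)
  ultimately have "rank_diff N = (\<Sum>\<pi>\<in>overpartitions N. ?s \<pi>)"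
    by (simp add: rank_diff_def)
  also have "\<dots> = (\<Sum>M\<in>bounded_partitions N N. \<Sum>S\<in>Pow (set_mset M). ?s (M, S))"
    by (simp add: overpartitions_eq_Sigma sum.Sigma finite_bounded_partitions)
  also have "\<dots> = (\<Sum>M\<in>bounded_partitions N N. (-1) ^ Max (set_mset M) * signed_weight M)"
  proof (intro sum.cong refl)
    fix M
    have "?s (M, S) = (-1) ^ Max (set_mset M) * (-1) ^ size M" for S
      by (simp add: overpartition_rank_def minus_one_power_iff)
    then show "(\<Sum>S\<in>Pow (set_mset M). ?s (M, S)) = (-1) ^ Max (set_mset M) * signed_weight M"
      by (simp only:) (simp add: signed_weight_def card_Pow)
  qed
  finally show ?thesis .
qed

lemma rank_diff_eq:
  assumes "N > 0"
  shows "rank_diff N = (\<Sum>m=1..N. (-1) ^ m * (signed_count m N - signed_count (m - 1) N))"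
proof -
  let ?f = "\<lambda>M. (-1) ^ Max (set_mset M) * signed_weight M"
  \<comment> \<open>These are the multisets with largest part exactly \<open>m\<close>. They exhaust
    all cases because \<open>N > 0\<close> excludes the empty multiset.\<close>
  let ?D = "\<lambda>m. bounded_partitions m N - bounded_partitions (m - 1) N"
  have max: "Max (set_mset M) = m" if "m \<ge> 1" "M \<in> ?D m" for M m
  proof -
    have *: "{1..m} = insert m {1..m - 1}" using that(1) by (cases m) (simp_all add: atLeastAtMostSuc_conv)
    have "m \<in># M" using that unfolding bounded_partitions_def * by blast
    then show ?thesis using that
      by (intro Max_eqI) (auto simp: bounded_partitions_def)
  qed
  have U: "bounded_partitions N N = (\<Union>m\<in>{1..N}. ?D m)"
  proof (intro subset_antisym subsetI)
    fix M assume M: "M \<in> bounded_partitions N N"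
    then have ne: "set_mset M \<noteq> {}" using assms by (auto simp: bounded_partitions_def)
    let ?m = "Max (set_mset M)"
    have m: "?m \<in> set_mset M" using ne by simp
    then have "?m \<in> {1..N}" using M by (auto simp: bounded_partitions_def)
    moreover have "M \<in> bounded_partitions ?m N" using M by (auto simp: bounded_partitions_def)
    moreover have "M \<notin> bounded_partitions (?m - 1) N" using m calculation(1)
      by (auto simp: bounded_partitions_def subset_iff) 
    ultimately show "M \<in> (\<Union>m\<in>{1..N}. ?D m)" by blast
  next
    fix M assume "M \<in> (\<Union>m\<in>{1..N}. ?D m)"
    then show "M \<in> bounded_partitions N N" using bounded_partitions_mono by fastforce
  qed
  have "rank_diff N = (\<Sum>m=1..N. \<Sum>M\<in>?D m. ?f M)"
    unfolding rank_diff_eq_sum U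
  proof (rule sum.UNION_disjoint, simp_all only: finite_atLeastAtMost finite_bounded_partitions finite_Diff Ball_def simp_thms, intro allI impI)
    fix i j assume ij: "i \<in> {1..N}" "j \<in> {1..N}" "i \<noteq> j"
    show "?D i \<inter> ?D j = {}"
    proof (rule equals0I)
      fix M assume "M \<in> ?D i \<inter> ?D j"
      then show False using max[of i M] max[of j M] ij by simp
    qed
  qed
  also have "\<dots> = (\<Sum>m=1..N. (-1) ^ m * (\<Sum>M\<in>?D m. signed_weight M))"
    unfolding sum_distrib_left using max by (intro sum.cong refl) auto
  also have "\<dots> = (\<Sum>m=1..N. (-1) ^ m * (signed_count m N - signed_count (m - 1) N))"
    unfolding signed_count_def
    by (intro sum.cong refl, subst sum_diff) (simp_all add: finite_bounded_partitions bounded_partitions_mono)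
  finally show ?thesis .
qed

lemma signed_count_0: "signed_count 0 N = (if N = 0 then 1 else 0)"
proof -
  have "bounded_partitions 0 N = (if N = 0 then {{#}} else {})"
    by (auto simp: bounded_partitions_def)
  then show ?thesis by (simp add: signed_count_def signed_weight_def)
qed

text \<open>Coefficientwise form of \<open>(1 + q^m) t_m = (1 - q^m) t_(m-1)\<close>, which later
  identifies the generating function without infinite products.\<close>

lemma signed_count_rec:
  assumes "m > 0"
  shows "signed_count m N + (if m \<le> N then signed_count m (N - m) else 0) =
         signed_count (m - 1) N - (if m \<le> N then signed_count (m - 1) (N - m) else 0)"
proof -
  let ?B = bounded_partitions
  let ?A = "{M \<in> ?B m N. m \<in># M}"
  have split: "?B m N = ?B (m - 1) N \<union> {M \<in> ?B m N. m \<in># M}"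
    "?B (m - 1) N \<inter> {M \<in> ?B m N. m \<in># M} = {}" for N
  proof -
    have *: "{1..m} = insert m {1..m - 1}" using assms by (cases m) (simp_all add: atLeastAtMostSuc_conv)
    show "?B m N = ?B (m - 1) N \<union> {M \<in> ?B m N. m \<in># M}"
      unfolding bounded_partitions_def * using subset_insert[of m] by auto
    show "?B (m - 1) N \<inter> {M \<in> ?B m N. m \<in># M} = {}"
      using assms unfolding bounded_partitions_def by auto
  qed
  have E: "signed_count m N = signed_count (m - 1) N + (\<Sum>M\<in>?A. signed_weight M)"
    unfolding signed_count_def using split[of N]
    by (metis (no_types, lifting) finite_Un finite_bounded_partitions sum.union_disjoint)
  have "(\<Sum>M\<in>?A. signed_weight M) =
      - (if m \<le> N then signed_count m (N - m) + signed_count (m - 1) (N - m) else 0)"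
  proof (cases "m \<le> N")
    case False
    then have e: "?A = {}" by (auto simp: bounded_partitions_def dest: mem_le_sum_mset)
    show ?thesis unfolding e using False by simp
  next
    case True
    let ?B' = "?B m (N - m)"
    have "(\<Sum>M\<in>?A. signed_weight M) = (\<Sum>M\<in>?B'. signed_weight (add_mset m M))"
      using True assms
      by (intro sum.reindex_bij_witness[of _ "add_mset m" "\<lambda>M. M - {#m#}"])
         (auto simp: bounded_partitions_def sum_mset.remove dest: in_diffD)
    \<comment> \<open>Adding a copy of \<open>m\<close> flips the sign, and it doubles the weight
      precisely if \<open>m\<close> was absent before, that is if \<open>M\<close> has only parts
      below \<open>m\<close>.\<close>
    also have "\<dots> = (\<Sum>M\<in>?B'. - signed_weight M - (if M \<in> ?B (m - 1) (N - m) then signed_weight M else 0))"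
    proof (intro sum.cong refl)
      fix M assume M: "M \<in> ?B'"
      show "signed_weight (add_mset m M) = - signed_weight M -
          (if M \<in> ?B (m - 1) (N - m) then signed_weight M else 0)"
      proof (cases "m \<in># M")
        case True
        then have "M \<notin> ?B (m - 1) (N - m)" using assms by (auto simp: bounded_partitions_def)
        then show ?thesis using True by (simp add: signed_weight_def insert_absorb)
      next
        case False
        then have "M \<in> ?B (m - 1) (N - m)" using M split by blast
        then show ?thesis using False by (simp add: signed_weight_def)
      qed
    qed
    also have "\<dots> = - signed_count m (N - m) - (\<Sum>M\<in>?B' \<inter> ?B (m - 1) (N - m). signed_weight M)"
      by (simp add: sum_subtractf sum_negf signed_count_def sum.inter_restrict finite_bounded_partitions)
    also have "?B' \<inter> ?B (m - 1) (N - m) = ?B (m - 1) (N - m)"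
      using bounded_partitions_mono[of "m - 1" m] by auto
    finally show ?thesis using True by (simp add: signed_count_def)
  qed
  then show ?thesis using E by (auto split: if_splits)
qed

section \<open>Finite identities of Gauss and Hecke type\<close>

definition qpoch :: "'a::field \<Rightarrow> 'a \<Rightarrow> nat \<Rightarrow> 'a" where
  "qpoch b q n = (\<Prod>i=1..n. 1 - b * q ^ i)"

lemma qpoch_0 [simp]: "qpoch b q 0 = 1"
  by (simp add: qpoch_def)

lemma qpoch_Suc [simp]: "qpoch b q (Suc n) = (1 - b * q ^ Suc n) * qpoch b q n"
  by (simp add: qpoch_def mult.commute)

text \<open>This is the sum of \<open>(-1)^j q^(n^2 - j^2)\<close> over integers \<open>j\<close>
  with \<open>|j| \<le> n\<close>. The recursion is the form needed for summation by parts: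
  \<open>B_n - q^(2n-1) B_(n-1) = 2 (-1)^n\<close>.\<close>

fun hecke_sum :: "'a::field \<Rightarrow> nat \<Rightarrow> 'a" where
  "hecke_sum q 0 = 1"
| "hecke_sum q (Suc n) = q ^ (2 * n + 1) * hecke_sum q n + 2 * (-1) ^ Suc n"

lemma sum_triangle_swap:
  "(\<Sum>m\<le>M. \<Sum>n\<le>m. f m n) = (\<Sum>n\<le>M. \<Sum>m=n..M. f m n)" for f :: "nat \<Rightarrow> nat \<Rightarrow> 'a::comm_monoid_add"
proof (induction M)
  case (Suc M)
  have "(\<Sum>n\<le>M. \<Sum>m=n..Suc M. f m n) = (\<Sum>n\<le>M. (\<Sum>m=n..M. f m n) + f (Suc M) n)"
    by (intro sum.cong refl) simp
  then show ?case using Suc by (simp add: sum.distrib add_ac)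
qed auto

text \<open>The two conditions make every denominator \<open>1 - q^n\<close> with
  \<open>n > 0\<close> and every \<open>1 + q^n\<close> invertible. The case \<open>n = 0\<close> of
  the second one excludes characteristic two.\<close>

locale generic_nome =
  fixes q :: "'a::field"
  assumes power_neq_1: "n > 0 \<Longrightarrow> q ^ n \<noteq> 1"
    and power_neq_minus_1: "q ^ n \<noteq> -1"
begin

lemma one_minus_nz [simp]: "n > 0 \<Longrightarrow> 1 - q ^ n \<noteq> 0" "1 - q * q ^ n \<noteq> 0"
  using power_neq_1[of n] power_neq_1[of "Suc n"] by auto

lemma power_neq_1' [simp]: "q * q ^ n \<noteq> 1" "q * (q * q ^ n) \<noteq> 1"
  using power_neq_1[of "Suc n"] power_neq_1[of "Suc (Suc n)"] by auto

lemma one_plus_nz [simp]: "1 + q ^ n \<noteq> 0" "1 + q * q ^ n \<noteq> 0"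
  using power_neq_minus_1[of n] power_neq_minus_1[of "Suc n"] by (auto simp: add_eq_0_iff)

lemma qpoch_nz [simp]: "qpoch 1 q n \<noteq> 0" "qpoch (-1) q n \<noteq> 0"
  by (induction n) auto

section \<open>Alternating sums of Gaussian binomial coefficients\<close>

definition gauss_term :: "nat \<Rightarrow> nat \<Rightarrow> 'a" where
  "gauss_term M n = (if n \<le> M then 1 / (qpoch 1 q (M - n) * qpoch 1 q (M + n)) else 0)"

lemma alternating_telescope:
  "(\<Sum>n=1..M. (-1) ^ n * (f n + f (n - 1))) = (-1) ^ M * f M - f 0" for f :: "nat \<Rightarrow> 'a"
  by (induction M) (auto simp: algebra_simps)

text \<open>While \<open>gauss_term M n\<close> is the Gaussian binomial \<open>[2M, M+n]\<close>
  over \<open>(q)_(2M)\<close>, this is the quantity linking neighbours: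
  \<open>(1 - q^(M-n))\<close> times the term at \<open>n\<close> equals
  \<open>(1 - q^(M+n+1))\<close> times the term at \<open>n + 1\<close>. It serves as the
  telescoping certificate below.\<close>

definition gauss_step :: "nat \<Rightarrow> nat \<Rightarrow> 'a" where
  "gauss_step M n = (if n < M then 1 / (qpoch 1 q (M - n - 1) * qpoch 1 q (M + n)) else 0)"

lemma gauss_term_diff:
  assumes "n \<le> M"
  shows "(1 - q ^ (M - n)) * gauss_term M n = gauss_step M n"
    and "0 < n \<Longrightarrow> (1 - q ^ (M + n)) * gauss_term M n = gauss_step M (n - 1)"
    and "0 < M \<Longrightarrow> gauss_term (M - 1) n = (1 - q ^ (M - n)) * (1 - q ^ (M + n)) * gauss_term M n"
proof -
  show "(1 - q ^ (M - n)) * gauss_term M n = gauss_step M n"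
  proof (cases "n = M")
    case False
    then obtain k where k: "M = Suc (n + k)"
      using assms by (metis add_Suc_right le_neq_implies_less less_imp_Suc_add)
    have "1 - q ^ (M - n) \<noteq> 0" by (simp add: k Suc_diff_le)
    then show ?thesis by (simp add: gauss_term_def gauss_step_def k Suc_diff_le)
  qed (simp add: gauss_term_def gauss_step_def)
  show "(1 - q ^ (M + n)) * gauss_term M n = gauss_step M (n - 1)" if "0 < n"
  proof -
    obtain k where "n = Suc k" using \<open>0 < n\<close> gr0_implies_Suc by blast
    then show ?thesis using assms by (simp add: gauss_term_def gauss_step_def)
  qed
  show "gauss_term (M - 1) n = (1 - q ^ (M - n)) * (1 - q ^ (M + n)) * gauss_term M n" if "0 < M"
  proof (cases "n = M")
    case False
    then obtain k where k: "M = Suc (n + k)"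
      using assms by (metis add_Suc_right le_neq_implies_less less_imp_Suc_add)
    show ?thesis by (simp add: gauss_term_def gauss_step_def k Suc_diff_le)
  qed (use that in \<open>simp add: gauss_term_def\<close>)
qed

lemma eq_divideI: "a * b * x = y \<Longrightarrow> a \<noteq> 0 \<Longrightarrow> b \<noteq> 0 \<Longrightarrow> x = y / (a * b)" for x :: 'a
  by (auto simp: field_simps)

lemma sum_linear_combination:
  "c * (x + 2 * (\<Sum>n\<in>A. s n * f n)) + d * (y + 2 * (\<Sum>n\<in>A. s n * g n)) =
    (c * x + d * y) + 2 * (\<Sum>n\<in>A. s n * (c * f n + d * g n))" for c d :: 'a
  by (simp add: distrib_left sum.distrib sum_distrib_left mult_ac)

text \<open>Gauss's evaluation of the alternating sum of the binomials \<open>[2M, M+n]\<close>,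
  divided by \<open>(q)_(2M)\<close>. A combination of the terms for \<open>M\<close> and
  \<open>M - 1\<close> splits into \<open>gauss_step\<close> at \<open>n\<close> and at
  \<open>n - 1\<close>; under alternating signs it telescopes, so each step in \<open>M\<close>
  multiplies the sum by \<open>-1 / (1 - q^(2M))\<close>.\<close>

lemma gauss_alternating:
  "gauss_term M 0 + 2 * (\<Sum>n=1..M. (-1) ^ n * gauss_term M n) = (-1) ^ M / (qpoch 1 q M * qpoch (-1) q M)"
proof (induction M)
  case 0
  show ?case by (simp add: gauss_term_def)
next
  case (Suc M)
  let ?S = "\<lambda>M. gauss_term M 0 + 2 * (\<Sum>n=1..M. (-1) ^ n * gauss_term M n)"
  let ?N = "Suc M"
  have *: "(1 - q ^ (2 * ?N)) * gauss_term ?N n + gauss_term M n = gauss_step ?N n + gauss_step ?N (n - 1)" if "0 < n" "n \<le> ?N" for n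
  proof -
    have "q ^ (?N - n) * q ^ (?N + n) = q ^ (2 * ?N)"
      using that by (simp add: mult_2 flip: power_add)
    then have "(1 - q ^ (2 * ?N)) + (1 - q ^ (?N - n)) * (1 - q ^ (?N + n))
        = (1 - q ^ (?N - n)) + (1 - q ^ (?N + n))"
      by (simp add: algebra_simps)
    then have "(1 - q ^ (2 * ?N)) * gauss_term ?N n + (1 - q ^ (?N - n)) * (1 - q ^ (?N + n)) * gauss_term ?N n
        = (1 - q ^ (?N - n)) * gauss_term ?N n + (1 - q ^ (?N + n)) * gauss_term ?N n"
      by (metis distrib_right)
    then show ?thesis using gauss_term_diff[of n ?N] that by simp
  qed
  have **: "(1 - q ^ (2 * ?N)) * gauss_term ?N 0 + gauss_term M 0 = 2 * gauss_step ?N 0"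
  proof -
    have e: "q ^ (2 * ?N) = q ^ ?N * q ^ ?N" by (metis mult_2 power_add)
    have "(1 - q ^ (2 * ?N)) * gauss_term ?N 0 + gauss_term M 0 = 2 * ((1 - q ^ ?N) * gauss_term ?N 0)"
      using gauss_term_diff(3)[of 0 ?N] unfolding e by (simp add: algebra_simps)
    also have "(1 - q ^ ?N) * gauss_term ?N 0 = gauss_step ?N 0" using gauss_term_diff(1)[of 0 ?N] by simp
    finally show ?thesis .
  qed
  have "(\<Sum>n=1..M. (-1) ^ n * gauss_term M n) = (\<Sum>n=1..?N. (-1) ^ n * gauss_term M n)"
    by (simp add: gauss_term_def)
  then have "(1 - q ^ (2 * ?N)) * ?S ?N + ?S M =
      ((1 - q ^ (2 * ?N)) * gauss_term ?N 0 + gauss_term M 0) +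
      2 * (\<Sum>n=1..?N. (-1) ^ n * ((1 - q ^ (2 * ?N)) * gauss_term ?N n + gauss_term M n))"
    using sum_linear_combination[of "1 - q ^ (2 * ?N)" "gauss_term ?N 0" "\<lambda>n. (-1) ^ n" "gauss_term ?N" "{1..?N}" 1 "gauss_term M 0" "gauss_term M"]
    by (simp only: mult_1)
  also have "(\<Sum>n=1..?N. (-1) ^ n * ((1 - q ^ (2 * ?N)) * gauss_term ?N n + gauss_term M n)) =
      (\<Sum>n=1..?N. (-1) ^ n * (gauss_step ?N n + gauss_step ?N (n - 1)))"
    by (intro sum.cong refl) (simp only: * atLeastAtMost_iff Suc_le_eq One_nat_def)
  also have "\<dots> = - gauss_step ?N 0"
    by (subst alternating_telescope) (simp add: gauss_step_def)
  finally have "(1 - q ^ (2 * ?N)) * ?S ?N = - ?S M"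
    unfolding ** by (simp add: add_eq_0_iff)
  moreover have "1 - q ^ (2 * ?N) = (1 - q ^ ?N) * (1 + q ^ ?N)"
    by (simp only: mult_2 power_add) (simp add: algebra_simps)
  ultimately have "(1 - q ^ ?N) * (1 + q ^ ?N) * ?S ?N = - ?S M" by simp
  moreover have "1 - q ^ ?N \<noteq> 0" "1 + q ^ ?N \<noteq> 0" by simp_all
  ultimately have "?S ?N = - ?S M / ((1 - q ^ ?N) * (1 + q ^ ?N))"
    by (rule eq_divideI)
  then show ?case unfolding Suc.IH by (simp add: mult_ac)
qed

text \<open>The image of \<open>gauss_alternating\<close> under \<open>q -> 1/q\<close>, which
  multiplies \<open>gauss_term M n\<close> by \<open>q^(M^2 + M + n^2)\<close>. Its limit is Gauss's
  product for the theta series.\<close>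

lemma gauss_square:
  "gauss_term M 0 + 2 * (\<Sum>n=1..M. (-1) ^ n * q ^ n\<^sup>2 * gauss_term M n) = 1 / (qpoch 1 q M * qpoch (-1) q M)"
proof (induction M)
  case 0
  show ?case by (simp add: gauss_term_def)
next
  case (Suc M)
  let ?S = "\<lambda>M. gauss_term M 0 + 2 * (\<Sum>n=1..M. (-1) ^ n * q ^ n\<^sup>2 * gauss_term M n)"
  let ?N = "Suc M"
  \<comment> \<open>The exponent is chosen so that one function covers both neighbours:
    \<open>n^2 + N + n\<close> at \<open>n\<close>, and at \<open>n - 1\<close> it becomes
    \<open>n^2 + N - n\<close>.\<close>
  let ?E = "\<lambda>n. q ^ (n\<^sup>2 + ?N + n) * gauss_step ?N n"
  have *: "q ^ n\<^sup>2 * ((1 - q ^ (2 * ?N)) * gauss_term ?N n - gauss_term M n) = ?E n + ?E (n - 1)"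
    if "0 < n" "n \<le> ?N" for n
  proof -
    have "q ^ (?N - n) * q ^ (?N + n) = q ^ (2 * ?N)"
      using that by (simp add: mult_2 flip: power_add)
    then have "(1 - q ^ (2 * ?N)) - (1 - q ^ (?N - n)) * (1 - q ^ (?N + n))
        = q ^ (?N - n) * (1 - q ^ (?N + n)) + q ^ (?N + n) * (1 - q ^ (?N - n))"
      by (simp add: algebra_simps)
    then have "(1 - q ^ (2 * ?N)) * gauss_term ?N n - (1 - q ^ (?N - n)) * (1 - q ^ (?N + n)) * gauss_term ?N n
        = q ^ (?N - n) * ((1 - q ^ (?N + n)) * gauss_term ?N n) + q ^ (?N + n) * ((1 - q ^ (?N - n)) * gauss_term ?N n)"
      by (metis (no_types, lifting) distrib_right left_diff_distrib mult.assoc)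
    then have "(1 - q ^ (2 * ?N)) * gauss_term ?N n - gauss_term M n
        = q ^ (?N - n) * gauss_step ?N (n - 1) + q ^ (?N + n) * gauss_step ?N n"
      using gauss_term_diff[of n ?N] that by simp
    moreover have "n\<^sup>2 + (?N - n) = (n - 1)\<^sup>2 + ?N + (n - 1)"
    proof -
      obtain k where "n = Suc k" using \<open>0 < n\<close> gr0_implies_Suc by blast
      then show ?thesis using that by (simp add: power2_eq_square algebra_simps)
    qed
    then have "q ^ n\<^sup>2 * q ^ (?N - n) = q ^ ((n - 1)\<^sup>2 + ?N + (n - 1))"
      by (metis power_add)
    moreover have "q ^ n\<^sup>2 * q ^ (?N + n) = q ^ (n\<^sup>2 + ?N + n)"
      by (simp add: power_add mult_ac)
    ultimately show ?thesis by (simp only: distrib_left flip: mult.assoc) (simp add: add.commute)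
  qed
  have **: "(1 - q ^ (2 * ?N)) * gauss_term ?N 0 - gauss_term M 0 = 2 * ?E 0"
  proof -
    have e: "q ^ (2 * ?N) = q ^ ?N * q ^ ?N" by (metis mult_2 power_add)
    have "(1 - q ^ (2 * ?N)) * gauss_term ?N 0 - gauss_term M 0 = 2 * q ^ ?N * ((1 - q ^ ?N) * gauss_term ?N 0)"
      using gauss_term_diff(3)[of 0 ?N] unfolding e by (simp add: algebra_simps)
    also have "(1 - q ^ ?N) * gauss_term ?N 0 = gauss_step ?N 0" using gauss_term_diff(1)[of 0 ?N] by simp
    finally show ?thesis by simp
  qed
  have "(\<Sum>n=1..M. (-1) ^ n * q ^ n\<^sup>2 * gauss_term M n) = (\<Sum>n=1..?N. (-1) ^ n * q ^ n\<^sup>2 * gauss_term M n)"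
    by (simp add: gauss_term_def)
  then have "(1 - q ^ (2 * ?N)) * ?S ?N - ?S M =
      ((1 - q ^ (2 * ?N)) * gauss_term ?N 0 - gauss_term M 0) +
      2 * (\<Sum>n=1..?N. (-1) ^ n * (q ^ n\<^sup>2 * ((1 - q ^ (2 * ?N)) * gauss_term ?N n - gauss_term M n)))"
    using sum_linear_combination[of "1 - q ^ (2 * ?N)" "gauss_term ?N 0" "\<lambda>n. (-1) ^ n * q ^ n\<^sup>2" "gauss_term ?N" "{1..?N}" "-1" "gauss_term M 0" "gauss_term M"]
    by (simp only: mult_minus1 add_uminus_conv_diff mult.assoc)
  also have "(\<Sum>n=1..?N. (-1) ^ n * (q ^ n\<^sup>2 * ((1 - q ^ (2 * ?N)) * gauss_term ?N n - gauss_term M n))) =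
      (\<Sum>n=1..?N. (-1) ^ n * (?E n + ?E (n - 1)))"
    by (intro sum.cong refl) (simp only: * atLeastAtMost_iff Suc_le_eq One_nat_def)
  also have "\<dots> = - ?E 0"
    by (subst alternating_telescope) (simp add: gauss_step_def)
  finally have "(1 - q ^ (2 * ?N)) * ?S ?N = ?S M"
    unfolding ** by simp
  moreover have "1 - q ^ (2 * ?N) = (1 - q ^ ?N) * (1 + q ^ ?N)"
    by (simp only: mult_2 power_add) (simp add: algebra_simps)
  ultimately have "(1 - q ^ ?N) * (1 + q ^ ?N) * ?S ?N = ?S M" by simp
  moreover have "1 - q ^ ?N \<noteq> 0" "1 + q ^ ?N \<noteq> 0" by simp_all
  ultimately have "?S ?N = ?S M / ((1 - q ^ ?N) * (1 + q ^ ?N))"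
    by (rule eq_divideI)
  then show ?case unfolding Suc.IH by (simp add: mult_ac)
qed

text \<open>Summation by parts in \<open>gauss_alternating\<close>: the recursion of
  \<open>hecke_sum\<close> moves the coefficients from \<open>gauss_term M n\<close> to the
  differences \<open>gauss_term M n - q^(2n+1) * gauss_term M (n+1)\<close>, and these are the
  quotients on the left. Up to normalisation this is a Bailey pair relative to
  \<open>q\<close>.\<close>

lemma hecke_expansion:
  "(\<Sum>n\<le>M. hecke_sum q n * (1 - q ^ (2 * n + 1)) / (qpoch 1 q (M - n) * qpoch 1 q (M + n + 1)))
   = (-1) ^ M / (qpoch 1 q M * qpoch (-1) q M)"
proof -
  let ?B = "hecke_sum q"
  have *: "?B n * (1 - q ^ (2 * n + 1)) / (qpoch 1 q (M - n) * qpoch 1 q (M + n + 1))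
      = ?B n * (gauss_term M n - q ^ (2 * n + 1) * gauss_term M (Suc n))" if "n \<le> M" for n
  proof -
    define c where "c = 1 - q ^ (M + n + 1)"
    have c: "c \<noteq> 0" unfolding c_def by (rule one_minus_nz) simp
    have "c * gauss_term M (Suc n) = gauss_step M n"
    proof (cases "n = M")
      case True
      then show ?thesis by (simp add: gauss_term_def gauss_step_def)
    next
      case False
      then show ?thesis using gauss_term_diff(2)[of "Suc n" M] that by (simp add: c_def)
    qed
    then have v_Suc: "gauss_term M (Suc n) = (1 - q ^ (M - n)) * gauss_term M n / c"
      using gauss_term_diff(1)[OF that] c by (simp add: eq_divide_eq mult.commute)
    have yz: "q ^ (2 * n + 1) * q ^ (M - n) = 1 - c"
    proof -
      have "2 * n + 1 + (M - n) = M + n + 1" using that by simp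
      then show ?thesis unfolding c_def by (simp only: power_add[symmetric]) simp
    qed
    define x y z where "x = gauss_term M n" and "y = q ^ (2 * n + 1)" and "z = q ^ (M - n)"
    have "x - y * ((1 - z) * x / c) = x * (c - y + y * z) / c"
      using c by (simp add: field_simps)
    also have "\<dots> = x * (1 - y) / c" using yz by (simp add: y_def z_def)
    finally have "?B n * (gauss_term M n - q ^ (2 * n + 1) * gauss_term M (Suc n)) = ?B n * (x * (1 - y) / c)"
      unfolding v_Suc by (simp only: x_def y_def z_def)
    also have "x = c / (qpoch 1 q (M - n) * qpoch 1 q (M + n + 1))"
      using that c by (simp add: x_def gauss_term_def c_def)
    finally show ?thesis using c by (simp add: y_def)
  qed
  have "(\<Sum>n\<le>m. ?B n * (gauss_term M n - q ^ (2 * n + 1) * gauss_term M (Suc n))) =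
      gauss_term M 0 + 2 * (\<Sum>n=1..m. (-1) ^ n * gauss_term M n) - q ^ (2 * m + 1) * ?B m * gauss_term M (Suc m)" for m
    by (induction m) (simp_all add: algebra_simps)
  from this[of M] show ?thesis
    using gauss_alternating[of M] * by (simp add: gauss_term_def)
qed

text \<open>The \<open>q\<close>-Gauss sum with parameters \<open>b\<close> and \<open>b q\<close>,
  where even the partial sums have a closed form, so that induction on \<open>M\<close> suffices.
  The condition at \<open>n\<close> itself excludes \<open>n = 0\<close> for
  \<open>b = 1\<close>.\<close>

lemma gauss_summation:
  assumes b: "b * b = 1" and nz: "\<And>n. n > 0 \<Longrightarrow> 1 - b * q ^ n \<noteq> 0"
    and n: "1 - b * q ^ n \<noteq> 0" and "n \<le> M"
  shows "(\<Sum>m=n..M. q ^ m * (qpoch b q m)\<^sup>2 / ((1 - b * q ^ m) * qpoch 1 q (m - n) * qpoch 1 q (m + n + 1)))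
    = q ^ n / ((1 - b * q ^ n) * (1 - b * q ^ Suc n)) *
      (qpoch b q M * qpoch b q (Suc M) / (qpoch 1 q (M - n) * qpoch 1 q (M + n + 1)))"
  using \<open>n \<le> M\<close>
proof (induction M rule: dec_induct)
  case base
  show ?case using nz[of "Suc n"] n by (simp add: power2_eq_square)
next
  case (step M)
  define d where "d = M - n"
  have M: "M = n + d" using step by (simp add: d_def)
  let ?P = "qpoch b q M" and ?R = "qpoch 1 q d" and ?Q = "qpoch 1 q (M + n + 1)"
  let ?e = "(1 - b * q ^ n) * (1 - b * q ^ Suc n)"
  let ?u = "1 - b * q ^ Suc M" and ?v = "1 - b * q ^ Suc (Suc M)"
  let ?r = "1 - q ^ Suc d" and ?s = "1 - q ^ (M + n + 2)"
  have e: "?e \<noteq> 0" using nz[of "Suc n"] n by simp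
  have u: "?u \<noteq> 0" using nz[of "Suc M"] by simp
  have r: "?r \<noteq> 0" "?s \<noteq> 0" "?R \<noteq> 0" "?Q \<noteq> 0" by (simp_all del: qpoch_Suc)
  \<comment> \<open>With \<open>x = q^n\<close> and \<open>y = q^d\<close> the induction step
    reduces to this polynomial identity; the terms in \<open>x^2 y\<close> cancel because
    \<open>b * b = 1\<close>.\<close>
  have "x * (1 - q * y) * (1 - q * q * x * x * y) + q * x * y * ((1 - b * x) * (1 - b * (q * x)))
      = x * (1 - b * (q * x * y)) * (1 - b * (q * q * x * y))" for x y :: 'a
  proof -
    have bb: "b * (b * z) = z" for z by (simp flip: mult.assoc add: b)
    show ?thesis by (simp add: algebra_simps bb)
  qed
  from this[of "q ^ n" "q ^ d"] have key: "q ^ n * ?r * ?s + q ^ Suc M * ?e = q ^ n * ?u * ?v"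
    by (simp add: M power_add mult_ac)
  have "(\<Sum>m=n..Suc M. q ^ m * (qpoch b q m)\<^sup>2 / ((1 - b * q ^ m) * qpoch 1 q (m - n) * qpoch 1 q (m + n + 1)))
    = q ^ n / ?e * (?P * (?u * ?P) / (?R * ?Q)) +
      q ^ Suc M * (?u * ?P)\<^sup>2 / (?u * (?r * ?R) * (?s * ?Q))"
    using step by (simp add: Suc_diff_le flip: d_def)
  also have "\<dots> = (?u * ?P * ?P * (q ^ n * ?r * ?s + q ^ Suc M * ?e)) / (?e * (?r * ?R) * (?s * ?Q))"
    using e u r by (simp add: power2_eq_square divide_simps del: power_Suc) (simp add: algebra_simps del: power_Suc)
  also have "\<dots> = q ^ n / ?e * ((?u * ?P) * (?v * (?u * ?P)) / ((?r * ?R) * (?s * ?Q)))"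
    unfolding key by (simp add: mult_ac)
  finally show ?case using step by (simp add: Suc_diff_le flip: d_def)
qed

section \<open>Bailey transforms for \<open>b = 1\<close> and \<open>b = -1\<close>\<close>

definition theta_ratio :: "nat \<Rightarrow> 'a" where "theta_ratio m = qpoch 1 q m / qpoch (-1) q m"

definition limit_factor :: "nat \<Rightarrow> nat \<Rightarrow> 'a" where
  "limit_factor M n = qpoch 1 q M * qpoch 1 q (Suc M) / (qpoch 1 q (M - n) * qpoch 1 q (M + n + 1))"

definition hecke_kernel :: "'a \<Rightarrow> nat \<Rightarrow> 'a" where
  "hecke_kernel b n = q ^ n * (1 - q ^ (2 * n + 1)) / ((1 - b * q ^ n) * (1 - b * q ^ Suc n))"

text \<open>Partial fractions: each summand has a single denominator and expands as a geometric
  series. They give rise to the two families in \<open>hecke_count\<close>.\<close>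

lemma hecke_kernel_eq:
  assumes b: "b * b = 1" and nz: "1 - b * q ^ n \<noteq> 0" "1 - b * q ^ Suc n \<noteq> 0"
  shows "hecke_kernel b n = q ^ n / (1 - b * q ^ n) + b * q ^ (2 * n + 1) / (1 - b * q ^ Suc n)"
proof -
  define x where "x = q ^ n"
  have bb: "b * (b * z) = z" for z by (simp flip: mult.assoc add: b)
  have x2: "q ^ (2 * n + 1) = q * x * x" by (simp add: x_def power_add mult_2)
  have "x * (1 - b * (q * x)) + b * (q * x * x) * (1 - b * x) = x * (1 - q * x * x)"
    by (simp add: algebra_simps bb)
  moreover have "x / (1 - b * x) + b * (q * x * x) / (1 - b * (q * x)) =
      (x * (1 - b * (q * x)) + b * (q * x * x) * (1 - b * x)) / ((1 - b * x) * (1 - b * (q * x)))"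
    by (rule add_frac_eq) (use nz in \<open>simp_all add: x_def\<close>)
  ultimately show ?thesis
    unfolding hecke_kernel_def x2 power_Suc x_def[symmetric] by (metis)
qed

text \<open>Bailey's transformation: insert the expansion and exchange the sums. For suitable
  \<open>w\<close> the inner sum is the one evaluated by \<open>gauss_summation\<close>.\<close>

lemma weighted_hecke_sum:
  fixes w :: "nat \<Rightarrow> 'a"
  shows "(\<Sum>m\<le>M. w m * ((-1) ^ m / (qpoch 1 q m * qpoch (-1) q m))) =
    (\<Sum>n\<le>M. hecke_sum q n * (1 - q ^ (2 * n + 1)) *
       (\<Sum>m=n..M. w m / (qpoch 1 q (m - n) * qpoch 1 q (m + n + 1))))"
  unfolding hecke_expansion[symmetric] sum_distrib_left sum_triangle_swap
  by (intro sum.cong refl) (simp add: mult_ac)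

lemma sum_theta_ratio_eq:
  "(\<Sum>m=1..M. q ^ m / (1 - q ^ m) * ((-1) ^ m * theta_ratio m)) =
    (q / (1 - q) - q ^ Suc M / (1 - q ^ Suc M)) + (\<Sum>n=1..M. hecke_sum q n * hecke_kernel 1 n * limit_factor M n)"
proof -
  \<comment> \<open>At \<open>m = 0\<close> the denominator \<open>1 - q^m\<close> vanishes, so the
    weight is set to zero there.\<close>
  define w where "w m = (if m = 0 then 0 else q ^ m * (qpoch 1 q m)\<^sup>2 / (1 - q ^ m))" for m
  have "(\<Sum>m=1..M. q ^ m / (1 - q ^ m) * ((-1) ^ m * theta_ratio m)) =
      (\<Sum>m\<le>M. w m * ((-1) ^ m / (qpoch 1 q m * qpoch (-1) q m)))"
  proof -
    have "(\<Sum>m=1..M. q ^ m / (1 - q ^ m) * ((-1) ^ m * theta_ratio m)) =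
      (\<Sum>m=1..M. w m * ((-1) ^ m / (qpoch 1 q m * qpoch (-1) q m)))"
      by (intro sum.cong refl) (simp add: w_def theta_ratio_def power2_eq_square)
    also have "\<dots> = (\<Sum>m\<le>M. w m * ((-1) ^ m / (qpoch 1 q m * qpoch (-1) q m)))"
      by (rule sum.mono_neutral_left) (auto simp: w_def)
    finally show ?thesis .
  qed
  also have "\<dots> = (\<Sum>n\<le>M. hecke_sum q n * (1 - q ^ (2 * n + 1)) *
       (\<Sum>m=n..M. w m / (qpoch 1 q (m - n) * qpoch 1 q (m + n + 1))))" (is "_ = (\<Sum>n\<le>M. ?f n)")
    by (rule weighted_hecke_sum)
  also have "\<dots> = ?f 0 + (\<Sum>n=1..M. ?f n)"
  proof -
    have "{..M} = insert 0 {1..M}" by auto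
    then show ?thesis by (simp only: sum.insert finite_atLeastAtMost) simp
  qed
  also have "(\<Sum>n=1..M. ?f n) = (\<Sum>n=1..M. hecke_sum q n * hecke_kernel 1 n * limit_factor M n)"
  proof (intro sum.cong refl)
    fix n assume n: "n \<in> {1..M}"
    have "(\<Sum>m=n..M. w m / (qpoch 1 q (m - n) * qpoch 1 q (m + n + 1))) =
      (\<Sum>m=n..M. q ^ m * (qpoch 1 q m)\<^sup>2 / ((1 - 1 * q ^ m) * qpoch 1 q (m - n) * qpoch 1 q (m + n + 1)))"
      using n by (intro sum.cong refl) (simp add: w_def)
    also have "\<dots> = q ^ n / ((1 - 1 * q ^ n) * (1 - 1 * q ^ Suc n)) * limit_factor M n"
      unfolding limit_factor_def using n by (intro gauss_summation) (simp_all add: power_neq_1)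
    finally show "?f n = hecke_sum q n * hecke_kernel 1 n * limit_factor M n" by (simp add: hecke_kernel_def)
  qed
  \<comment> \<open>For \<open>n = 0\<close> the closed form would have the denominator
    \<open>1 - q^0\<close>. This inner sum is evaluated separately and telescopes.\<close>
  also have "?f 0 = (1 - q) * (\<Sum>m=0..M. w m / (qpoch 1 q m * qpoch 1 q (Suc m)))"
    by (simp del: qpoch_Suc)
  also have "\<dots> = q / (1 - q) - q ^ Suc M / (1 - q ^ Suc M)"
  proof (induction M)
    case (Suc M)
    define y where "y = q ^ Suc M"
    have y: "1 - y \<noteq> 0" "1 - q * y \<noteq> 0"
      using power_neq_1[of "Suc M"] power_neq_1[of "Suc (Suc M)"] by (simp_all add: y_def)
    have "w (Suc M) / (qpoch 1 q (Suc M) * qpoch 1 q (Suc (Suc M))) = y / ((1 - y) * (1 - q * y))"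
      by (simp add: w_def power2_eq_square y_def)
    moreover have "(1 - q) * (y / ((1 - y) * (1 - q * y))) = y / (1 - y) - q * y / (1 - q * y)"
      using y by (simp add: diff_frac_eq algebra_simps)
    ultimately have "(1 - q) * (w (Suc M) / (qpoch 1 q (Suc M) * qpoch 1 q (Suc (Suc M)))) =
        q ^ Suc M / (1 - q ^ Suc M) - q ^ Suc (Suc M) / (1 - q ^ Suc (Suc M))"
      by (simp add: y_def)
    then show ?case by (simp only: sum.atLeast0_atMost_Suc distrib_left Suc) simp
  qed (simp add: w_def)
  finally show ?thesis .
qed

text \<open>Since \<open>2 (-q)_m / (1 + q^m) = (-1; q)_m\<close>, this truncates the
  \<open>q\<close>-binomial series whose sum is \<open>(-z)_\<infinity> / (z)_\<infinity>\<close>.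
  At \<open>z = -q\<close> that is the limit of \<open>theta_ratio\<close>.\<close>

definition binomial_sum :: "nat \<Rightarrow> 'a \<Rightarrow> 'a" where
  "binomial_sum M z = (\<Sum>m\<le>M. 2 * qpoch (-1) q m / ((1 + q ^ m) * qpoch 1 q m) * z ^ m)"

text \<open>Here \<open>b = -1\<close>. The Gauss sum yields \<open>(-q)_M (-q)_(M+1)\<close> where
  \<open>limit_factor\<close> has \<open>(q)_M (q)_(M+1)\<close>; the quotient is the product of two
  values of \<open>theta_ratio\<close>, which supplies two of the three factors of the theta
  cube.\<close>

lemma binomial_sum_eq: "binomial_sum M (- q) = 2 / (theta_ratio M * theta_ratio (Suc M)) * (\<Sum>n\<le>M. hecke_sum q n * hecke_kernel (-1) n * limit_factor M n)"
proof -
  define w where "w m = q ^ m * (qpoch (-1) q m)\<^sup>2 / (1 + q ^ m)" for m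
  have "binomial_sum M (- q) = 2 * (\<Sum>m\<le>M. w m * ((-1) ^ m / (qpoch 1 q m * qpoch (-1) q m)))"
    unfolding binomial_sum_def sum_distrib_left w_def
    by (intro sum.cong refl) (simp add: power2_eq_square power_minus[of q] mult_ac)
  also have "\<dots> = 2 * (\<Sum>n\<le>M. hecke_sum q n * (1 - q ^ (2 * n + 1)) *
       (\<Sum>m=n..M. w m / (qpoch 1 q (m - n) * qpoch 1 q (m + n + 1))))"
    by (simp only: weighted_hecke_sum)
  also have "\<dots> = 2 * (\<Sum>n\<le>M. hecke_sum q n * hecke_kernel (-1) n * limit_factor M n / (theta_ratio M * theta_ratio (Suc M)))"
  proof (intro arg_cong[where f = "(*) 2"] sum.cong refl)
    fix n assume n: "n \<in> {..M}"
    have "(\<Sum>m=n..M. w m / (qpoch 1 q (m - n) * qpoch 1 q (m + n + 1))) =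
      (\<Sum>m=n..M. q ^ m * (qpoch (-1) q m)\<^sup>2 / ((1 - (-1) * q ^ m) * qpoch 1 q (m - n) * qpoch 1 q (m + n + 1)))"
      by (intro sum.cong refl) (simp add: w_def)
    also have "\<dots> = q ^ n / ((1 - (-1) * q ^ n) * (1 - (-1) * q ^ Suc n)) *
      (qpoch (-1) q M * qpoch (-1) q (Suc M) / (qpoch 1 q (M - n) * qpoch 1 q (M + n + 1)))"
      using n by (intro gauss_summation) auto
    also have "qpoch (-1) q M * qpoch (-1) q (Suc M) / (qpoch 1 q (M - n) * qpoch 1 q (M + n + 1))
        = limit_factor M n / (theta_ratio M * theta_ratio (Suc M))"
    proof -
      have "a * b / (c * d) = (x * y / (c * d)) / (x / a * (y / b))"
        if "a \<noteq> 0" "b \<noteq> 0" "x \<noteq> 0" "y \<noteq> 0" for a b c d x y :: 'a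
        using that by simp
      then show ?thesis unfolding limit_factor_def theta_ratio_def by (metis qpoch_nz)
    qed
    finally show "hecke_sum q n * (1 - q ^ (2 * n + 1)) *
       (\<Sum>m=n..M. w m / (qpoch 1 q (m - n) * qpoch 1 q (m + n + 1))) =
       hecke_sum q n * hecke_kernel (-1) n * limit_factor M n / (theta_ratio M * theta_ratio (Suc M))" by (simp only:) (simp add: hecke_kernel_def)
  qed
  finally show ?thesis unfolding sum_divide_distrib[symmetric] by simp
qed

text \<open>The \<open>q\<close>-difference equation \<open>(1 - z) E(z) = (1 + z) E(z q)\<close> of
  the full series; the right-hand side is the boundary term left by truncation.\<close>

lemma binomial_sum_shift:
  "(1 - z) * binomial_sum M z - (1 + z) * binomial_sum M (z * q) = - (2 * qpoch (-1) q M / qpoch 1 q M) * z ^ Suc M"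
proof (induction M)
  case 0
  show ?case using one_plus_nz(1)[of 0] by (simp add: binomial_sum_def algebra_simps)
next
  case (Suc M)
  define e where "e = 2 * qpoch (-1) q (Suc M) / ((1 + q ^ Suc M) * qpoch 1 q (Suc M))"
  define x where "x = q ^ Suc M"
  have nz: "1 - x \<noteq> 0" "1 + x \<noteq> 0" unfolding x_def by (simp_all add: power_neq_1 del: power_Suc)
  have e: "e * (1 - x) = 2 * qpoch (-1) q M / qpoch 1 q M"
    using nz by (simp add: e_def flip: x_def power_Suc)
  have e': "e * (1 + x) = 2 * qpoch (-1) q (Suc M) / qpoch 1 q (Suc M)"
    using nz by (simp add: e_def flip: x_def power_Suc)
  have binomial_sum: "binomial_sum (Suc M) y = binomial_sum M y + e * y ^ Suc M" for y
    by (simp add: binomial_sum_def e_def)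
  have "(1 - z) * binomial_sum (Suc M) z - (1 + z) * binomial_sum (Suc M) (z * q) =
     - (e * (1 - x)) * z ^ Suc M + e * z ^ Suc M * ((1 - z) - (1 + z) * x)"
    unfolding e Suc.IH[symmetric] binomial_sum by (simp add: algebra_simps x_def power_mult_distrib)
  also have "\<dots> = - (e * (1 + x)) * z ^ Suc (Suc M)" by (simp add: algebra_simps)
  finally show ?case unfolding e' .
qed

lemma theta_ratio_square_sum:
  "theta_ratio M = (qpoch 1 q M)\<^sup>2 * gauss_term M 0 + 2 * (\<Sum>n=1..M. (-1) ^ n * q ^ n\<^sup>2 * ((qpoch 1 q M)\<^sup>2 * gauss_term M n))"
proof -
  have "theta_ratio M = (qpoch 1 q M)\<^sup>2 * (1 / (qpoch 1 q M * qpoch (-1) q M))"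
    by (simp add: theta_ratio_def power2_eq_square)
  also have "\<dots> = (qpoch 1 q M)\<^sup>2 * gauss_term M 0 + 2 * (\<Sum>n=1..M. (qpoch 1 q M)\<^sup>2 * ((-1) ^ n * q ^ n\<^sup>2 * gauss_term M n))"
    unfolding gauss_square[symmetric] by (simp only: distrib_left sum_distrib_left mult_ac)
  finally show ?thesis by (simp only: mult_ac)
qed

lemma theta_ratio_0 [simp]: "theta_ratio 0 = 1"
  by (simp add: theta_ratio_def)

lemma theta_ratio_Suc: "(1 + q ^ Suc m) * theta_ratio (Suc m) = (1 - q ^ Suc m) * theta_ratio m"
proof -
  have "1 + q ^ Suc m \<noteq> 0" by (simp del: power_Suc)
  then show ?thesis by (simp add: theta_ratio_def)
qed

lemma theta_ratio_telescope:
  "(\<Sum>m=1..M. (-1) ^ m * (theta_ratio m - theta_ratio (m - 1))) = - 2 * (\<Sum>m=1..M. q ^ m / (1 - q ^ m) * ((-1) ^ m * theta_ratio m))"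
  unfolding sum_distrib_left
proof (intro sum.cong refl)
  fix m assume "m \<in> {1..M}"
  then obtain k where m: "m = Suc k" by (cases m) auto
  define x where "x = q ^ Suc k"
  have "1 - x \<noteq> 0" unfolding x_def by (simp add: power_neq_1 del: power_Suc)
  moreover have "(1 + x) * theta_ratio (Suc k) = (1 - x) * theta_ratio k" using theta_ratio_Suc[of k] by (simp add: x_def)
  ultimately have "theta_ratio k = (1 + x) * theta_ratio (Suc k) / (1 - x)" by (simp add: eq_divide_eq mult.commute)
  then have "theta_ratio (Suc k) - theta_ratio k = - 2 * (x / (1 - x) * theta_ratio (Suc k))"
    using \<open>1 - x \<noteq> 0\<close> by (simp add: divide_simps) (simp add: algebra_simps)
  then show "(-1) ^ m * (theta_ratio m - theta_ratio (m - 1)) = - 2 * (q ^ m / (1 - q ^ m) * ((-1) ^ m * theta_ratio m))"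
    by (simp add: m x_def del: power_Suc)
qed

end

section \<open>Passage to formal series\<close>

unbundle fps_syntax


section \<open>Congruences of Laurent series modulo powers of \<open>X\<close>\<close>

definition big_oh :: "int \<Rightarrow> real fls set" where
  "big_oh k = {f. \<forall>i<k. f $$ i = 0}"

lemma big_oh_iff: "f \<in> big_oh k \<longleftrightarrow> f = 0 \<or> k \<le> fls_subdegree f"
proof
  assume "f \<in> big_oh k"
  then show "f = 0 \<or> k \<le> fls_subdegree f"
    using fls_subdegree_geI[of f k] by (auto simp: big_oh_def)
next
  assume "f = 0 \<or> k \<le> fls_subdegree f"
  then show "f \<in> big_oh k"
    by (elim disjE) (simp_all add: big_oh_def)
qed

lemma big_oh_0 [simp]: "0 \<in> big_oh k"
  by (simp add: big_oh_def)

lemma big_oh_add: "f \<in> big_oh k \<Longrightarrow> g \<in> big_oh k \<Longrightarrow> f + g \<in> big_oh k"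
  and big_oh_diff: "f \<in> big_oh k \<Longrightarrow> g \<in> big_oh k \<Longrightarrow> f - g \<in> big_oh k"
  and big_oh_uminus: "f \<in> big_oh k \<Longrightarrow> - f \<in> big_oh k"
  by (simp_all add: big_oh_def)

lemma big_oh_sum: "(\<And>i. i \<in> A \<Longrightarrow> f i \<in> big_oh k) \<Longrightarrow> sum f A \<in> big_oh k"
  by (induction A rule: infinite_finite_induct) (auto intro: big_oh_add)

lemma big_oh_mono: "f \<in> big_oh k \<Longrightarrow> l \<le> k \<Longrightarrow> f \<in> big_oh l"
  by (simp add: big_oh_def)

lemma big_oh_mult: "f \<in> big_oh k \<Longrightarrow> g \<in> big_oh l \<Longrightarrow> f * g \<in> big_oh (k + l)"
  by (cases "f = 0 \<or> g = 0") (auto simp: big_oh_iff)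

lemma big_oh_mult_left: "f \<in> big_oh 0 \<Longrightarrow> g \<in> big_oh k \<Longrightarrow> f * g \<in> big_oh k"
  using big_oh_mult[of f 0 g k] by simp

lemma big_oh_mult_right: "f \<in> big_oh k \<Longrightarrow> g \<in> big_oh 0 \<Longrightarrow> f * g \<in> big_oh k"
  using big_oh_mult[of f k g 0] by simp

lemma big_oh_one: "1 \<in> big_oh 0"
  by (simp add: big_oh_def)

lemma big_oh_power: "f \<in> big_oh 0 \<Longrightarrow> f ^ n \<in> big_oh 0"
  by (induction n) (auto intro: big_oh_mult_left big_oh_one)

lemma big_oh_const [simp]: "numeral n \<in> big_oh 0" "1 \<in> big_oh 0" "-1 \<in> big_oh 0"
proof -
  have "numeral n = fls_const (numeral n :: real)" by (simp add: fls_const_numeral)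
  then show "numeral n \<in> big_oh 0" by (simp add: big_oh_def)
qed (simp_all add: big_oh_def)

abbreviation X :: "real fls" where "X \<equiv> fls_X"

lemma big_oh_X [simp]: "X ^ n \<in> big_oh (int n)"
  by (simp add: big_oh_iff fls_subdegree_pow)

lemma big_oh_X' [simp]: "X ^ n \<in> big_oh 0" "X \<in> big_oh 0"
  using big_oh_mono[OF big_oh_X[of n], of 0] big_oh_mono[OF big_oh_X[of 1], of 0] by simp_all

lemma big_oh_X_square [simp]: "X ^ n\<^sup>2 \<in> big_oh ((int n)\<^sup>2)"
  using big_oh_X[of "n\<^sup>2"] by (simp del: big_oh_X)

lemma unit_inverse:
  assumes "f - 1 \<in> big_oh 1"
  shows "f \<noteq> 0" "inverse f \<in> big_oh 0"
proof -
  have f0: "f $$ 0 = 1" and neg: "f $$ i = 0" if "i < 0" for i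
    using assms that by (auto simp: big_oh_def)
  have f0: "f $$ 0 = 1" using assms by (auto simp: big_oh_def)
  then show f: "f \<noteq> 0" by auto
  have "fls_subdegree f = 0" using f0 neg by (intro fls_subdegree_eqI) auto
  then show "inverse f \<in> big_oh 0" by (simp add: big_oh_iff fls_inverse_subdegree)
qed

global_interpretation nome: generic_nome X
proof
  fix n :: nat
  show "X ^ n \<noteq> 1" if "n > 0"
  proof
    assume "X ^ n = 1"
    then have "fls_subdegree (X ^ n) = 0" by simp
    with that show False by (simp add: fls_subdegree_pow)
  qed
  show "X ^ n \<noteq> - 1"
  proof (cases "n = 0")
    case False
    show ?thesis
    proof
      assume "X ^ n = -1"
      then have "fls_subdegree (X ^ n) = 0" by simp
      with False show False by (simp add: fls_subdegree_pow)
    qed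
  qed auto
qed

definition eqm :: "int \<Rightarrow> real fls \<Rightarrow> real fls \<Rightarrow> bool" where
  "eqm k f g \<longleftrightarrow> f - g \<in> big_oh k"

lemma eqm_refl [simp]: "eqm k f f"
  by (simp add: eqm_def)

lemma eqm_sym: "eqm k f g \<Longrightarrow> eqm k g f"
  using big_oh_uminus[of "f - g" k] by (simp add: eqm_def)

lemma eqm_trans [trans]: "eqm k f g \<Longrightarrow> eqm k g h \<Longrightarrow> eqm k f h"
  using big_oh_add[of "f - g" k "g - h"] by (simp add: eqm_def)

lemma eqm_mult:
  assumes "eqm k f f'" "eqm k g g'" "f \<in> big_oh 0" "g' \<in> big_oh 0"
  shows "eqm k (f * g) (f' * g')"
proof -
  have "f * (g - g') + (f - f') * g' \<in> big_oh k"
    using assms by (intro big_oh_add big_oh_mult_left big_oh_mult_right) (auto simp: eqm_def)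
  then show ?thesis by (simp add: eqm_def algebra_simps)
qed

lemma eqm_add: "eqm k f f' \<Longrightarrow> eqm k g g' \<Longrightarrow> eqm k (f + g) (f' + g')"
  using big_oh_add[of "f - f'" k "g - g'"] by (simp add: eqm_def algebra_simps)

lemma eqm_sum: "(\<And>i. i \<in> A \<Longrightarrow> eqm k (f i) (g i)) \<Longrightarrow> eqm k (sum f A) (sum g A)"
  by (simp add: eqm_def big_oh_sum flip: sum_subtractf)

lemma eqm_cmult: "c \<in> big_oh 0 \<Longrightarrow> eqm k f g \<Longrightarrow> eqm k (c * f) (c * g)"
  using big_oh_mult_left[of c "f - g" k] by (simp add: eqm_def algebra_simps)

lemma eqm_mono: "eqm k f g \<Longrightarrow> l \<le> k \<Longrightarrow> eqm l f g"
  by (auto simp: eqm_def intro: big_oh_mono)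

lemma eqm_nth: "eqm k f g \<Longrightarrow> i < k \<Longrightarrow> f $$ i = g $$ i"
  by (simp add: eqm_def big_oh_def)

lemma eqm_big_oh: "eqm k f g \<Longrightarrow> k \<ge> 0 \<Longrightarrow> g \<in> big_oh 0 \<Longrightarrow> f \<in> big_oh 0"
  using big_oh_add[of "f - g" 0 g] big_oh_mono[of "f - g" k 0] by (simp add: eqm_def)

lemma eqm_one_mult: "eqm k f 1 \<Longrightarrow> eqm k g 1 \<Longrightarrow> k \<ge> 0 \<Longrightarrow> eqm k (f * g) 1"
  using eqm_mult[of k f 1 g 1] eqm_big_oh[of k f 1] by simp

lemma eqm_one_inverse:
  assumes "eqm k f 1" "k \<ge> 1"
  shows "f \<noteq> 0" "inverse f \<in> big_oh 0" "eqm k (inverse f) 1"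
proof -
  have "f - 1 \<in> big_oh 1" using assms by (auto simp: eqm_def intro: big_oh_mono)
  note u = unit_inverse[OF this]
  show "f \<noteq> 0" "inverse f \<in> big_oh 0" by (fact u)+
  have "inverse f * (1 - f) \<in> big_oh k"
    using big_oh_mult_left[OF u(2), of "1 - f" k] eqm_sym[OF assms(1)] by (simp add: eqm_def)
  then show "eqm k (inverse f) 1" using u(1) by (simp add: eqm_def algebra_simps)
qed

lemma eqm_one_divide: "eqm k f 1 \<Longrightarrow> eqm k g 1 \<Longrightarrow> k \<ge> 1 \<Longrightarrow> eqm k (f / g) 1"
  by (simp add: divide_inverse eqm_one_mult eqm_one_inverse)

section \<open>Convergence of the finite products\<close>

lemma eqm_one_minus: "b \<in> big_oh 0 \<Longrightarrow> eqm (int n) (1 - b * X ^ n) 1"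
  using big_oh_uminus[OF big_oh_mult_left[of b "X ^ n" "int n"]] by (simp add: eqm_def)

lemma qpoch_ratio:
  assumes "k \<le> m" "b \<in> big_oh 0" and nz: "\<And>n. qpoch b X n \<noteq> 0"
  shows "eqm (int k + 1) (qpoch b X m / qpoch b X k) 1"
  using \<open>k \<le> m\<close>
proof (induction m rule: dec_induct)
  case base
  then show ?case using nz by simp
next
  case (step m)
  have "eqm (int k + 1) ((1 - b * X ^ Suc m) * (qpoch b X m / qpoch b X k)) 1"
    using step eqm_mono[OF eqm_one_minus[OF assms(2), of "Suc m"], of "int k + 1"]
    by (intro eqm_one_mult) auto
  then show ?case by simp
qed

text \<open>The factor \<open>(q)_M / (q)_(M-n)\<close> first differs from 1 at
  \<open>q^(M-n+1)\<close>, so precision decreases with \<open>n\<close>. The loss is made good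
  later, since the accompanying kernel is divisible by \<open>X^n\<close>.\<close>

lemma limit_factor_eqm:
  assumes "n \<le> M"
  shows "eqm (int M - int n + 1) (nome.limit_factor M n) 1"
proof -
  have eq: "nome.limit_factor M n = (qpoch 1 X M / qpoch 1 X (M - n)) / (qpoch 1 X (M + n + 1) / qpoch 1 X (Suc M))"
    by (simp add: nome.limit_factor_def)
  have "eqm (int M - int n + 1) (qpoch 1 X M / qpoch 1 X (M - n)) 1"
    using qpoch_ratio[of "M - n" M 1] assms by (simp add: of_nat_diff)
  moreover have "eqm (int M - int n + 1) (qpoch 1 X (M + n + 1) / qpoch 1 X (Suc M)) 1"
    by (rule eqm_mono[OF qpoch_ratio]) simp_all
  ultimately show ?thesis unfolding eq using assms by - (rule eqm_one_divide, assumption+, simp)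
qed

lemma gauss_term_eqm:
  assumes "n \<le> M"
  shows "eqm (int M - int n + 1) ((qpoch 1 X M)\<^sup>2 * nome.gauss_term M n) 1"
proof -
  have eq: "(qpoch 1 X M)\<^sup>2 * nome.gauss_term M n =
      (qpoch 1 X M / qpoch 1 X (M - n)) / (qpoch 1 X (M + n) / qpoch 1 X M)"
    using assms by (simp add: nome.gauss_term_def power2_eq_square)
  have "eqm (int M - int n + 1) (qpoch 1 X M / qpoch 1 X (M - n)) 1"
    using qpoch_ratio[of "M - n" M 1] assms by (simp add: of_nat_diff)
  moreover have "eqm (int M - int n + 1) (qpoch 1 X (M + n) / qpoch 1 X M) 1"
    by (rule eqm_mono[OF qpoch_ratio]) simp_all
  ultimately show ?thesis unfolding eq using assms by - (rule eqm_one_divide, assumption+, simp)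
qed

definition theta :: "nat \<Rightarrow> real fls" where
  "theta M = 1 + 2 * (\<Sum>n=1..M. (-1) ^ n * X ^ n\<^sup>2)"

text \<open>Gauss's product for theta at finite level. The factor \<open>X^(n^2)\<close> compensates
  the precision lost in \<open>gauss_term_eqm\<close>, as \<open>n \<le> n^2\<close>.\<close>

lemma theta_ratio_eqm_theta: "eqm (int M + 1) (nome.theta_ratio M) (theta M)"
proof -
  have "eqm (int M + 1) ((-1) ^ n * X ^ n\<^sup>2 * ((qpoch 1 X M)\<^sup>2 * nome.gauss_term M n)) ((-1) ^ n * X ^ n\<^sup>2)"
    if "n \<in> {1..M}" for n
  proof -
    have "(-1) ^ n * X ^ n\<^sup>2 * ((qpoch 1 X M)\<^sup>2 * nome.gauss_term M n - 1) \<in> big_oh (int (n\<^sup>2) + (int M - int n + 1))"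
      using gauss_term_eqm[of n M] that unfolding eqm_def
      by (intro big_oh_mult big_oh_mult_left[OF big_oh_power]) auto
    moreover have "int n \<le> int (n\<^sup>2)" by (simp add: power2_eq_square flip: of_nat_mult)
    ultimately show ?thesis by (auto simp: eqm_def algebra_simps intro: big_oh_mono)
  qed
  moreover have "eqm (int M + 1) ((qpoch 1 X M)\<^sup>2 * nome.gauss_term M 0) 1" using gauss_term_eqm[of 0 M] by simp
  ultimately show ?thesis unfolding nome.theta_ratio_square_sum theta_def
    by (intro eqm_add eqm_cmult eqm_sum) auto
qed

lemma theta_big_oh: "theta M \<in> big_oh 0"
  unfolding theta_def by (intro big_oh_add big_oh_mult_left big_oh_sum big_oh_power) auto

lemma theta_ratio_big_oh: "nome.theta_ratio M \<in> big_oh 0"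
  by (rule eqm_big_oh[OF theta_ratio_eqm_theta _ theta_big_oh]) simp

lemma theta_ratio_Suc_eqm: "eqm (int M + 1) (nome.theta_ratio (Suc M)) (theta M)"
proof -
  define r where "r = (qpoch 1 X (Suc M) / qpoch 1 X M) / (qpoch (-1) X (Suc M) / qpoch (-1) X M)"
  have r: "eqm (int M + 1) r 1"
    unfolding r_def by (intro eqm_one_divide qpoch_ratio) simp_all
  then have "r \<in> big_oh 0" by (rule eqm_big_oh) simp_all
  with r have "eqm (int M + 1) (r * nome.theta_ratio M) (1 * nome.theta_ratio M)"
    using theta_ratio_big_oh by (intro eqm_mult) simp_all
  moreover have "r * nome.theta_ratio M = nome.theta_ratio (Suc M)"
    by (simp add: r_def nome.theta_ratio_def del: qpoch_Suc)
  ultimately show ?thesis using eqm_trans[OF _ theta_ratio_eqm_theta] by simp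
qed

lemma fps_to_fls_signed_count: "fps_to_fls (Abs_fps (signed_count m)) = nome.theta_ratio m"
proof (induction m)
  case 0
  have "Abs_fps (signed_count 0) = 1" by (simp add: fps_eq_iff signed_count_0)
  then show ?case by simp
next
  case (Suc m)
  let ?A = "\<lambda>m. Abs_fps (signed_count m)"
  have "?A (Suc m) + fps_X ^ Suc m * ?A (Suc m) = ?A m - fps_X ^ Suc m * ?A m"
  proof (rule fps_ext)
    fix N
    show "(?A (Suc m) + fps_X ^ Suc m * ?A (Suc m)) $ N = (?A m - fps_X ^ Suc m * ?A m) $ N"
      using signed_count_rec[of "Suc m" N]
      by (auto simp del: power_Suc simp add: fps_X_power_mult_nth split: if_splits)
  qed
  then have "fps_to_fls (?A (Suc m) + fps_X ^ Suc m * ?A (Suc m)) = fps_to_fls (?A m - fps_X ^ Suc m * ?A m)"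
    by simp
  then have "(1 + X ^ Suc m) * fps_to_fls (?A (Suc m)) = (1 - X ^ Suc m) * fps_to_fls (?A m)"
    by (simp add: fls_times_fps_to_fls fps_to_fls_power algebra_simps del: power_Suc)
  also have "\<dots> = (1 + X ^ Suc m) * nome.theta_ratio (Suc m)"
    using nome.theta_ratio_Suc[of m] Suc by simp
  finally show ?case using nome.one_plus_nz(1)[of "Suc m"] by (simp del: power_Suc)
qed

section \<open>Coefficients of the Hecke-type series\<close>

definition mult_sign :: "nat \<Rightarrow> real" where
  "mult_sign j = (if j = 0 then 1 else 2 * (-1) ^ j)"

lemma hecke_sum_eq: "hecke_sum X n = (\<Sum>j\<le>n. fls_const (mult_sign j) * X ^ (n\<^sup>2 - j\<^sup>2))"
proof (induction n)
  case (Suc n)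
  have "X ^ (2 * n + 1) * X ^ (n\<^sup>2 - j\<^sup>2) = X ^ ((Suc n)\<^sup>2 - j\<^sup>2)" if "j \<le> n" for j
  proof -
    have "j\<^sup>2 \<le> n\<^sup>2" using that by (simp add: power_mono)
    then have "2 * n + 1 + (n\<^sup>2 - j\<^sup>2) = (Suc n)\<^sup>2 - j\<^sup>2" by (simp add: power2_eq_square)
    then show ?thesis by (metis power_add)
  qed
  then have "X ^ (2 * n + 1) * hecke_sum X n = (\<Sum>j\<le>n. fls_const (mult_sign j) * X ^ ((Suc n)\<^sup>2 - j\<^sup>2))"
    unfolding Suc sum_distrib_left by (intro sum.cong refl) (simp only: mult.left_commute atMost_iff)
  moreover have "fls_const (mult_sign (Suc n)) = 2 * (-1) ^ Suc n"
    by (simp add: mult_sign_def fls_const_power flip: fls_const_mult_const)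
  ultimately show ?case by (simp del: power_Suc)
qed (simp add: mult_sign_def)

lemma hecke_sum_big_oh: "hecke_sum X n \<in> big_oh 0"
  unfolding hecke_sum_eq by (intro big_oh_sum big_oh_mult_left big_oh_X'(1)) (simp add: big_oh_def)

lemma theta_eq: "theta n = (\<Sum>j\<le>n. fls_const (mult_sign j) * X ^ j\<^sup>2)"
  unfolding theta_def
  by (induction n) (simp_all add: mult_sign_def fls_const_power algebra_simps flip: fls_const_mult_const)

lemma monomial_nth: "(fls_const c * X ^ e) $$ int N = (if e = N then c else 0)"
  by simp

text \<open>Both families have the exponent \<open>n (n + w) - j^2\<close>; the first omits
  \<open>w = 0\<close>, the second omits \<open>j = n\<close>. \<open>mult_sign\<close> folds
  \<open>j\<close> and \<open>-j\<close> together.\<close>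

definition hecke_count :: "real \<Rightarrow> nat \<Rightarrow> real" where
  "hecke_count b N =
     (\<Sum>n=1..N. \<Sum>w=1..N. \<Sum>j\<le>n. if n\<^sup>2 - j\<^sup>2 + n * w = N then mult_sign j * b ^ w else 0) +
     (\<Sum>n=1..N. \<Sum>w\<le>N. \<Sum>j\<le>n - 1. if n\<^sup>2 - j\<^sup>2 + n * w = N then mult_sign j * b ^ w else 0)"

lemma geometric_eqm:
  assumes "b \<in> big_oh 0" "n > 0"
  shows "eqm (int N + 1) (1 / (1 - b * X ^ n)) (\<Sum>w\<le>N. b ^ w * X ^ (n * w))"
    and "eqm (int N + 1) (b * X ^ n / (1 - b * X ^ n)) (\<Sum>w=1..N. b ^ w * X ^ (n * w))"
proof -
  define y where "y = b * X ^ n"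
  have y: "eqm (int n) (1 - y) 1" unfolding y_def by (rule eqm_one_minus) fact
  note inv = eqm_one_inverse[OF y]
  have nz: "1 - y \<noteq> 0" using inv(1) assms by simp
  have pow: "y ^ w = b ^ w * X ^ (n * w)" for w
    by (simp add: y_def power_mult_distrib power_mult)
  have "y ^ Suc N \<in> big_oh (int N + 1)"
  proof -
    have "N + 1 \<le> n * Suc N" using mult_le_mono1[of 1 n "Suc N"] assms by simp
    then have "X ^ (n * Suc N) \<in> big_oh (int N + 1)"
      by (intro big_oh_mono[OF big_oh_X]) (metis of_nat_1 of_nat_add of_nat_le_iff)
    then show ?thesis unfolding pow using assms by (intro big_oh_mult_left big_oh_power)
  qed
  then have r: "y ^ Suc N * inverse (1 - y) \<in> big_oh (int N + 1)"
    using inv(2) assms by (intro big_oh_mult_right) auto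
  have "(1 - y) * (\<Sum>w\<le>N. y ^ w) = 1 - y ^ Suc N"
    using one_diff_power_eq[of y "Suc N"] by (simp add: lessThan_Suc_atMost)
  then have "(\<Sum>w\<le>N. y ^ w) = (1 - y ^ Suc N) / (1 - y)"
    using nz by (simp add: eq_divide_eq mult.commute)
  then have "1 / (1 - y) - (\<Sum>w\<le>N. y ^ w) = y ^ Suc N * inverse (1 - y)"
    by (simp add: divide_inverse left_diff_distrib)
  then have *: "eqm (int N + 1) (1 / (1 - y)) (\<Sum>w\<le>N. y ^ w)" using r by (simp add: eqm_def)
  then show "eqm (int N + 1) (1 / (1 - b * X ^ n)) (\<Sum>w\<le>N. b ^ w * X ^ (n * w))"
    unfolding pow by (simp add: y_def)
  have "y / (1 - y) = 1 / (1 - y) - 1" using nz by (simp add: field_simps)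
  moreover have "(\<Sum>w=1..N. y ^ w) = (\<Sum>w\<le>N. y ^ w) - 1"
  proof -
    have "{..N} = insert 0 {1..N}" by auto
    then show ?thesis by (simp only: sum.insert finite_atLeastAtMost) simp
  qed
  ultimately have "eqm (int N + 1) (y / (1 - y)) (\<Sum>w=1..N. y ^ w)"
    using * by (simp add: eqm_def)
  then show "eqm (int N + 1) (b * X ^ n / (1 - b * X ^ n)) (\<Sum>w=1..N. b ^ w * X ^ (n * w))"
    unfolding pow by (simp add: y_def)
qed

definition hecke_series :: "real fls \<Rightarrow> nat \<Rightarrow> real fls" where
  "hecke_series b N = (\<Sum>n=1..N. hecke_sum X n * (b * X ^ n / (1 - b * X ^ n))) +
     (\<Sum>n=1..N. X ^ (2 * n - 1) * hecke_sum X (n - 1) * (1 / (1 - b * X ^ n)))"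

lemma hecke_series_nth: "hecke_series (fls_const b) N $$ int N = hecke_count b N"
proof -
  let ?b = "fls_const b"
  have b: "?b \<in> big_oh 0" by (simp add: big_oh_def)
  have 1: "(hecke_sum X n * (?b * X ^ n / (1 - ?b * X ^ n))) $$ int N =
      (\<Sum>w=1..N. \<Sum>j\<le>n. if n\<^sup>2 - j\<^sup>2 + n * w = N then mult_sign j * b ^ w else 0)"
    if "n \<in> {1..N}" for n
  proof -
    have "eqm (int N + 1) (hecke_sum X n * (?b * X ^ n / (1 - ?b * X ^ n)))
        (hecke_sum X n * (\<Sum>w=1..N. ?b ^ w * X ^ (n * w)))"
      using that by (intro eqm_cmult hecke_sum_big_oh geometric_eqm b) auto
    then have "(hecke_sum X n * (?b * X ^ n / (1 - ?b * X ^ n))) $$ int N =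
        (hecke_sum X n * (\<Sum>w=1..N. ?b ^ w * X ^ (n * w))) $$ int N"
      by (rule eqm_nth) simp
    also have "hecke_sum X n * (\<Sum>w=1..N. ?b ^ w * X ^ (n * w)) =
        (\<Sum>w=1..N. \<Sum>j\<le>n. fls_const (mult_sign j * b ^ w) * X ^ (n\<^sup>2 - j\<^sup>2 + n * w))"
      unfolding hecke_sum_eq sum_product
      by (subst sum.swap) (simp only: power_add fls_const_power mult_ac fls_const_mult_const[symmetric])
    finally show ?thesis by (simp only: fls_nth_sum monomial_nth)
  qed
  have 2: "(X ^ (2 * n - 1) * hecke_sum X (n - 1) * (1 / (1 - ?b * X ^ n))) $$ int N =
      (\<Sum>w\<le>N. \<Sum>j\<le>n - 1. if n\<^sup>2 - j\<^sup>2 + n * w = N then mult_sign j * b ^ w else 0)"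
    if "n \<in> {1..N}" for n
  proof -
    have e: "2 * n - 1 + ((n - 1)\<^sup>2 - j\<^sup>2) = n\<^sup>2 - j\<^sup>2" if "j \<le> n - 1" for j
    proof -
      obtain k where k: "n = Suc k" using \<open>n \<in> {1..N}\<close> by (cases n) auto
      have "j\<^sup>2 \<le> k\<^sup>2" using that k by (simp add: power_mono)
      then show ?thesis by (simp add: k power2_eq_square)
    qed
    have eq: "X ^ (2 * n - 1) * hecke_sum X (n - 1) =
        (\<Sum>j\<le>n - 1. fls_const (mult_sign j) * X ^ (n\<^sup>2 - j\<^sup>2))"
      unfolding hecke_sum_eq sum_distrib_left
    proof (intro sum.cong refl)
      fix j assume "j \<in> {..n - 1}"
      then show "X ^ (2 * n - 1) * (fls_const (mult_sign j) * X ^ ((n - 1)\<^sup>2 - j\<^sup>2)) =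
          fls_const (mult_sign j) * X ^ (n\<^sup>2 - j\<^sup>2)"
        by (simp only: mult.left_commute power_add[symmetric] e atMost_iff)
    qed
    have "eqm (int N + 1) (X ^ (2 * n - 1) * hecke_sum X (n - 1) * (1 / (1 - ?b * X ^ n)))
        (X ^ (2 * n - 1) * hecke_sum X (n - 1) * (\<Sum>w\<le>N. ?b ^ w * X ^ (n * w)))"
      using that by (intro eqm_cmult big_oh_mult_left hecke_sum_big_oh geometric_eqm b) auto
    then have "(X ^ (2 * n - 1) * hecke_sum X (n - 1) * (1 / (1 - ?b * X ^ n))) $$ int N =
        (X ^ (2 * n - 1) * hecke_sum X (n - 1) * (\<Sum>w\<le>N. ?b ^ w * X ^ (n * w))) $$ int N"
      by (rule eqm_nth) simp
    also have "X ^ (2 * n - 1) * hecke_sum X (n - 1) * (\<Sum>w\<le>N. ?b ^ w * X ^ (n * w)) =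
        (\<Sum>w\<le>N. \<Sum>j\<le>n - 1. fls_const (mult_sign j * b ^ w) * X ^ (n\<^sup>2 - j\<^sup>2 + n * w))"
      unfolding eq sum_product
      by (subst sum.swap) (simp only: power_add fls_const_power mult_ac fls_const_mult_const[symmetric])
    finally show ?thesis by (simp only: fls_nth_sum monomial_nth)
  qed
  show ?thesis unfolding hecke_series_def hecke_count_def fls_plus_nth fls_nth_sum
    by (intro arg_cong2[where f = "(+)"] sum.cong refl 1 2)
qed

text \<open>The second partial fraction of the kernel has to be shifted from \<open>n\<close> to
  \<open>n + 1\<close> to fit \<open>hecke_series\<close>. The shift loses the term at
  \<open>n = 1\<close>, which is \<open>b X / (1 - b X)\<close>, and adds one at
  \<open>N + 1\<close> beyond the precision.\<close>

lemma sum_hecke_kernel: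
  assumes b: "b * b = 1" "b \<in> big_oh 0"
  shows "eqm (int N + 1) (\<Sum>n=1..N. hecke_sum X n * nome.hecke_kernel b n)
    (b * hecke_series b N - b * X / (1 - b * X))"
proof -
  have nz: "1 - b * X ^ n \<noteq> 0" if "n > 0" for n
    using eqm_one_inverse(1)[OF eqm_one_minus[OF b(2), of n]] that by simp
  define f where "f n = X ^ (2 * n - 1) * hecke_sum X (n - 1) * (1 / (1 - b * X ^ n))" for n
  have bb: "b * (b * z) = z" for z by (simp flip: mult.assoc add: b)
  have "(\<Sum>n=1..N. hecke_sum X n * nome.hecke_kernel b n) =
      (\<Sum>n=1..N. b * (hecke_sum X n * (b * X ^ n / (1 - b * X ^ n))) + b * f (Suc n))"
  proof (intro sum.cong refl)
    fix n assume n: "n \<in> {1..N}"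
    have "nome.hecke_kernel b n = X ^ n / (1 - b * X ^ n) + b * X ^ (2 * n + 1) / (1 - b * X ^ Suc n)"
      by (rule nome.hecke_kernel_eq) (use n nz[of n] nz[of "Suc n"] b in \<open>auto simp del: power_Suc\<close>)
    then show "hecke_sum X n * nome.hecke_kernel b n =
        b * (hecke_sum X n * (b * X ^ n / (1 - b * X ^ n))) + b * f (Suc n)"
      by (simp add: f_def distrib_left mult_ac bb)
  qed
  also have "\<dots> = b * (\<Sum>n=1..N. hecke_sum X n * (b * X ^ n / (1 - b * X ^ n))) + b * (\<Sum>n=1..N. f (Suc n))"
    by (simp only: sum.distrib sum_distrib_left)
  also have "(\<Sum>n=1..N. f (Suc n)) = (\<Sum>n=1..N. f n) - f 1 + f (Suc N)"
    by (induction N) auto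
  also have "f 1 = X / (1 - b * X)" by (simp add: f_def)
  also have "b * (\<Sum>n=1..N. hecke_sum X n * (b * X ^ n / (1 - b * X ^ n))) +
      b * ((\<Sum>n=1..N. f n) - X / (1 - b * X) + f (Suc N)) =
      (b * hecke_series b N - b * X / (1 - b * X)) + b * f (Suc N)"
    by (simp add: hecke_series_def f_def[abs_def] algebra_simps)
  finally have *: "(\<Sum>n=1..N. hecke_sum X n * nome.hecke_kernel b n) =
      (b * hecke_series b N - b * X / (1 - b * X)) + b * f (Suc N)" .
  have "f (Suc N) \<in> big_oh (int N + 1)"
  proof -
    have "X ^ (2 * Suc N - 1) \<in> big_oh (int N + 1)" by (rule big_oh_mono[OF big_oh_X]) simp
    moreover have "inverse (1 - b * X ^ Suc N) \<in> big_oh 0"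
      using eqm_one_inverse(2)[OF eqm_one_minus[OF b(2), of "Suc N"]] by simp
    ultimately show ?thesis unfolding f_def
      by (intro big_oh_mult_right hecke_sum_big_oh) (simp_all add: divide_inverse)
  qed
  then show ?thesis unfolding * using b by (simp add: eqm_def big_oh_mult_left)
qed

lemma hecke_kernel_big_oh:
  assumes "b = 1 \<and> n > 0 \<or> b = - 1"
  shows "hecke_sum X n * nome.hecke_kernel b n \<in> big_oh (int n)"
proof -
  have b: "b \<in> big_oh 0" using assms by auto
  have i1: "inverse (1 - b * X ^ m) \<in> big_oh 0" if "m > 0" for m
    using eqm_one_inverse(2)[OF eqm_one_minus[OF b, of m]] that by simp
  have i2: "inverse (1 - b * X ^ n) \<in> big_oh 0"
  proof (cases "n = 0")
    case True
    \<comment> \<open>For \<open>n = 0\<close> and \<open>b = -1\<close> the denominator is the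
      constant 2, a unit because the coefficients are real.\<close>
    have "fls_subdegree (2 :: real fls) = 0" using fls_const_subdegree[of "2::real"] by simp
    then have "inverse (2 :: real fls) \<in> big_oh 0" by (simp only: big_oh_iff fls_inverse_subdegree) simp
    then show ?thesis using assms True by simp
  qed (simp add: i1)
  have i: "inverse (1 - b * X ^ n) * inverse (1 - b * X ^ Suc n) \<in> big_oh 0"
    by (rule big_oh_mult_left[OF i2 i1]) simp
  have "1 - X ^ (2 * n + 1) \<in> big_oh 0" by (intro big_oh_diff big_oh_one big_oh_X'(1))
  then have "hecke_sum X n * (X ^ n * (1 - X ^ (2 * n + 1)) *
      (inverse (1 - b * X ^ n) * inverse (1 - b * X ^ Suc n))) \<in> big_oh (int n)"
    by (intro big_oh_mult_left[OF hecke_sum_big_oh] big_oh_mult_right big_oh_X i)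
  then show ?thesis by (simp add: nome.hecke_kernel_def divide_inverse)
qed

lemma limit_factor_remove:
  assumes "b = 1 \<and> n > 0 \<or> b = - 1" "n \<le> N"
  shows "eqm (int N + 1) (hecke_sum X n * nome.hecke_kernel b n * nome.limit_factor N n) (hecke_sum X n * nome.hecke_kernel b n)"
proof -
  have "hecke_sum X n * nome.hecke_kernel b n * (nome.limit_factor N n - 1) \<in> big_oh (int n + (int N - int n + 1))"
    using hecke_kernel_big_oh[OF assms(1)] limit_factor_eqm[OF assms(2)] by (intro big_oh_mult) (auto simp: eqm_def)
  then show ?thesis by (simp add: eqm_def algebra_simps)
qed

text \<open>The separately evaluated \<open>n = 0\<close> term has limit \<open>X / (1 - X)\<close>
  and cancels exactly the term lost in the shift of \<open>sum_hecke_kernel\<close>.\<close>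

theorem rank_diff_eq_hecke_count:
  assumes "N > 0"
  shows "rank_diff N = - 2 * hecke_count 1 N"
proof -
  have nth: "signed_count m N = nome.theta_ratio m $$ int N" for m
    by (simp flip: fps_to_fls_signed_count)
  have "((-1) ^ m * f) $$ k = (-1) ^ m * f $$ k" for m k and f :: "real fls"
    by (cases "even m") simp_all
  then have "rank_diff N = (\<Sum>m=1..N. (-1) ^ m * (nome.theta_ratio m - nome.theta_ratio (m - 1))) $$ int N"
    unfolding rank_diff_eq[OF assms] nth by (simp add: fls_nth_sum)
  also have "(\<Sum>m=1..N. (-1) ^ m * (nome.theta_ratio m - nome.theta_ratio (m - 1))) =
      - 2 * ((X / (1 - X) - X ^ Suc N / (1 - X ^ Suc N)) +
        (\<Sum>n=1..N. hecke_sum X n * nome.hecke_kernel 1 n * nome.limit_factor N n))"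
    unfolding nome.theta_ratio_telescope nome.sum_theta_ratio_eq ..
  also have "\<dots> $$ int N = (- 2 * (X / (1 - X) + (hecke_series 1 N - X / (1 - X)))) $$ int N"
  proof (rule eqm_nth[of "int N + 1"], rule eqm_cmult)
    have "X ^ Suc N * inverse (1 - 1 * X ^ Suc N) \<in> big_oh (int N + 1)"
      using eqm_one_inverse(2)[OF eqm_one_minus[of 1 "Suc N"]] big_oh_X[of "Suc N"]
      by (intro big_oh_mult_right) (simp_all del: power_Suc add: add.commute)
    then have "eqm (int N + 1) (X / (1 - X) - X ^ Suc N / (1 - X ^ Suc N)) (X / (1 - X))"
      using big_oh_uminus by (simp add: eqm_def divide_inverse del: power_Suc)
    moreover have "eqm (int N + 1) (\<Sum>n=1..N. hecke_sum X n * nome.hecke_kernel 1 n * nome.limit_factor N n)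
        (\<Sum>n=1..N. hecke_sum X n * nome.hecke_kernel 1 n)"
      by (intro eqm_sum limit_factor_remove) auto
    moreover have "eqm (int N + 1) (\<Sum>n=1..N. hecke_sum X n * nome.hecke_kernel 1 n) (hecke_series 1 N - X / (1 - X))"
      using sum_hecke_kernel[of 1 N] by simp
    ultimately show "eqm (int N + 1) (X / (1 - X) - X ^ Suc N / (1 - X ^ Suc N) +
          (\<Sum>n = 1..N. hecke_sum X n * nome.hecke_kernel 1 n * nome.limit_factor N n))
        (X / (1 - X) + (hecke_series 1 N - X / (1 - X)))"
      by (intro eqm_add) (auto intro: eqm_trans)
    show "- 2 \<in> big_oh 0" by (intro big_oh_uminus) simp
  qed simp
  also have "(- 2 * (X / (1 - X) + (hecke_series 1 N - X / (1 - X)))) = fls_const (-2) * hecke_series (fls_const 1) N"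
    by simp
  also have "(fls_const (-2) * hecke_series (fls_const 1) N) $$ int N = - 2 * (hecke_series (fls_const 1) N $$ int N)"
    by simp
  finally show ?thesis unfolding hecke_series_nth .
qed

section \<open>The cube of the theta series\<close>

lemma qpoch_big_oh:
  assumes "b \<in> big_oh 0"
  shows "qpoch b X n \<in> big_oh 0"
  unfolding qpoch_def using assms
  by (induction n) (auto intro!: big_oh_mult_left big_oh_diff big_oh_one simp: big_oh_one simp del: power_Suc)

lemma inverse_qpoch_big_oh: "inverse (qpoch 1 X n) \<in> big_oh 0"
proof -
  have "eqm 1 (qpoch 1 X n / qpoch 1 X 0) 1"
    using qpoch_ratio[of 0 n 1] by simp
  then show ?thesis using eqm_one_inverse(2)[of 1 "qpoch 1 X n"] by simp
qed

text \<open>The \<open>q\<close>-binomial theorem by iteration of \<open>binomial_sum_shift\<close>: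
  passing from \<open>z = -X^(K+1)\<close> to \<open>z X\<close> produces the next factor of
  \<open>theta_ratio\<close>, and the boundary terms, divisible by \<open>z^(N+1)\<close>, are
  beyond the precision. After \<open>N\<close> steps the remaining series is 1 modulo
  \<open>X^(N+1)\<close>.\<close>

lemma binomial_sum_eqm_theta_ratio: "eqm (int N + 1) (nome.binomial_sum N (- X)) (nome.theta_ratio N)"
proof -
  have c: "2 * qpoch (-1) X N / qpoch 1 X N \<in> big_oh 0"
    by (simp add: divide_inverse big_oh_mult_left qpoch_big_oh inverse_qpoch_big_oh)
  have e: "2 * qpoch (-1) X m / ((1 + X ^ m) * qpoch 1 X m) \<in> big_oh 0" if "m > 0" for m
  proof -
    have "inverse (1 - (-1) * X ^ m) \<in> big_oh 0"
      using eqm_one_inverse(2)[OF eqm_one_minus[of "-1" m]] that by simp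
    then show ?thesis
      by (simp add: divide_inverse big_oh_mult_left qpoch_big_oh inverse_qpoch_big_oh)
  qed
  have small: "(- X) ^ m \<in> big_oh (int N + 1)" if "m > N" for m
  proof -
    have "X ^ m \<in> big_oh (int N + 1)" using that by (intro big_oh_mono[OF big_oh_X]) simp
    then show ?thesis using big_oh_mult_left[OF big_oh_power[of "-1" m]] by (simp add: power_minus[of X])
  qed
  have E0: "nome.binomial_sum N (- (X ^ Suc N)) - 1 \<in> big_oh (int N + 1)"
  proof -
    have "{..N} = insert 0 {1..N}" by auto
    then have "nome.binomial_sum N (- (X ^ Suc N)) - 1 =
        (\<Sum>m=1..N. 2 * qpoch (-1) X m / ((1 + X ^ m) * qpoch 1 X m) * (- (X ^ Suc N)) ^ m)"
      unfolding nome.binomial_sum_def by (simp only: sum.insert finite_atLeastAtMost) simp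
    also have "\<dots> \<in> big_oh (int N + 1)"
    proof (intro big_oh_sum big_oh_mult_left e)
      fix m assume m: "m \<in> {1..N}"
      then obtain k where k: "m = Suc k" by (cases m) auto
      have "X ^ Suc N \<in> big_oh (int N + 1)" by (intro big_oh_mono[OF big_oh_X]) simp
      moreover have "(- (X ^ Suc N)) ^ k \<in> big_oh 0" by (intro big_oh_power big_oh_uminus) simp
      ultimately show "(- (X ^ Suc N)) ^ m \<in> big_oh (int N + 1)"
        unfolding k power_Suc[of "- (X ^ Suc N)"] by (intro big_oh_mult_right big_oh_uminus)
    qed auto
    finally show ?thesis .
  qed
  have EO: "nome.binomial_sum N (- (X ^ Suc K)) \<in> big_oh 0" for K
    unfolding nome.binomial_sum_def
  proof (rule big_oh_sum)
    fix m
    show "2 * qpoch (-1) X m / ((1 + X ^ m) * qpoch 1 X m) * (- (X ^ Suc K)) ^ m \<in> big_oh 0"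
    proof (cases "m = 0")
      case False
      then show ?thesis by (intro big_oh_mult_left e big_oh_power big_oh_uminus) simp_all
    qed simp
  qed
  have "eqm (int N + 1) (nome.binomial_sum N (- X)) (nome.theta_ratio K * nome.binomial_sum N (- (X ^ Suc K)))" for K
  proof (induction K)
    case (Suc K)
    define x where "x = X ^ Suc K"
    have inv: "inverse (1 + x) \<in> big_oh 0" "1 + x \<noteq> 0"
      using eqm_one_inverse(1,2)[OF eqm_one_minus[of "-1" "Suc K"]] by (simp_all add: x_def)
    have "(- x) ^ Suc N \<in> big_oh (int N + 1)"
    proof -
      have "(- x) ^ Suc N = (- X) ^ Suc N * (X ^ K) ^ Suc N"
        by (simp add: x_def flip: power_mult_distrib power_Suc)
      moreover have "(X ^ K) ^ Suc N \<in> big_oh 0" by (intro big_oh_power) simp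
      ultimately show ?thesis using small[of "Suc N"] by (simp add: big_oh_mult_right del: power_Suc)
    qed
    then have "- (2 * qpoch (-1) X N / qpoch 1 X N) * (- x) ^ Suc N \<in> big_oh (int N + 1)"
      by (intro big_oh_mult_left big_oh_uminus c)
    then have "(1 - - x) * nome.binomial_sum N (- x) - (1 + - x) * nome.binomial_sum N (- x * X) \<in> big_oh (int N + 1)"
      unfolding nome.binomial_sum_shift .
    then have "eqm (int N + 1) ((1 + x) * nome.binomial_sum N (- x)) ((1 - x) * nome.binomial_sum N (- (X ^ Suc (Suc K))))"
      by (simp add: eqm_def x_def mult_ac)
    then have "eqm (int N + 1) ((nome.theta_ratio K * inverse (1 + x)) * ((1 + x) * nome.binomial_sum N (- x)))
       ((nome.theta_ratio K * inverse (1 + x)) * ((1 - x) * nome.binomial_sum N (- (X ^ Suc (Suc K)))))"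
      by (intro eqm_cmult big_oh_mult_left theta_ratio_big_oh inv)
    moreover have "(nome.theta_ratio K * inverse (1 + x)) * ((1 + x) * nome.binomial_sum N (- x)) = nome.theta_ratio K * nome.binomial_sum N (- (X ^ Suc K))"
      using inv(2) by (simp add: x_def)
    moreover have "nome.theta_ratio (Suc K) = nome.theta_ratio K * inverse (1 + x) * (1 - x)"
      using nome.theta_ratio_Suc[of K, folded x_def] inv(2) by (simp add: field_simps)
    ultimately have "eqm (int N + 1) (nome.theta_ratio K * nome.binomial_sum N (- (X ^ Suc K)))
        (nome.theta_ratio (Suc K) * nome.binomial_sum N (- (X ^ Suc (Suc K))))"
      by (simp only: mult.assoc)
    then show ?case using Suc eqm_trans by blast
  qed simp
  from this[of N] have "eqm (int N + 1) (nome.binomial_sum N (- X)) (nome.theta_ratio N * nome.binomial_sum N (- (X ^ Suc N)))" .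
  moreover have "eqm (int N + 1) (nome.theta_ratio N * nome.binomial_sum N (- (X ^ Suc N))) (nome.theta_ratio N * 1)"
    using E0 by (intro eqm_cmult theta_ratio_big_oh) (simp add: eqm_def)
  ultimately show ?thesis using eqm_trans by fastforce
qed

text \<open>Clearing denominators in \<open>binomial_sum_eq\<close> leaves
  \<open>binomial_sum\<close>, \<open>theta_ratio N\<close> and \<open>theta_ratio (Suc N)\<close>,
  each congruent to \<open>theta N\<close>. On the other side the \<open>n = 0\<close> kernel and
  the term lost in the shift combine to the constant 1.\<close>

lemma theta_cube: "eqm (int N + 1) (theta N ^ 3) (1 - 2 * hecke_series (-1) N)"
proof -
  let ?k = "int N + 1"
  have nz: "nome.theta_ratio m \<noteq> 0" for m by (simp add: nome.theta_ratio_def)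
  have "eqm ?k (theta N * (theta N * theta N)) (nome.binomial_sum N (- X) * (nome.theta_ratio N * nome.theta_ratio (Suc N)))"
    by (intro eqm_mult theta_big_oh big_oh_mult_left theta_ratio_big_oh eqm_sym[OF theta_ratio_eqm_theta] eqm_sym[OF theta_ratio_Suc_eqm]
        eqm_sym[OF eqm_trans[OF binomial_sum_eqm_theta_ratio theta_ratio_eqm_theta]])
  also have "nome.binomial_sum N (- X) * (nome.theta_ratio N * nome.theta_ratio (Suc N)) =
      2 * (\<Sum>n\<le>N. hecke_sum X n * nome.hecke_kernel (-1) n * nome.limit_factor N n)"
    unfolding nome.binomial_sum_eq using nz by simp
  also have "eqm ?k \<dots> (2 * (\<Sum>n\<le>N. hecke_sum X n * nome.hecke_kernel (-1) n))"
    by (intro eqm_cmult eqm_sum limit_factor_remove) auto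
  also have "(\<Sum>n\<le>N. hecke_sum X n * nome.hecke_kernel (-1) n) =
      nome.hecke_kernel (-1) 0 + (\<Sum>n=1..N. hecke_sum X n * nome.hecke_kernel (-1) n)"
  proof -
    have "{..N} = insert 0 {1..N}" by auto
    then show ?thesis by (simp only: sum.insert finite_atLeastAtMost) simp
  qed
  also have "eqm ?k (2 * \<dots>) (2 * (nome.hecke_kernel (-1) 0 + (-1 * hecke_series (-1) N - -1 * X / (1 - -1 * X))))"
    by (intro eqm_cmult eqm_add sum_hecke_kernel) auto
  also have "2 * (nome.hecke_kernel (-1) 0 + (-1 * hecke_series (-1) N - -1 * X / (1 - -1 * X))) =
      1 - 2 * hecke_series (-1) N"
  proof -
    have nz: "1 + X \<noteq> 0" using nome.one_plus_nz(1)[of 1] by simp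
    have cancel: "2 * (a / (2 * y)) = a / y" for a y :: "real fls" by simp
    have "nome.hecke_kernel (-1) 0 = (1 - X) / (2 * (1 + X))" by (simp add: nome.hecke_kernel_def)
    then have "2 * nome.hecke_kernel (-1) 0 + 2 * (X / (1 + X)) = ((1 - X) + 2 * X) / (1 + X)"
      unfolding add_divide_distrib using cancel[of "1 - X" "1 + X"] by simp
    also have "\<dots> = 1" using nz by simp
    finally have "2 * nome.hecke_kernel (-1) 0 + 2 * (X / (1 + X)) = 1" .
    then show ?thesis by (simp add: algebra_simps)
  qed
  finally show ?thesis by (simp add: power3_eq_cube mult.assoc)
qed

definition three_squares_sum :: "nat \<Rightarrow> real" where
  "three_squares_sum N = (\<Sum>x\<le>N. \<Sum>y\<le>N. \<Sum>z\<le>N.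
     if x\<^sup>2 + y\<^sup>2 + z\<^sup>2 = N then mult_sign x * mult_sign y * mult_sign z else 0)"

theorem three_squares_sum_eq_hecke_count:
  assumes "N > 0"
  shows "three_squares_sum N = - 2 * hecke_count (-1) N"
proof -
  have "theta N ^ 3 = (\<Sum>x\<le>N. \<Sum>y\<le>N. \<Sum>z\<le>N.
      fls_const (mult_sign x * mult_sign y * mult_sign z) * X ^ (x\<^sup>2 + y\<^sup>2 + z\<^sup>2))"
    unfolding theta_eq power3_eq_cube sum_product sum_distrib_left sum_distrib_right
    by (simp only: power_add mult_ac fls_const_mult_const[symmetric])
  then have "three_squares_sum N = (theta N ^ 3) $$ int N"
    by (simp only: three_squares_sum_def fls_nth_sum monomial_nth)
  also have "\<dots> = (1 - 2 * hecke_series (-1) N) $$ int N"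
    by (rule eqm_nth[OF theta_cube]) simp
  also have "1 - 2 * hecke_series (-1) N = 1 + fls_const (-2) * hecke_series (fls_const (-1)) N"
    by simp
  also have "\<dots> $$ int N = - 2 * hecke_count (-1) N"
    using assms by (simp only: fls_plus_nth) (simp flip: hecke_series_nth)
  finally show ?thesis .
qed

section \<open>Comparison with sums of three squares\<close>

definition triples :: "nat \<Rightarrow> (nat \<times> nat \<times> nat) set" where
  "triples N = {(x, y, z). x * y + y * z + z * x = N}"

definition triple_weight :: "nat \<times> nat \<times> nat \<Rightarrow> real" where
  "triple_weight = (\<lambda>(x, y, z). if x = 0 \<or> y = 0 \<or> z = 0 then 2 else 4)"

lemma finite_triples:
  assumes "N > 0"
  shows "finite (triples N)"
proof (rule finite_subset)
  have "x \<le> N" if "x * y + y * z + z * x = N" for x y z :: nat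
  proof (cases "y = 0 \<and> z = 0")
    case False
    then have "x * 1 \<le> x * (y + z)" by (intro mult_le_mono) auto
    also have "\<dots> \<le> N" using that by (simp add: algebra_simps)
    finally show ?thesis by simp
  qed (use that assms in auto)
  from this show "triples N \<subseteq> {..N} \<times> {..N} \<times> {..N}"
    unfolding triples_def by (auto simp: algebra_simps) (metis add.commute add.left_commute mult.commute)+
qed auto

lemma sum_nested_filter:
  fixes f :: "nat \<Rightarrow> nat \<Rightarrow> nat \<Rightarrow> real"
  assumes "finite A" "\<And>n. finite (C n)" "finite B"
  shows "(\<Sum>n\<in>A. \<Sum>w\<in>B. \<Sum>j\<in>C n. if P n w j then f n w j else 0) =
    (\<Sum>(n, w, j)\<in>{(n, w, j). n \<in> A \<and> w \<in> B \<and> j \<in> C n \<and> P n w j}. f n w j)"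
proof -
  have "(\<Sum>n\<in>A. \<Sum>w\<in>B. \<Sum>j\<in>C n. if P n w j then f n w j else 0) =
    (\<Sum>(n, w, j)\<in>(SIGMA n:A. B \<times> C n). if P n w j then f n w j else 0)"
    using assms by (simp add: sum.Sigma sum.cartesian_product)
  also have "\<dots> = (\<Sum>(n, w, j)\<in>{(n, w, j). n \<in> A \<and> w \<in> B \<and> j \<in> C n \<and> P n w j}. f n w j)"
    using assms by (intro sum.mono_neutral_cong_right) (auto intro: finite_SigmaI split: if_splits)
  finally show ?thesis .
qed

lemma hecke_exponent:
  "(x + y)\<^sup>2 - x\<^sup>2 + (x + y) * w = x * y + y * (y + w) + (y + w) * x" for x y w :: nat
proof -
  have "(x + y)\<^sup>2 - x\<^sup>2 = 2 * x * y + y * y" by (simp add: power2_eq_square algebra_simps)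
  then show ?thesis by (simp add: algebra_simps)
qed

text \<open>The two families become the ranges \<open>y < z\<close> and
  \<open>0 < y \<le> z\<close>. Doubling adds their mirror images in \<open>y\<close> and
  \<open>z\<close>: a triple with \<open>y\<close> and \<open>z\<close> positive is then met twice,
  one with \<open>y\<close> or \<open>z\<close> zero only once. \<open>mult_sign\<close> contributes
  a further 2 exactly if \<open>x > 0\<close>, and the product is the symmetric
  \<open>triple_weight\<close>. As \<open>b * b = 1\<close>, \<open>b^w\<close> with
  \<open>w = z - y\<close> equals \<open>b^(y+z)\<close>.\<close>

lemma hecke_count_eq_triples:
  assumes "N > 0" and b: "b * b = 1"
  shows "2 * hecke_count b N = (\<Sum>(x, y, z)\<in>triples N. triple_weight (x, y, z) * ((-1) ^ x * b ^ (y + z)))"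
proof -
  let ?S = "triples N"
  let ?i = "\<lambda>(x, y, z). (x + y, z - y, x)" and ?j = "\<lambda>(n, w, j). (j, n - j, n - j + w)"
  define f where "f = (\<lambda>(x, y, z). mult_sign x * b ^ (y + z))"
  have fin: "finite ?S" using finite_triples assms by blast
  have bpow: "b ^ (y + (y + w)) = b ^ w" for y w
  proof -
    have "b ^ (y + (y + w)) = (b * b) ^ y * b ^ w" by (simp add: power_add power_mult_distrib)
    then show ?thesis by (simp add: b)
  qed
  have A: "(\<Sum>n=1..N. \<Sum>w=1..N. \<Sum>j\<le>n. if n\<^sup>2 - j\<^sup>2 + n * w = N then mult_sign j * b ^ w else 0)
     = (\<Sum>t\<in>{t \<in> ?S. case t of (x, y, z) \<Rightarrow> y < z}. f t)"
    unfolding sum_nested_filter[OF finite_atLeastAtMost finite_atMost finite_atLeastAtMost]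
  proof (rule sum.reindex_bij_witness[where i = ?i and j = ?j])
    fix t assume t_in: "t \<in> {(n, w, j). n \<in> {1..N} \<and> w \<in> {1..N} \<and> j \<in> {..n} \<and> n\<^sup>2 - j\<^sup>2 + n * w = N}"
    obtain n w j where t: "t = (n, w, j)" by (rule prod_cases3)
    have h: "n \<in> {1..N}" "w \<in> {1..N}" "j \<in> {..n}" "n\<^sup>2 - j\<^sup>2 + n * w = N"
      using t_in by (simp_all only: t mem_Collect_eq prod.case)
    define y where "y = n - j"
    have n: "n = j + y" using h by (simp add: y_def)
    show "?i (?j t) = t" using h by (simp add: t)
    show "?j t \<in> {t \<in> ?S. case t of (x, y, z) \<Rightarrow> y < z}"
      using h hecke_exponent[of j y w] by (simp add: t triples_def n)
    show "f (?j t) = (case t of (n, w, j) \<Rightarrow> mult_sign j * b ^ w)"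
      by (simp add: t f_def bpow)
  next
    fix t assume t_in: "t \<in> {t \<in> ?S. case t of (x, y, z) \<Rightarrow> y < z}"
    obtain x y z where t: "t = (x, y, z)" by (rule prod_cases3)
    have h: "(x, y, z) \<in> ?S" "y < z"
      using t_in by (simp_all only: t mem_Collect_eq prod.case)
    define w where "w = z - y"
    have z: "z = y + w" using h by (simp add: w_def)
    have e: "(x + y)\<^sup>2 - x\<^sup>2 + (x + y) * w = N"
      using h hecke_exponent[of x y w] by (simp add: triples_def z)
    have "w > 0" using h z by simp
    have "x + y > 0" using h \<open>N > 0\<close> by (cases "x + y = 0") (auto simp: triples_def)
    have "(x + y) * w \<le> N" using le_add2[of "(x + y) * w" "(x + y)\<^sup>2 - x\<^sup>2"] unfolding e .
    moreover have "(x + y) * 1 \<le> (x + y) * w" "1 * w \<le> (x + y) * w"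
      using \<open>w > 0\<close> \<open>x + y > 0\<close> by (intro mult_le_mono2 mult_le_mono1; linarith)+
    ultimately have "x + y \<le> N" "w \<le> N" unfolding mult_1 mult_1_right by linarith+
    then show "?i t \<in> {(n, w, j). n \<in> {1..N} \<and> w \<in> {1..N} \<and> j \<in> {..n} \<and> n\<^sup>2 - j\<^sup>2 + n * w = N}"
      using e \<open>w > 0\<close> \<open>x + y > 0\<close> by (simp add: t z, linarith)
    show "?j (?i t) = t" using h by (simp add: t)
  qed
  have B: "(\<Sum>n=1..N. \<Sum>w\<le>N. \<Sum>j\<le>n - 1. if n\<^sup>2 - j\<^sup>2 + n * w = N then mult_sign j * b ^ w else 0)
     = (\<Sum>t\<in>{t \<in> ?S. case t of (x, y, z) \<Rightarrow> 0 < y \<and> y \<le> z}. f t)"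
    unfolding sum_nested_filter[OF finite_atLeastAtMost finite_atMost finite_atMost]
  proof (rule sum.reindex_bij_witness[where i = ?i and j = ?j])
    fix t assume t_in: "t \<in> {(n, w, j). n \<in> {1..N} \<and> w \<in> {..N} \<and> j \<in> {..n - 1} \<and> n\<^sup>2 - j\<^sup>2 + n * w = N}"
    obtain n w j where t: "t = (n, w, j)" by (rule prod_cases3)
    have h: "n \<in> {1..N}" "w \<in> {..N}" "j \<in> {..n - 1}" "n\<^sup>2 - j\<^sup>2 + n * w = N"
      using t_in by (simp_all only: t mem_Collect_eq prod.case)
    define y where "y = n - j"
    have n: "n = j + y" "y > 0" using h by (auto simp: y_def)
    show "?i (?j t) = t" using n by (simp add: t)
    show "?j t \<in> {t \<in> ?S. case t of (x, y, z) \<Rightarrow> 0 < y \<and> y \<le> z}"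
      using h hecke_exponent[of j y w] n(2) by (simp add: t triples_def n(1))
    show "f (?j t) = (case t of (n, w, j) \<Rightarrow> mult_sign j * b ^ w)"
      by (simp add: t f_def bpow)
  next
    fix t assume t_in: "t \<in> {t \<in> ?S. case t of (x, y, z) \<Rightarrow> 0 < y \<and> y \<le> z}"
    obtain x y z where t: "t = (x, y, z)" by (rule prod_cases3)
    have h: "(x, y, z) \<in> ?S" "0 < y" "y \<le> z"
      using t_in by (simp_all only: t mem_Collect_eq prod.case)
    define w where "w = z - y"
    have z: "z = y + w" using h by (simp add: w_def)
    have e: "(x + y)\<^sup>2 - x\<^sup>2 + (x + y) * w = N"
      using h hecke_exponent[of x y w] by (simp add: triples_def z)
    have "w * 1 \<le> w * (x + y)" using h by (intro mult_le_mono2) simp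
    moreover have "(x + y) * w \<le> N" using le_add2[of "(x + y) * w" "(x + y)\<^sup>2 - x\<^sup>2"] unfolding e .
    ultimately have w: "w \<le> N" by (simp only: mult.commute[of w] mult_1_right)
    have "x * 1 \<le> x * y" "y * 1 \<le> y * (y + w)" using h by (auto intro: mult_le_mono2)
    moreover have "x * y + y * (y + w) \<le> N" using h by (simp add: triples_def z)
    ultimately have "x + y \<le> N" by linarith
    then show "?i t \<in> {(n, w, j). n \<in> {1..N} \<and> w \<in> {..N} \<and> j \<in> {..n - 1} \<and> n\<^sup>2 - j\<^sup>2 + n * w = N}"
      using e h w by (auto simp add: t z)
    show "?j (?i t) = t" using h by (simp add: t)
  qed
  have swap: "(\<Sum>t\<in>{t \<in> ?S. case t of (x, y, z) \<Rightarrow> Q y z}. f t) = (\<Sum>t\<in>{t \<in> ?S. case t of (x, y, z) \<Rightarrow> Q z y}. f t)" for Q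
    by (rule sum.reindex_bij_witness[where i = "\<lambda>(x, y, z). (x, z, y)" and j = "\<lambda>(x, y, z). (x, z, y)"])
       (auto simp: triples_def f_def add.commute algebra_simps)
  have filt: "(\<Sum>t\<in>{t \<in> ?S. Q t}. f t) = (\<Sum>t\<in>?S. (if Q t then f t else 0))" for Q
    using fin by (simp add: sum.inter_filter)
  have "2 * hecke_count b N =
      ((\<Sum>t\<in>{t \<in> ?S. case t of (x, y, z) \<Rightarrow> y < z}. f t) + (\<Sum>t\<in>{t \<in> ?S. case t of (x, y, z) \<Rightarrow> z < y}. f t)) +
      ((\<Sum>t\<in>{t \<in> ?S. case t of (x, y, z) \<Rightarrow> 0 < y \<and> y \<le> z}. f t) +
       (\<Sum>t\<in>{t \<in> ?S. case t of (x, y, z) \<Rightarrow> 0 < z \<and> z \<le> y}. f t))"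
    unfolding hecke_count_def A B using swap[of "\<lambda>y z. y < z"] swap[of "\<lambda>y z. 0 < y \<and> y \<le> z"] by simp
  also have "\<dots> = (\<Sum>t\<in>?S. case t of (x, y, z) \<Rightarrow> triple_weight (x, y, z) * ((-1) ^ x * b ^ (y + z)))"
    unfolding filt sum.distrib[symmetric]
  proof (intro sum.cong refl, clarify)
    fix x y z assume h: "(x, y, z) \<in> ?S"
    then have nz: "x = 0 \<Longrightarrow> y \<noteq> 0 \<and> z \<noteq> 0" "y = 0 \<Longrightarrow> z \<noteq> 0"
      using \<open>N > 0\<close> by (auto simp: triples_def)
    consider "y < z" | "y = z" | "z < y" by linarith
    then show "(if y < z then f (x, y, z) else 0) + (if z < y then f (x, y, z) else 0) +
        ((if 0 < y \<and> y \<le> z then f (x, y, z) else 0) + (if 0 < z \<and> z \<le> y then f (x, y, z) else 0)) =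
        triple_weight (x, y, z) * ((-1) ^ x * b ^ (y + z))"
      by cases (use nz in \<open>auto simp: f_def triple_weight_def mult_sign_def\<close>)
  qed
  finally show ?thesis .
qed

text \<open>Three even entries give \<open>N\<close> divisible by 4 and three odd ones give
  \<open>N\<close> equal to 3 modulo 4. So one or two entries are odd, and the signs can be compared
  directly.\<close>

lemma parity_identity:
  assumes "N mod 4 = 1 \<or> N mod 4 = 2" "x * y + y * z + z * x = N"
  shows "(-1) ^ x + (-1) ^ y + (-1) ^ z = - ((-1) ^ (x + y + z) :: real)"
proof -
  have "\<not> (even x \<and> even y \<and> even z)"
  proof
    assume "even x \<and> even y \<and> even z"
    then obtain a b c where "x = 2 * a" "y = 2 * b" "z = 2 * c" by (auto elim!: evenE)
    then have "N = 4 * (a * b + b * c + c * a)" using assms(2) by (simp add: algebra_simps)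
    then show False using assms(1) by simp
  qed
  moreover have "\<not> (odd x \<and> odd y \<and> odd z)"
  proof
    assume "odd x \<and> odd y \<and> odd z"
    then obtain a b c where "x = 2 * a + 1" "y = 2 * b + 1" "z = 2 * c + 1" by (auto elim!: oddE)
    then have "N = 4 * (a * b + b * c + c * a + a + b + c) + 3" using assms(2) by (simp add: algebra_simps)
    then show False using assms(1) by (simp add: mod_mult_self4 flip: mod_add_eq)
  qed
  ultimately show ?thesis by (auto simp: minus_one_power_iff)
qed

text \<open>For \<open>b = 1\<close> the sign depends on one coordinate only, for
  \<open>b = -1\<close> on \<open>x + y + z\<close>. Since triples and weights are symmetric,
  averaging over the coordinates makes \<open>parity_identity\<close> applicable.\<close>

theorem rank_diff_eq_three_squares_sum:
  assumes "N mod 4 = 1 \<or> N mod 4 = 2"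
  shows "3 * rank_diff N = - three_squares_sum N"
proof -
  have N: "N > 0" using assms by (cases N) auto
  let ?S = "triples N" and ?w = triple_weight
  have "(\<Sum>(x, y, z)\<in>?S. ?w (x, y, z) * (-1) ^ y) = (\<Sum>(x, y, z)\<in>?S. ?w (x, y, z) * (-1) ^ x)"
    by (rule sum.reindex_bij_witness[where i = "\<lambda>(x, y, z). (y, x, z)" and j = "\<lambda>(x, y, z). (y, x, z)"])
       (auto simp: triples_def triple_weight_def algebra_simps)
  moreover have "(\<Sum>(x, y, z)\<in>?S. ?w (x, y, z) * (-1) ^ z) = (\<Sum>(x, y, z)\<in>?S. ?w (x, y, z) * (-1) ^ x)"
    by (rule sum.reindex_bij_witness[where i = "\<lambda>(x, y, z). (z, y, x)" and j = "\<lambda>(x, y, z). (z, y, x)"])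
       (auto simp: triples_def triple_weight_def algebra_simps)
  moreover have "2 * hecke_count 1 N = (\<Sum>(x, y, z)\<in>?S. ?w (x, y, z) * (-1) ^ x)"
    using hecke_count_eq_triples[of N 1] N by simp
  ultimately have "3 * (2 * hecke_count 1 N) =
      (\<Sum>(x, y, z)\<in>?S. ?w (x, y, z) * (-1) ^ x) + (\<Sum>(x, y, z)\<in>?S. ?w (x, y, z) * (-1) ^ y)
      + (\<Sum>(x, y, z)\<in>?S. ?w (x, y, z) * (-1) ^ z)"
    by simp
  also have "\<dots> = (\<Sum>(x, y, z)\<in>?S. ?w (x, y, z) * ((-1) ^ x + (-1) ^ y + (-1) ^ z))"
    by (simp add: case_prod_unfold distrib_left flip: sum.distrib)
  also have "\<dots> = (\<Sum>(x, y, z)\<in>?S. - (?w (x, y, z) * ((-1) ^ x * (-1) ^ (y + z))))"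
    by (intro sum.cong refl) (auto simp: triples_def parity_identity[OF assms] power_add mult_ac)
  also have "\<dots> = - (2 * hecke_count (-1) N)"
    using hecke_count_eq_triples[of N "-1"] N by (simp add: case_prod_unfold sum_negf)
  finally show ?thesis
    using rank_diff_eq_hecke_count[OF N] three_squares_sum_eq_hecke_count[OF N] by simp
qed

section \<open>Representations by binary forms\<close>

text \<open>The divisors of \<open>p m\<close> are those of \<open>m\<close> together with their
  multiples by \<open>p\<close>; the overlap consists of the \<open>p\<close>-multiples of divisors
  of \<open>m div p\<close>.\<close>

lemma sum_dvd_mult_prime:
  fixes chi :: "nat \<Rightarrow> int"
  assumes p: "prime p" and m: "m > 0" and chi: "\<And>d. chi (p * d) = chi p * chi d"
  shows "(\<Sum>d | d dvd p * m. chi d) =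
    (1 + chi p) * (\<Sum>d | d dvd m. chi d) - (if p dvd m then chi p * (\<Sum>d | d dvd m div p. chi d) else 0)"
proof -
  let ?D = "\<lambda>m. {d. d dvd m}"
  have p0: "p > 0" using p by (simp add: prime_gt_0_nat)
  have fin: "finite (?D k)" if "k > 0" for k :: nat using that by simp
  have scale: "sum chi ((*) p ` ?D k) = chi p * (\<Sum>d\<in>?D k. chi d)" for k
    using p0 by (subst sum.reindex) (auto simp: inj_on_def chi sum_distrib_left)
  have U: "?D (p * m) = ?D m \<union> (*) p ` ?D m"
  proof (intro subset_antisym subsetI)
    fix d assume d: "d \<in> ?D (p * m)"
    show "d \<in> ?D m \<union> (*) p ` ?D m"
    proof (cases "p dvd d")
      case True
      then obtain e where "d = p * e" by auto
      then show ?thesis using d p0 by auto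
    next
      case False
      then have "coprime d p" using p prime_imp_coprime coprime_commute by blast
      then show ?thesis using d coprime_dvd_mult_right_iff by auto
    qed
  qed auto
  have I: "?D m \<inter> (*) p ` ?D m = (if p dvd m then (*) p ` ?D (m div p) else {})"
  proof (cases "p dvd m")
    case True
    then obtain k where k: "m = p * k" by auto
    have "?D m \<inter> (*) p ` ?D m = (*) p ` ?D k" using p0 by (auto simp: k)
    then show ?thesis using True p0 by (simp add: k)
  next
    case False
    then show ?thesis by (auto dest: dvd_mult_left)
  qed
  have "sum chi (?D (p * m)) + sum chi (?D m \<inter> (*) p ` ?D m) = sum chi (?D m) + sum chi ((*) p ` ?D m)"
    unfolding U using m fin by (intro sum.union_inter) auto
  then have *: "sum chi (?D (p * m)) + (if p dvd m then chi p * sum chi (?D (m div p)) else 0) =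
      sum chi (?D m) + chi p * sum chi (?D m)"
    unfolding I by (cases "p dvd m") (simp_all only: scale if_True if_False sum.empty)
  show ?thesis unfolding distrib_right mult_1 using * by linarith
qed

text \<open>The hypothesis covers all divisors of \<open>m\<close> because the recursions at a prime
  also refer to \<open>m div p\<close>.\<close>

lemma nat_prime_induct [consumes 1, case_names one mult]:
  fixes m :: nat
  assumes "m > 0" "P 1" "\<And>p m. prime p \<Longrightarrow> m > 0 \<Longrightarrow> (\<And>k. k dvd m \<Longrightarrow> P k) \<Longrightarrow> P (p * m)"
  shows "P m"
  using assms(1)
proof (induction m rule: less_induct)
  case (less m)
  show ?case
  proof (cases "m = 1")
    case False
    then obtain p k where p: "prime p" and m: "m = p * k" by (metis prime_factor_nat dvd_def)
    have "k > 0" using less.prems m by simp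
    have "P j" if "j dvd k" for j
    proof (rule less.IH)
      have "j \<le> k" using that \<open>k > 0\<close> by (simp add: dvd_imp_le)
      also have "k < m" using \<open>k > 0\<close> prime_gt_1_nat[OF p] by (simp add: m)
      finally show "j < m" .
      show "j > 0" using that \<open>k > 0\<close> by (auto intro: Nat.gr0I)
    qed
    then show ?thesis unfolding m using p \<open>k > 0\<close> assms(3) by blast
  qed (use assms in simp)
qed

section \<open>Representations by \<open>x^2 + D y^2\<close> and multiplication by a prime\<close>

definition form_reps :: "int \<Rightarrow> nat \<Rightarrow> (int \<times> int) set" where
  "form_reps D m = {(x, y). x\<^sup>2 + D * y\<^sup>2 = int m}"

lemma finite_form_reps:
  assumes "D > 0"
  shows "finite (form_reps D m)"
proof -
  have "form_reps D m \<subseteq> {- int m..int m} \<times> {- int m..int m}"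
  proof (clarsimp simp: form_reps_def)
    fix x y assume h: "x\<^sup>2 + D * y\<^sup>2 = int m"
    have sq: "\<bar>z\<bar> \<le> z\<^sup>2" for z :: int
      by (metis abs_ge_zero abs_mult_self_eq int_one_le_iff_zero_less le_less mult_le_cancel_left1 not_less power2_eq_square)
    have "y\<^sup>2 \<le> D * y\<^sup>2" using assms by (simp add: mult_le_cancel_right1)
    moreover have "0 \<le> y\<^sup>2" "0 \<le> x\<^sup>2" by simp_all
    ultimately have "\<bar>x\<bar> \<le> int m" "\<bar>y\<bar> \<le> int m" using sq[of x] sq[of y] h by linarith+
    then show "- int m \<le> x \<and> x \<le> int m \<and> - int m \<le> y \<and> y \<le> int m" by auto
  qed
  then show ?thesis by (rule finite_subset) simp
qed

lemma card_form_reps_inert: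
  assumes p: "prime p" and inert: "\<And>x y. int p dvd x\<^sup>2 + D * y\<^sup>2 \<Longrightarrow> int p dvd x \<and> int p dvd y"
  shows "card (form_reps D (p * m)) = (if p dvd m then card (form_reps D (m div p)) else 0)"
proof -
  have p0: "int p \<noteq> 0" using p by (simp add: prime_gt_0_nat)
  have *: "\<exists>u v. x = int p * u \<and> y = int p * v \<and> int p * (u\<^sup>2 + D * v\<^sup>2) = int m"
    if "(x, y) \<in> form_reps D (p * m)" for x y
  proof -
    have h: "x\<^sup>2 + D * y\<^sup>2 = int p * int m" using that by (simp add: form_reps_def)
    then obtain u v where uv: "x = int p * u" "y = int p * v" using inert[of x y] by (metis dvd_def dvd_triv_left)
    have "int p * (int p * (u\<^sup>2 + D * v\<^sup>2)) = int p * int m"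
      using h unfolding uv by (simp add: power2_eq_square algebra_simps)
    then show ?thesis using uv p0 by auto
  qed
  show ?thesis
  proof (cases "p dvd m")
    case True
    then obtain k where k: "m = p * k" by auto
    have "bij_betw (\<lambda>(u, v). (int p * u, int p * v)) (form_reps D k) (form_reps D (p * m))"
    proof (rule bij_betw_imageI)
      show "inj_on (\<lambda>(u, v). (int p * u, int p * v)) (form_reps D k)"
        using p0 by (auto simp: inj_on_def)
      have "(int p * u, int p * v) \<in> form_reps D (p * m)" if "(u, v) \<in> form_reps D k" for u v
      proof -
        have "(int p * u)\<^sup>2 + D * (int p * v)\<^sup>2 = int p * int p * (u\<^sup>2 + D * v\<^sup>2)"
          by (simp add: power2_eq_square algebra_simps)
        then show ?thesis using that by (simp add: form_reps_def k)
      qed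
      moreover have "\<exists>u v. (u, v) \<in> form_reps D k \<and> x = int p * u \<and> y = int p * v"
        if "(x, y) \<in> form_reps D (p * m)" for x y
        using *[OF that] p0 by (auto simp: form_reps_def k)
      ultimately show "(\<lambda>(u, v). (int p * u, int p * v)) ` form_reps D k = form_reps D (p * m)"
        by fastforce
    qed
    then have "card (form_reps D k) = card (form_reps D (p * m))" by (rule bij_betw_same_card)
    then show ?thesis using True p0 by (simp add: k)
  next
    case False
    then have "int p * z \<noteq> int m" for z by (metis dvd_triv_left int_dvd_int_iff)
    then have "form_reps D (p * m) = {}" using * by auto
    then show ?thesis using False by simp
  qed
qed

text \<open>In a ring of norm form \<open>x\<^sup>2 + D y\<^sup>2\<close>, an element of norm \<open>p m\<close> is divisible by
  \<open>a + b \<surd>-D\<close> or by its conjugate, where \<open>p = a\<^sup>2 + D b\<^sup>2\<close>, and by both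
  precisely if it is divisible by \<open>p\<close>.\<close>

lemma card_form_reps_split:
  assumes p: "prime p" "odd p" and ab: "a\<^sup>2 + D * b\<^sup>2 = int p" and D: "D > 0" "\<not> int p dvd D"
  shows "card (form_reps D (p * m)) + (if p dvd m then card (form_reps D (m div p)) else 0) =
    2 * card (form_reps D m)"
proof -
  \<comment> \<open>Multiplication of \<open>u + v \<surd>-D\<close> by
    \<open>a + e b \<surd>-D\<close>; the values \<open>e = 1\<close> and \<open>e = -1\<close> give
    the two conjugate factors of \<open>p\<close>.\<close>
  define F where "F = (\<lambda>e (u, v). (a * u - e * D * b * v, a * v + e * b * u :: int))"
  have p0: "int p \<noteq> 0" and pp: "prime (int p)" using p by (simp_all add: prime_gt_0_nat)
  have pa: "\<not> int p dvd a"
  proof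
    assume h: "int p dvd a"
    have "D * b\<^sup>2 = int p - a * a" using ab by (simp add: power2_eq_square)
    then have "int p dvd D * b\<^sup>2" using h by simp
    then have "int p dvd b" using D pp by (simp add: prime_dvd_mult_iff prime_dvd_power_iff)
    then obtain b' where b': "b = int p * b'" by (rule dvdE)
    obtain a' where "a = int p * a'" using h by (rule dvdE)
    with b'
    have "int p * (int p * (a'\<^sup>2 + D * b'\<^sup>2)) = int p * 1" using ab by (simp add: power2_eq_square algebra_simps)
    then have "int p * (a'\<^sup>2 + D * b'\<^sup>2) = 1" using p0 by (metis mult_left_cancel)
    then have "int p dvd 1" by (metis dvd_triv_left)
    then show False using pp by (simp add: not_prime_unit)
  qed
  have pb: "\<not> int p dvd b"
  proof
    assume "int p dvd b"
    moreover have "a\<^sup>2 = int p - D * b * b" using ab by (simp add: power2_eq_square)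
    ultimately have "int p dvd a\<^sup>2" by simp
    then show False using pa prime_dvd_power[OF pp] by simp
  qed
  have F_norm: "(fst (F e (u, v)))\<^sup>2 + D * (snd (F e (u, v)))\<^sup>2 = int p * (u\<^sup>2 + D * v\<^sup>2)" if "e * e = 1" for e u v
  proof -
    have ee: "e * (e * z) = z" for z using that by (simp flip: mult.assoc)
    have "(a * u - e * D * b * v)\<^sup>2 + D * (a * v + e * b * u)\<^sup>2 = (a\<^sup>2 + D * b\<^sup>2) * (u\<^sup>2 + D * v\<^sup>2)"
      by (simp add: power2_eq_square algebra_simps ee)
    then show ?thesis unfolding ab F_def by simp
  qed
  have inj: "inj (F e)" if e: "e * e = 1" for e
  proof (rule injI, clarify)
    fix u v u' v' assume h: "F e (u, v) = F e (u', v')"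
    have "F e (u - u', v - v') = (0, 0)" using h by (simp add: F_def algebra_simps)
    then have "int p * ((u - u')\<^sup>2 + D * (v - v')\<^sup>2) = 0" using F_norm[OF e, of "u - u'" "v - v'"] by simp
    then have "(u - u')\<^sup>2 + D * (v - v')\<^sup>2 = 0" using p0 by simp
    moreover have "0 \<le> (u - u')\<^sup>2" "0 \<le> D * (v - v')\<^sup>2" using D by simp_all
    ultimately have "(u - u')\<^sup>2 = 0" "D * (v - v')\<^sup>2 = 0" by linarith+
    then show "u = u' \<and> v = v'" using D by simp
  qed
  define I where "I e = F e ` form_reps D m" for e
  have cardI: "card (I e) = card (form_reps D m)" if "e * e = 1" for e
    unfolding I_def using inj[OF that] by (intro card_image) (auto intro: inj_on_subset)
  \<comment> \<open>The number \<open>a y - e b x\<close> is the second coordinate of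
    \<open>x + y \<surd>-D\<close> times the conjugate factor. If \<open>p\<close> divides it, then
    \<open>p\<close> divides the first coordinate as well, and the quotient is the preimage.\<close>
  have I_iff: "(x, y) \<in> I e \<longleftrightarrow> (x, y) \<in> form_reps D (p * m) \<and> int p dvd a * y - e * b * x"
    if e: "e * e = 1" for e x y
  proof -
    have ee: "e * (e * z) = z" for z using e by (simp flip: mult.assoc)
    show ?thesis
    proof
      assume "(x, y) \<in> I e"
      then obtain u v where uv: "(x, y) = F e (u, v)" "(u, v) \<in> form_reps D m" by (auto simp: I_def)
      have "(x, y) \<in> form_reps D (p * m)"
        using F_norm[OF e, of u v] uv by (auto simp: form_reps_def)
      moreover have "a * y - e * b * x = int p * v"
      proof -
        have xy: "x = a * u - e * D * b * v" "y = a * v + e * b * u" using uv(1) by (simp_all add: F_def)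
        show ?thesis unfolding xy ab[symmetric]
          by (simp add: power2_eq_square algebra_simps ee)
      qed
      ultimately show "(x, y) \<in> form_reps D (p * m) \<and> int p dvd a * y - e * b * x" by simp
    next
      assume h: "(x, y) \<in> form_reps D (p * m) \<and> int p dvd a * y - e * b * x"
      then have n: "x\<^sup>2 + D * y\<^sup>2 = int p * int m" by (simp add: form_reps_def)
      obtain v where v: "a * y - e * b * x = int p * v" using h by auto
      have "a * (a * x + e * D * b * y) = int p * x + e * D * b * (a * y - e * b * x)"
        unfolding ab[symmetric]
        by (simp add: power2_eq_square algebra_simps ee)
      also have "\<dots> = int p * (x + e * D * b * v)" unfolding v by (simp add: algebra_simps)
      finally have "int p dvd a * (a * x + e * D * b * y)" by simp
      then have "int p dvd a * x + e * D * b * y" using pa pp by (simp add: prime_dvd_mult_iff)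
      then obtain u where u: "a * x + e * D * b * y = int p * u" by auto
      have "int p * (fst (F e (u, v))) = a * (int p * u) - e * D * b * (int p * v)"
        by (simp add: F_def algebra_simps)
      also have "\<dots> = a * (a * x + e * D * b * y) - e * D * b * (a * y - e * b * x)" by (simp only: u v)
      also have "\<dots> = (a\<^sup>2 + D * b\<^sup>2) * x" by (simp add: power2_eq_square algebra_simps ee)
      also have "\<dots> = int p * x" by (simp only: ab)
      finally have x: "fst (F e (u, v)) = x" using p0 by simp
      have "int p * (snd (F e (u, v))) = a * (int p * v) + e * b * (int p * u)"
        by (simp add: F_def algebra_simps)
      also have "\<dots> = a * (a * y - e * b * x) + e * b * (a * x + e * D * b * y)" by (simp only: u v)
      also have "\<dots> = (a\<^sup>2 + D * b\<^sup>2) * y" by (simp add: power2_eq_square algebra_simps ee)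
      also have "\<dots> = int p * y" by (simp only: ab)
      finally have y: "snd (F e (u, v)) = y" using p0 by simp
      have "int p * (u\<^sup>2 + D * v\<^sup>2) = int p * int m" using F_norm[OF e, of u v] n unfolding x y by linarith
      then have "(u, v) \<in> form_reps D m" using p0 by (simp add: form_reps_def)
      then show "(x, y) \<in> I e" unfolding I_def using x y by (metis image_eqI prod.collapse)
    qed
  qed
  have U: "form_reps D (p * m) = I 1 \<union> I (-1)"
  proof -
    have "int p dvd a * y - 1 * b * x \<or> int p dvd a * y - (-1) * b * x" if "(x, y) \<in> form_reps D (p * m)" for x y
    proof -
      have n: "x\<^sup>2 + D * y\<^sup>2 = int p * int m" using that by (simp add: form_reps_def)
      have eq: "a\<^sup>2 = int p - D * b\<^sup>2" "x\<^sup>2 = int p * int m - D * y\<^sup>2" using ab n by simp_all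
      have "(a * y - b * x) * (a * y + b * x) = a\<^sup>2 * y\<^sup>2 - b\<^sup>2 * x\<^sup>2"
        by (simp add: power2_eq_square algebra_simps)
      also have "\<dots> = int p * (y\<^sup>2 - b\<^sup>2 * int m)" unfolding eq by (simp add: algebra_simps)
      finally have "int p dvd (a * y - b * x) * (a * y + b * x)" by simp
      then show ?thesis using pp by (simp add: prime_dvd_mult_iff)
    qed
    moreover have "(x, y) \<in> I 1 \<longleftrightarrow> (x, y) \<in> form_reps D (p * m) \<and> int p dvd a * y - 1 * b * x"
      "(x, y) \<in> I (-1) \<longleftrightarrow> (x, y) \<in> form_reps D (p * m) \<and> int p dvd a * y - (-1) * b * x" for x y
      by (rule I_iff; simp)+
    ultimately have *: "(x, y) \<in> form_reps D (p * m) \<longleftrightarrow> (x, y) \<in> I 1 \<union> I (-1)" for x y by blast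
    show ?thesis
    proof (rule Set.set_eqI)
      fix t show "t \<in> form_reps D (p * m) \<longleftrightarrow> t \<in> I 1 \<union> I (-1)"
        by (cases t) (simp only: *)
    qed
  qed
  have J: "(x, y) \<in> I 1 \<inter> I (-1) \<longleftrightarrow> (x, y) \<in> form_reps D (p * m) \<and> int p dvd x \<and> int p dvd y" for x y
  proof -
    have "int p dvd a * y - 1 * b * x \<and> int p dvd a * y - (-1) * b * x \<longleftrightarrow> int p dvd x \<and> int p dvd y"
    proof
      assume h: "int p dvd a * y - 1 * b * x \<and> int p dvd a * y - (-1) * b * x"
      have "\<not> int p dvd 2"
      proof
        assume "int p dvd 2"
        then have "int p \<le> 2" by (rule zdvd_imp_le) simp
        then have "p = 2" using prime_ge_2_nat[OF p(1)] by simp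
        then show False using p(2) by simp
      qed
      moreover have "int p dvd (a * y - 1 * b * x) + (a * y - (-1) * b * x)" "int p dvd (a * y - (-1) * b * x) - (a * y - 1 * b * x)"
        using h dvd_add dvd_diff by blast+
      then have "int p dvd 2 * a * y" "int p dvd 2 * b * x" by (simp_all add: algebra_simps)
      ultimately show "int p dvd x \<and> int p dvd y" using pa pb pp by (simp add: prime_dvd_mult_iff)
    qed auto
    moreover have "(x, y) \<in> I 1 \<longleftrightarrow> (x, y) \<in> form_reps D (p * m) \<and> int p dvd a * y - 1 * b * x"
      "(x, y) \<in> I (-1) \<longleftrightarrow> (x, y) \<in> form_reps D (p * m) \<and> int p dvd a * y - (-1) * b * x"
      by (rule I_iff; simp)+
    ultimately show ?thesis by blast
  qed
  have cardJ: "card (I 1 \<inter> I (-1)) = (if p dvd m then card (form_reps D (m div p)) else 0)"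
  proof (cases "p dvd m")
    case True
    then obtain k where k: "m = p * k" by auto
    have scale: "(int p * u)\<^sup>2 + D * (int p * v)\<^sup>2 = int p * (int p * (u\<^sup>2 + D * v\<^sup>2))" for u v
      by (simp add: power2_eq_square algebra_simps)
    have "bij_betw (\<lambda>(u, v). (int p * u, int p * v)) (form_reps D k) (I 1 \<inter> I (-1))"
    proof (rule bij_betw_imageI)
      show "inj_on (\<lambda>(u, v). (int p * u, int p * v)) (form_reps D k)"
        using p0 by (auto simp: inj_on_def)
      have "(int p * u, int p * v) \<in> I 1 \<inter> I (-1)" if "(u, v) \<in> form_reps D k" for u v
        unfolding J using that scale[of u v] by (simp add: form_reps_def k)
      moreover have "\<exists>u v. (u, v) \<in> form_reps D k \<and> x = int p * u \<and> y = int p * v"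
        if "(x, y) \<in> I 1 \<inter> I (-1)" for x y
      proof -
        have "int p dvd x" "int p dvd y" using \<open>(x, y) \<in> I 1 \<inter> I (-1)\<close> unfolding J by simp_all
        then obtain u v where uv: "x = int p * u" "y = int p * v" by (metis dvdE)
        have "int p * (int p * (u\<^sup>2 + D * v\<^sup>2)) = int p * (int p * int k)"
          using that unfolding J uv form_reps_def by (simp add: scale k)
        then show ?thesis using p0 uv by (auto simp: form_reps_def)
      qed
      ultimately show "(\<lambda>(u, v). (int p * u, int p * v)) ` form_reps D k = I 1 \<inter> I (-1)"
        by fast
    qed
    then have "card (form_reps D k) = card (I 1 \<inter> I (-1))" by (rule bij_betw_same_card)
    then show ?thesis using True p0 by (simp add: k)
  next
    case False
    have "I 1 \<inter> I (-1) = {}"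
    proof (rule equals0I)
      fix t assume "t \<in> I 1 \<inter> I (-1)"
      then obtain x y where "(x, y) \<in> I 1 \<inter> I (-1)" by (cases t) auto
      then have "int p dvd x" "int p dvd y" "x\<^sup>2 + D * y\<^sup>2 = int p * int m"
        unfolding J by (simp_all add: form_reps_def)
      then obtain u v where "x = int p * u" "y = int p * v" "x\<^sup>2 + D * y\<^sup>2 = int p * int m"
        by (metis dvdE)
      then have "int p * (int p * (u\<^sup>2 + D * v\<^sup>2)) = int p * int m" by (simp add: power2_eq_square algebra_simps)
      then have "int p dvd int m" using p0 by (metis dvd_triv_left mult_left_cancel)
      then show False using False by simp
    qed
    then show ?thesis using False by simp
  qed
  have "card (I 1) + card (I (-1)) = card (I 1 \<union> I (-1)) + card (I 1 \<inter> I (-1))"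
    using finite_form_reps[OF D(1)] by (intro card_Un_Int) (simp_all add: I_def)
  then show ?thesis using cardI[of 1] cardI[of "-1"] U cardJ by simp
qed

text \<open>Pigeonhole: with \<open>s\<close> the integer part of the root of \<open>p\<close> there
  are \<open>(s + 1)^2 > p\<close> pairs, so two of them agree modulo \<open>p\<close> under
  \<open>i - t j\<close>. The bounds are strict because a prime is not a square.\<close>

lemma thue:
  fixes t :: int
  assumes p: "prime (p::nat)"
  obtains x y :: int where "(x, y) \<noteq> (0, 0)" "x\<^sup>2 < int p" "y\<^sup>2 < int p" "int p dvd x - t * y"
proof -
  define s where "s = nat \<lfloor>sqrt (real p)\<rfloor>"
  have s: "real s \<le> sqrt (real p)" "sqrt (real p) < real s + 1"
    by (simp_all add: s_def)
  have "(sqrt (real p))\<^sup>2 < (real s + 1)\<^sup>2" using s(2) by (intro power_strict_mono) auto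
  then have "real p < real ((s + 1)\<^sup>2)" by (simp add: add.commute)
  then have ps: "p < (s + 1)\<^sup>2" by (simp only: of_nat_less_iff)
  have "(real s)\<^sup>2 \<le> (sqrt (real p))\<^sup>2" using s(1) by (intro power_mono) auto
  then have "real (s\<^sup>2) \<le> real p" by simp
  then have "s\<^sup>2 \<le> p" by (simp only: of_nat_le_iff)
  moreover have "s\<^sup>2 \<noteq> p"
  proof
    assume "s\<^sup>2 = p"
    then have "s dvd p" by (auto simp: power2_eq_square)
    then have "s = 1 \<or> s = p" using p by (simp add: prime_nat_iff)
    then show False using \<open>s\<^sup>2 = p\<close> p by (auto simp: power2_eq_square)
  qed
  ultimately have sp: "s\<^sup>2 < p" by simp
  define f where "f = (\<lambda>(i::nat, j::nat). (int i - t * int j) mod int p)"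
  have p0: "int p > 0" using p by (simp add: prime_gt_0_nat)
  have "f ` ({..s} \<times> {..s}) \<subseteq> {0..<int p}" using p0 by (auto simp: f_def)
  then have "card (f ` ({..s} \<times> {..s})) \<le> p" using card_mono[of "{0..<int p}"] by fastforce
  also have "\<dots> < card ({..s} \<times> {..s})" using ps by (simp add: power2_eq_square)
  finally have "\<not> inj_on f ({..s} \<times> {..s})" by (rule pigeonhole)
  then obtain i j i' j' where ij: "i \<le> s" "j \<le> s" "i' \<le> s" "j' \<le> s" "(i, j) \<noteq> (i', j')"
    and eq: "f (i, j) = f (i', j')" by (auto simp: inj_on_def)
  have sq: "(int u - int v)\<^sup>2 < int p" if "u \<le> s" "v \<le> s" for u v
  proof -
    have "\<bar>int u - int v\<bar> \<le> int s" using that by linarith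
    then have "\<bar>int u - int v\<bar>\<^sup>2 \<le> (int s)\<^sup>2" by (intro power_mono) auto
    also have "\<dots> < int p" using sp by (metis of_nat_less_iff of_nat_power)
    finally show ?thesis by simp
  qed
  show thesis
  proof (rule that)
    show "(int i - int i', int j - int j') \<noteq> (0, 0)" using ij by auto
    show "(int i - int i')\<^sup>2 < int p" "(int j - int j')\<^sup>2 < int p" using ij by (auto intro: sq)
    have "int p dvd (int i - t * int j) - (int i' - t * int j')"
      using eq by (simp add: f_def mod_eq_dvd_iff)
    then show "int p dvd (int i - int i') - t * (int j - int j')" by (simp add: algebra_simps)
  qed
qed

text \<open>For \<open>t^2\<close> congruent to \<open>-D\<close>, Thue's pair satisfies
  \<open>x^2 + D y^2 = p k\<close> with \<open>0 < k < 1 + D\<close>. Only \<open>k = 2\<close> for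
  \<open>D = 2\<close> needs work: then \<open>x\<close> is even, and halving exchanges the roles of
  the two squares.\<close>

lemma represent_prime:
  assumes p: "prime (p::nat)" "odd p" and t: "int p dvd t\<^sup>2 + D" and D: "D = 1 \<or> D = 2"
  shows "\<exists>a b. a\<^sup>2 + D * b\<^sup>2 = int p"
proof -
  obtain x y where xy: "(x, y) \<noteq> (0, 0)" "x\<^sup>2 < int p" "y\<^sup>2 < int p" "int p dvd x - t * y"
    by (rule thue[OF p(1), of t])
  have "x\<^sup>2 + D * y\<^sup>2 = (x - t * y) * (x + t * y) + (t\<^sup>2 + D) * y\<^sup>2"
    by (simp add: power2_eq_square algebra_simps)
  then have "int p dvd x\<^sup>2 + D * y\<^sup>2" using xy(4) t by simp
  then obtain k where k: "x\<^sup>2 + D * y\<^sup>2 = int p * k" by auto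
  have p0: "int p > 0" using p(1) by (simp add: prime_gt_0_nat)
  have pos: "0 < x\<^sup>2 + D * y\<^sup>2"
  proof -
    have "0 < x\<^sup>2 \<or> 0 < y\<^sup>2" using xy(1) by auto
    moreover have "0 \<le> x\<^sup>2" "0 \<le> y\<^sup>2" by simp_all
    moreover have "y\<^sup>2 \<le> D * y\<^sup>2" using D by auto
    ultimately show ?thesis by linarith
  qed
  then have "k > 0" using k p0 by (simp add: zero_less_mult_iff)
  have "int p * k < int p * (1 + D)" using k[symmetric] xy(2,3) D by (auto simp: algebra_simps)
  then have "k < 1 + D" using p0 by simp
  show ?thesis
  proof (cases "k = 1")
    case True
    then show ?thesis using k by auto
  next
    case False
    then have D2: "D = 2" and "k = 2" using \<open>k > 0\<close> \<open>k < 1 + D\<close> D by auto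
    then have "x\<^sup>2 = 2 * (int p - y\<^sup>2)" using k by simp
    then have "even (x\<^sup>2)" by simp
    then have "even x" by simp
    then obtain x' where "x = 2 * x'" by auto
    then have "y\<^sup>2 + D * x'\<^sup>2 = int p" using k D2 \<open>k = 2\<close> by (simp add: power2_eq_square)
    then show ?thesis by blast
  qed
qed

lemma square_mod_8: "odd (a::int) \<Longrightarrow> a\<^sup>2 mod 8 = 1"
proof -
  assume "odd a"
  then obtain b where b: "a = 2 * b + 1" by (auto elim: oddE)
  have "even (b * (b + 1))" by simp
  then obtain c where c: "b * (b + 1) = 2 * c" by (rule evenE)
  have "a\<^sup>2 = 4 * (b * (b + 1)) + 1" by (simp add: b power2_eq_square algebra_simps)
  then have "a\<^sup>2 = 1 + 8 * c" using c by simp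
  then show ?thesis by simp
qed

lemma square_cases: "even (a::int) \<Longrightarrow> a\<^sup>2 mod 4 = 0" "odd a \<Longrightarrow> a\<^sup>2 mod 4 = 1"
proof -
  show "a\<^sup>2 mod 4 = 0" if "even a" using that by (auto simp: power2_eq_square elim!: evenE)
  show "a\<^sup>2 mod 4 = 1" if "odd a"
  proof -
    have "a\<^sup>2 mod 4 = a\<^sup>2 mod 8 mod 4" by (simp add: mod_mod_cancel)
    then show ?thesis using square_mod_8[OF that] by simp
  qed
qed

lemma sum_two_squares_mod_4:
  assumes "a\<^sup>2 + 1 * b\<^sup>2 = int p" "odd p"
  shows "p mod 4 = 1"
proof -
  have "int p mod 4 = (a\<^sup>2 mod 4 + b\<^sup>2 mod 4) mod 4"
    unfolding assms(1)[symmetric] by (simp add: mod_add_eq)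
  moreover have "odd (int p)" using assms(2) by simp
  then have "even a \<noteq> even b" unfolding assms(1)[symmetric] by auto
  ultimately have "int p mod 4 = 1" using square_cases[of a] square_cases[of b] by auto
  then show ?thesis by presburger
qed

lemma square_plus_two_squares_mod_8:
  assumes "a\<^sup>2 + 2 * b\<^sup>2 = int p" "odd p"
  shows "p mod 8 = 1 \<or> p mod 8 = 3"
proof -
  have "odd (int p)" using assms(2) by simp
  then have "odd a" unfolding assms(1)[symmetric] by simp
  then have 1: "a\<^sup>2 mod 8 = 1" by (rule square_mod_8)
  have "b\<^sup>2 mod 4 = 0 \<or> b\<^sup>2 mod 4 = 1" using square_cases[of b] by blast
  then have "int p mod 8 = 1 \<or> int p mod 8 = 3" unfolding assms(1)[symmetric] using 1 by presburger
  then show ?thesis by presburger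
qed

lemma two_minus_squares_mod_8:
  assumes "2 * b\<^sup>2 - a\<^sup>2 = int p" "odd p"
  shows "p mod 8 = 1 \<or> p mod 8 = 7"
proof -
  have "odd (int p)" using assms(2) by simp
  then have "odd a" unfolding assms(1)[symmetric] by simp
  then have 1: "a\<^sup>2 mod 8 = 1" by (rule square_mod_8)
  have "b\<^sup>2 mod 4 = 0 \<or> b\<^sup>2 mod 4 = 1" using square_cases[of b] by blast
  then have "int p mod 8 = 1 \<or> int p mod 8 = 7" unfolding assms(1)[symmetric] using 1 by presburger
  then show ?thesis by presburger
qed

lemma square_eq_two_times_square: "(x::nat)\<^sup>2 = 2 * y\<^sup>2 \<Longrightarrow> x = 0"
proof (induction x arbitrary: y rule: less_induct)
  case (less x)
  have "even (x\<^sup>2)" using less.prems by simp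
  then have "even x" by simp
  then obtain x' where x: "x = 2 * x'" by auto
  then have y: "y\<^sup>2 = 2 * x'\<^sup>2" using less.prems by (simp add: power2_eq_square)
  show ?case
  proof (rule ccontr)
    assume "x \<noteq> 0"
    then have "x' > 0" using x by simp
    have "y < x"
    proof (rule ccontr)
      assume "\<not> y < x"
      then have "x\<^sup>2 \<le> y\<^sup>2" by (simp add: power_mono)
      then show False using less.prems \<open>x \<noteq> 0\<close> by simp
    qed
    then have "y = 0" using less.IH y by blast
    then show False using y \<open>x' > 0\<close> by simp
  qed
qed

section \<open>The residues \<open>-1\<close> and \<open>-2\<close>, and the quadratic
  characters\<close>

lemma euler_residue:
  assumes "prime (p::nat)" "2 < p" "[a ^ ((p - 1) div 2) = 1] (mod int p)"
  shows "\<exists>t. int p dvd t\<^sup>2 - a"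
proof (rule ccontr)
  assume "\<not> (\<exists>t. int p dvd t\<^sup>2 - a)"
  then have nq: "\<not> QuadRes (int p) a" by (simp add: QuadRes_def cong_iff_dvd_diff)
  have "\<not> [a = 0] (mod int p)"
  proof
    assume "[a = 0] (mod int p)"
    then have "QuadRes (int p) a" unfolding QuadRes_def by (intro exI[of _ 0]) (simp add: cong_sym)
    with nq show False by simp
  qed
  then have "Legendre a (int p) = -1" using nq by (simp add: Legendre_def)
  then have "[-1 = 1] (mod int p)"
    using euler_criterion[OF assms(1,2), of a] assms(3) cong_trans by fastforce
  then have "int p dvd 2" by (simp add: cong_iff_dvd_diff dvd_diff_commute)
  then have "int p \<le> 2" by (rule zdvd_imp_le) simp
  then show False using assms(2) by simp
qed

lemma minus_one_residue:
  assumes "prime (p::nat)" "p mod 4 = 1"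
  shows "\<exists>t. int p dvd t\<^sup>2 + 1"
proof -
  have "p > 2" using assms prime_ge_2_nat[of p] by (cases "p = 2") auto
  moreover have "even ((p - 1) div 2)" using assms(2) by presburger
  ultimately show ?thesis using euler_residue[of p "-1"] assms(1) by simp
qed

text \<open>A primitive eighth root of unity \<open>z\<close> exists modulo \<open>p\<close>, and
  \<open>z^4 = -1\<close> gives \<open>(z + z^3)^2 = z^2 (1 + z^4) + 2 z^4 = -2\<close>.\<close>

lemma minus_two_residue_1:
  assumes p: "prime (p::nat)" "p mod 8 = 1"
  shows "\<exists>t. int p dvd t\<^sup>2 + 2"
proof -
  have p2: "p > 2" using p prime_ge_2_nat[of p] by (cases "p = 2") auto
  obtain g where g: "residue_primroot p g" using prime_primitive_root_exists[of p] p(1) prime_gt_1_nat[OF p(1)] by auto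
  define z where "z = g ^ ((p - 1) div 8)"
  have e: "(p - 1) div 8 * 4 = (p - 1) div 2" "(p - 1) div 2 * 2 = p - 1" using p(2) by presburger+
  have ord: "ord p g = p - 1" using g p by (simp add: residue_primroot_def totient_prime)
  have z4: "z ^ 4 = g ^ ((p - 1) div 2)" by (simp only: z_def e power_mult[symmetric])
  have "[g ^ (p - 1) = 1] (mod p)" using ord_works[of g p] ord by simp
  then have "[(z ^ 4)\<^sup>2 = 1] (mod p)" by (simp only: z4 power_mult[symmetric] e)
  then have "[(int z ^ 4)\<^sup>2 = 1] (mod int p)" using cong_int_iff[of "(z ^ 4)\<^sup>2" 1 p] by simp
  then have "int p dvd (int z ^ 4)\<^sup>2 - 1" by (simp add: cong_iff_dvd_diff)
  moreover have "(int z ^ 4)\<^sup>2 - 1 = (int z ^ 4 - 1) * (int z ^ 4 + 1)" by (simp add: power2_eq_square algebra_simps)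
  ultimately have "int p dvd int z ^ 4 - 1 \<or> int p dvd int z ^ 4 + 1"
    using p(1) by (metis prime_dvd_mult_iff prime_int_nat_transfer prime_nat_int_transfer)
  moreover have "\<not> int p dvd int z ^ 4 - 1"
  proof
    assume "int p dvd int z ^ 4 - 1"
    then have "[int (z ^ 4) = int 1] (mod int p)" by (simp add: cong_iff_dvd_diff)
    then have "[z ^ 4 = 1] (mod p)" by (simp only: cong_int_iff)
    then have "[g ^ ((p - 1) div 2) = 1] (mod p)" using z4 by simp
    moreover have "0 < (p - 1) div 2" "(p - 1) div 2 < ord p g" using p2 ord by auto
    ultimately show False using ord_works[of g p] by blast
  qed
  ultimately have d: "int p dvd int z ^ 4 + 1" by blast
  have "(int z + int z ^ 3)\<^sup>2 + 2 = (int z ^ 4 + 1) * ((int z)\<^sup>2 + 2)"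
    by (simp add: power2_eq_square power3_eq_cube power4_eq_xxxx algebra_simps)
  then have "int p dvd (int z + int z ^ 3)\<^sup>2 + 2" using d by simp
  then show ?thesis by blast
qed

text \<open>Otherwise \<open>2\<close> is a residue, and Thue's lemma yields \<open>p = 2 y\<^sup>2 - x\<^sup>2\<close>, which is impossible
  modulo 8.\<close>

lemma minus_two_residue_3:
  assumes p: "prime (p::nat)" "p mod 8 = 3"
  shows "\<exists>t. int p dvd t\<^sup>2 + 2"
proof (rule ccontr)
  assume contr: "\<not> (\<exists>t. int p dvd t\<^sup>2 + 2)"
  have p2: "p > 2" using p prime_ge_2_nat[of p] by (cases "p = 2") auto
  have oddh: "odd ((p - 1) div 2)" using p(2) by presburger
  have "\<not> QuadRes (int p) (-2)" using contr by (simp add: QuadRes_def cong_iff_dvd_diff)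
  moreover have "\<not> [-2 = 0] (mod int p)"
  proof
    assume "[-2 = 0] (mod int p)"
    then have "int p dvd 2" by (simp add: cong_iff_dvd_diff)
    then have "int p \<le> 2" by (rule zdvd_imp_le) simp
    then show False using p2 by simp
  qed
  ultimately have "Legendre (-2) (int p) = -1" by (simp add: Legendre_def)
  then have "[-1 = (-2) ^ ((p - 1) div 2)] (mod int p)"
    using euler_criterion[OF p(1) p2, of "-2"] by simp
  then have "[-1 = - (2 ^ ((p - 1) div 2))] (mod int p)" using oddh by (simp add: power_minus[of "2::int"])
  then have "[1 = 2 ^ ((p - 1) div 2)] (mod int p)" using cong_minus_minus_iff by blast
  then obtain t where t: "int p dvd t\<^sup>2 - 2" using euler_residue[OF p(1) p2, of 2] cong_sym by blast
  obtain x y where xy: "(x, y) \<noteq> (0, 0)" "x\<^sup>2 < int p" "y\<^sup>2 < int p" "int p dvd x - t * y"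
    by (rule thue[OF p(1), of t])
  have "x\<^sup>2 - 2 * y\<^sup>2 = (x - t * y) * (x + t * y) + (t\<^sup>2 - 2) * y\<^sup>2"
    by (simp add: power2_eq_square algebra_simps)
  then have "int p dvd x\<^sup>2 - 2 * y\<^sup>2" using xy(4) t by simp
  then obtain k where k: "x\<^sup>2 - 2 * y\<^sup>2 = int p * k" by auto
  have p0: "int p > 0" using p2 by simp
  have "x\<^sup>2 - 2 * y\<^sup>2 \<noteq> 0"
  proof
    assume "x\<^sup>2 - 2 * y\<^sup>2 = 0"
    then have h: "x\<^sup>2 = 2 * y\<^sup>2" by simp
    have "(nat \<bar>x\<bar>)\<^sup>2 = 2 * (nat \<bar>y\<bar>)\<^sup>2"
    proof -
      have "int ((nat \<bar>x\<bar>)\<^sup>2) = int (2 * (nat \<bar>y\<bar>)\<^sup>2)" using h by simp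
      then show ?thesis by (simp only: of_nat_eq_iff)
    qed
    then have "nat \<bar>x\<bar> = 0" by (rule square_eq_two_times_square)
    then have "x = 0" by simp
    then show False using h xy(1) by simp
  qed
  then have "k \<noteq> 0" using k by auto
  have nn: "0 \<le> x\<^sup>2" "0 \<le> y\<^sup>2" by simp_all
  have "int p * k < int p * 1" using k[symmetric] xy(2) nn by linarith
  then have "k < 1" using p0 by simp
  have "int p * (-2) < int p * k" using k[symmetric] xy(3) nn by linarith
  then have "-2 < k" by (simp only: mult_less_cancel_left_pos[OF p0])
  then have "k = -1" using \<open>k < 1\<close> \<open>k \<noteq> 0\<close> by simp
  then have "2 * y\<^sup>2 - x\<^sup>2 = int p" using k by simp
  then have "p mod 8 = 1 \<or> p mod 8 = 7" by (rule two_minus_squares_mod_8) (use p in presburger)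
  then show False using p(2) by simp
qed

lemma inert_of_non_residue:
  assumes p: "prime (p::nat)" and nr: "\<not> (\<exists>t. int p dvd t\<^sup>2 + D)" and h: "int p dvd x\<^sup>2 + D * y\<^sup>2"
  shows "int p dvd x \<and> int p dvd y"
proof -
  have pp: "prime (int p)" using p by simp
  have y: "int p dvd y"
  proof (rule ccontr)
    assume "\<not> int p dvd y"
    then have "coprime y (int p)" using pp prime_imp_coprime coprime_commute by blast
    then obtain z where "[y * z = 1] (mod int p)" using cong_solve_coprime_int by blast
    then have "int p dvd y * z - 1" by (simp add: cong_iff_dvd_diff)
    moreover have "(x * z)\<^sup>2 + D = z\<^sup>2 * (x\<^sup>2 + D * y\<^sup>2) - D * (y * z - 1) * (y * z + 1)"
      by (simp add: power2_eq_square algebra_simps)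
    ultimately have "int p dvd (x * z)\<^sup>2 + D" using h by simp
    then show False using nr by blast
  qed
  then have "int p dvd D * y\<^sup>2" by (simp add: power2_eq_square)
  then have "int p dvd x\<^sup>2" using h by (simp add: dvd_add_left_iff)
  then have "int p dvd x" by (rule prime_dvd_power[OF pp])
  then show ?thesis using y by simp
qed

text \<open>The quadratic characters belonging to the fields of \<open>\<surd>-1\<close> and
  \<open>\<surd>-2\<close>, of conductors 4 and 8.\<close>

definition chi :: "int \<Rightarrow> nat \<Rightarrow> int" where
  "chi D d = (if D = 1 then (if d mod 4 = 1 then 1 else if d mod 4 = 3 then -1 else 0)
     else (if d mod 8 = 1 \<or> d mod 8 = 3 then 1 else if d mod 8 = 5 \<or> d mod 8 = 7 then -1 else 0))"

lemma chi_mod_8: "chi D (d mod 8) = chi D d"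
  by (cases "D = 1") (simp_all add: chi_def mod_mod_cancel)

lemma chi_mult: "chi D (a * b) = chi D a * chi D b"
proof -
  have "\<forall>x\<in>set [0..<8]. \<forall>y\<in>set [0..<8]. chi 1 (x * y) = chi 1 x * chi 1 y \<and> chi 2 (x * y) = chi 2 x * chi 2 y"
    by code_simp
  moreover have "a mod 8 \<in> set [0..<8]" "b mod 8 \<in> set [0..<8]" by simp_all
  ultimately have "chi 1 ((a mod 8) * (b mod 8)) = chi 1 (a mod 8) * chi 1 (b mod 8)"
    "chi 2 ((a mod 8) * (b mod 8)) = chi 2 (a mod 8) * chi 2 (b mod 8)" by blast+
  moreover have "chi E ((a mod 8) * (b mod 8)) = chi E (a * b)" for E
    using chi_mod_8[of E "(a mod 8) * (b mod 8)"] chi_mod_8[of E "a * b"] by (simp add: mod_mult_eq)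
  ultimately have "chi 1 (a * b) = chi 1 a * chi 1 b" "chi 2 (a * b) = chi 2 a * chi 2 b"
    by (simp_all add: chi_mod_8)
  then show ?thesis by (cases "D = 1") (simp_all add: chi_def)
qed

lemma chi_odd_cases: "odd d \<Longrightarrow> chi D d = 1 \<or> chi D d = -1"
  unfolding chi_def by presburger

text \<open>For the converse, a residue makes \<open>p\<close> representable as
  \<open>a^2 + D b^2\<close>, and squares modulo 8 then restrict \<open>p\<close> to the classes
  with character value 1.\<close>

lemma chi_residue:
  assumes p: "prime (p::nat)" "odd p" and D: "D = 1 \<or> D = 2"
  shows "chi D p = 1 \<longleftrightarrow> (\<exists>t. int p dvd t\<^sup>2 + D)"
proof
  assume h: "chi D p = 1"
  show "\<exists>t. int p dvd t\<^sup>2 + D"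
  proof (cases "D = 1")
    case True
    then have "p mod 4 = 1" using h by (auto simp: chi_def split: if_splits)
    then show ?thesis using minus_one_residue p True by simp
  next
    case False
    then have "D = 2" "p mod 8 = 1 \<or> p mod 8 = 3" using h D by (auto simp: chi_def split: if_splits)
    then show ?thesis using minus_two_residue_1 minus_two_residue_3 p by blast
  qed
next
  assume "\<exists>t. int p dvd t\<^sup>2 + D"
  then obtain a b where ab: "a\<^sup>2 + D * b\<^sup>2 = int p" using represent_prime[OF p] D by blast
  show "chi D p = 1"
  proof (cases "D = 1")
    case True
    then show ?thesis using sum_two_squares_mod_4[of a b p] ab p by (simp add: chi_def)
  next
    case False
    then show ?thesis using square_plus_two_squares_mod_8[of a b p] ab p D by (auto simp: chi_def)
  qed
qed

section \<open>An identity of Liouville\<close>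

text \<open>The equation can be regrouped as \<open>(x - z) y + z (y + w)\<close> if
  \<open>z < x\<close>, and as \<open>(x + z) w + x (y - w)\<close> if \<open>w < y\<close>. Both
  carry the off-diagonal solutions into the set \<open>P\<close> of solutions with two even entries,
  and the argument of \<open>F\<close> becomes the even entry \<open>e\<close>. The two images have
  equal \<open>F\<close>-sums, so only the diagonals \<open>x = z\<close> and \<open>y = w\<close>
  survive.\<close>

lemma liouville_sum:
  fixes n :: nat and F :: "int \<Rightarrow> int"
  assumes n: "odd n" and F: "\<And>t. F (- t) = F t"
  defines "Q \<equiv> {(x, y, z, w). odd x \<and> odd y \<and> odd z \<and> odd w \<and> x * y + z * w = 2 * n}"
  shows "(\<Sum>(x, y, z, w)\<in>Q. F (int x - int z) - F (int x + int z)) =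
    (\<Sum>d | d dvd n. int d * (F 0 - F (2 * int d)))"
proof -
  let ?f = "\<lambda>(x, y, z, w). F (int x - int z)"
  let ?g = "\<lambda>(x, y, z, w). F (int x + int z)"
  let ?h = "\<lambda>(e, u, f, v). F (int e)"
  have n0: "n > 0" using n by (rule odd_pos)
  define P where "P = {(e, u, f, v). even e \<and> odd u \<and> even f \<and> odd v \<and> 0 < e \<and> 0 < f \<and> e * u + f * v = 2 * n}"
  have bound: "a \<le> N" if "a * b + c * d = N" "0 < b" for a b c d N :: nat
  proof -
    have "a * 1 \<le> a * b" using that(2) by (intro mult_le_mono2) simp
    then show ?thesis using that(1) by linarith
  qed
  have finQ: "finite Q"
  proof (rule finite_subset)
    show "Q \<subseteq> {..2 * n} \<times> {..2 * n} \<times> {..2 * n} \<times> {..2 * n}"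
    proof (clarsimp simp: Q_def)
      fix x y z w assume h: "odd x" "odd y" "odd z" "odd w" "x * y + z * w = 2 * n"
      note pos = h(1-4)[THEN odd_pos]
      show "x \<le> 2 * n \<and> y \<le> 2 * n \<and> z \<le> 2 * n \<and> w \<le> 2 * n"
        using bound[of x y z w "2 * n"] bound[of y x z w "2 * n"] bound[of z w x y "2 * n"] bound[of w z x y "2 * n"] h(5) pos
        by (simp add: mult.commute add.commute)
    qed
  qed auto
  have finP: "finite P"
  proof (rule finite_subset)
    show "P \<subseteq> {..2 * n} \<times> {..2 * n} \<times> {..2 * n} \<times> {..2 * n}"
    proof (clarsimp simp: P_def)
      fix x y z w assume h: "odd y" "odd w" "0 < x" "0 < z" "x * y + z * w = 2 * n"
      note pos = h(1,2)[THEN odd_pos]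
      show "x \<le> 2 * n \<and> y \<le> 2 * n \<and> z \<le> 2 * n \<and> w \<le> 2 * n"
        using bound[of x y z w "2 * n"] bound[of y x z w "2 * n"] bound[of z w x y "2 * n"] bound[of w z x y "2 * n"] h(3-5) pos
        by (simp add: mult.commute add.commute)
    qed
  qed auto
  define Qx where "Qx = {(x, y, z, w) \<in> Q. z < x}"
  define Qy where "Qy = {(x, y, z, w) \<in> Q. w < y}"
  have A: "sum ?f Qx = sum ?h {(e, u, f, v) \<in> P. u < f}"
  proof (rule sum.reindex_bij_witness[where j = "\<lambda>(x, y, z, w). (x - z, y, y + w, z)" and i = "\<lambda>(e, u, f, v). (e + v, u, v, f - u)"])
    fix t assume t_in: "t \<in> Qx"
    obtain x y z w where t: "t = (x, y, z, w)" by (rule prod_cases4)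
    have h: "odd x" "odd y" "odd z" "odd w" "x * y + z * w = 2 * n" "z < x"
      using t_in by (simp_all add: Qx_def Q_def t)
    define d where "d = x - z"
    have x: "x = d + z" using h by (simp add: d_def)
    show "(\<lambda>(e, u, f, v). (e + v, u, v, f - u)) ((\<lambda>(x, y, z, w). (x - z, y, y + w, z)) t) = t"
      by (simp add: t x)
    show "(\<lambda>(x, y, z, w). (x - z, y, y + w, z)) t \<in> {(e, u, f, v) \<in> P. u < f}"
      using h by (auto simp: t x P_def algebra_simps odd_pos)
    show "?h ((\<lambda>(x, y, z, w). (x - z, y, y + w, z)) t) = ?f t" by (simp add: t x)
  next
    fix t assume t_in: "t \<in> {(e, u, f, v) \<in> P. u < f}"
    obtain e u f v where t: "t = (e, u, f, v)" by (rule prod_cases4)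
    have h: "even e" "odd u" "even f" "odd v" "0 < e" "0 < f" "e * u + f * v = 2 * n" "u < f"
      using t_in by (simp_all add: P_def t)
    define d where "d = f - u"
    have f: "f = d + u" using h by (simp add: d_def)
    show "(\<lambda>(x, y, z, w). (x - z, y, y + w, z)) ((\<lambda>(e, u, f, v). (e + v, u, v, f - u)) t) = t"
      by (simp add: t f)
    show "(\<lambda>(e, u, f, v). (e + v, u, v, f - u)) t \<in> Qx"
      using h by (auto simp: t f Qx_def Q_def algebra_simps)
  qed
  have B: "sum ?g Qy = sum ?h {(e, u, f, v) \<in> P. v < e}"
  proof (rule sum.reindex_bij_witness[where j = "\<lambda>(x, y, z, w). (x + z, w, y - w, x)" and i = "\<lambda>(e, u, f, v). (v, f + u, e - v, u)"])
    fix t assume t_in: "t \<in> Qy"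
    obtain x y z w where t: "t = (x, y, z, w)" by (rule prod_cases4)
    have h: "odd x" "odd y" "odd z" "odd w" "x * y + z * w = 2 * n" "w < y"
      using t_in by (simp_all add: Qy_def Q_def t)
    define d where "d = y - w"
    have y: "y = d + w" using h by (simp add: d_def)
    show "(\<lambda>(e, u, f, v). (v, f + u, e - v, u)) ((\<lambda>(x, y, z, w). (x + z, w, y - w, x)) t) = t"
      by (simp add: t y)
    show "(\<lambda>(x, y, z, w). (x + z, w, y - w, x)) t \<in> {(e, u, f, v) \<in> P. v < e}"
      using h by (auto simp: t y P_def algebra_simps odd_pos)
    show "?h ((\<lambda>(x, y, z, w). (x + z, w, y - w, x)) t) = ?g t" by (simp add: t)
  next
    fix t assume t_in: "t \<in> {(e, u, f, v) \<in> P. v < e}"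
    obtain e u f v where t: "t = (e, u, f, v)" by (rule prod_cases4)
    have h: "even e" "odd u" "even f" "odd v" "0 < e" "0 < f" "e * u + f * v = 2 * n" "v < e"
      using t_in by (simp_all add: P_def t)
    define d where "d = e - v"
    have e: "e = d + v" using h by (simp add: d_def)
    show "(\<lambda>(x, y, z, w). (x + z, w, y - w, x)) ((\<lambda>(e, u, f, v). (v, f + u, e - v, u)) t) = t"
      by (simp add: t e)
    show "(\<lambda>(e, u, f, v). (v, f + u, e - v, u)) t \<in> Qy"
      using h by (auto simp: t e Qy_def Q_def algebra_simps)
  qed
  \<comment> \<open>The complements in \<open>P\<close> of the two images correspond by
    \<open>e u + f v = e (u - f) + f (v + e)\<close>, which keeps \<open>e\<close>. Equality
    \<open>u = f\<close> or \<open>v = e\<close> is impossible by parity.\<close>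
  have C: "sum ?h {(e, u, f, v) \<in> P. f < u} = sum ?h {(e, u, f, v) \<in> P. e < v}"
  proof (rule sum.reindex_bij_witness[where j = "\<lambda>(e, u, f, v). (e, u - f, f, v + e)" and i = "\<lambda>(e, u, f, v). (e, u + f, f, v - e)"])
    fix t assume t_in: "t \<in> {(e, u, f, v) \<in> P. f < u}"
    obtain e u f v where t: "t = (e, u, f, v)" by (rule prod_cases4)
    have h: "even e" "odd u" "even f" "odd v" "0 < e" "0 < f" "e * u + f * v = 2 * n" "f < u"
      using t_in by (simp_all add: P_def t)
    define d where "d = u - f"
    have u: "u = d + f" using h by (simp add: d_def)
    show "(\<lambda>(e, u, f, v). (e, u + f, f, v - e)) ((\<lambda>(e, u, f, v). (e, u - f, f, v + e)) t) = t"
      by (simp add: t u)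
    show "(\<lambda>(e, u, f, v). (e, u - f, f, v + e)) t \<in> {(e, u, f, v) \<in> P. e < v}"
      using h by (auto simp: t u P_def algebra_simps odd_pos)
    show "?h ((\<lambda>(e, u, f, v). (e, u - f, f, v + e)) t) = ?h t" by (simp add: t)
  next
    fix t assume t_in: "t \<in> {(e, u, f, v) \<in> P. e < v}"
    obtain e u f v where t: "t = (e, u, f, v)" by (rule prod_cases4)
    have h: "even e" "odd u" "even f" "odd v" "0 < e" "0 < f" "e * u + f * v = 2 * n" "e < v"
      using t_in by (simp_all add: P_def t)
    define d where "d = v - e"
    have v: "v = d + e" using h by (simp add: d_def)
    show "(\<lambda>(e, u, f, v). (e, u - f, f, v + e)) ((\<lambda>(e, u, f, v). (e, u + f, f, v - e)) t) = t"
      by (simp add: t v)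
    show "(\<lambda>(e, u, f, v). (e, u + f, f, v - e)) t \<in> {(e, u, f, v) \<in> P. f < u}"
      using h by (auto simp: t v P_def algebra_simps odd_pos)
  qed
  have D: "sum ?h {(e, u, f, v) \<in> P. u < f} = sum ?h {(e, u, f, v) \<in> P. v < e}"
  proof -
    have "sum ?h P = sum ?h {(e, u, f, v) \<in> P. u < f} + sum ?h {(e, u, f, v) \<in> P. f < u}"
    proof -
      have "P = {(e, u, f, v) \<in> P. u < f} \<union> {(e, u, f, v) \<in> P. f < u}"
        by (auto simp: P_def) (metis linorder_neqE_nat)+
      moreover have "{(e, u, f, v) \<in> P. u < f} \<inter> {(e, u, f, v) \<in> P. f < u} = {}" by auto
      ultimately show ?thesis using finP by (metis (no_types, lifting) finite_Un sum.union_disjoint)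
    qed
    moreover have "sum ?h P = sum ?h {(e, u, f, v) \<in> P. v < e} + sum ?h {(e, u, f, v) \<in> P. e < v}"
    proof -
      have "P = {(e, u, f, v) \<in> P. v < e} \<union> {(e, u, f, v) \<in> P. e < v}"
        by (auto simp: P_def) (metis linorder_neqE_nat)+
      moreover have "{(e, u, f, v) \<in> P. v < e} \<inter> {(e, u, f, v) \<in> P. e < v} = {}" by auto
      ultimately show ?thesis using finP by (metis (no_types, lifting) finite_Un sum.union_disjoint)
    qed
    ultimately show ?thesis using C by linarith
  qed
  have count: "card {(y, w). odd y \<and> odd w \<and> y + w = 2 * d} = d" if "odd d" for d :: nat
  proof -
    have "bij_betw (\<lambda>i. (2 * i + 1, 2 * (d - i - 1) + 1)) {..<d} {(y, w). odd y \<and> odd w \<and> y + w = 2 * d}"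
      by (rule bij_betw_byWitness[where f' = "\<lambda>(y, w). y div 2"]) (auto elim!: oddE)
    then show ?thesis by (auto dest!: bij_betw_same_card)
  qed
  \<comment> \<open>Both diagonals have the shape \<open>x (u + v) = 2 n\<close>. Here
    \<open>u + v = 2 d\<close> with \<open>d\<close> a divisor of \<open>n\<close>, and each
    \<open>d\<close> comes from exactly \<open>d\<close> pairs of odd numbers, whence the factor
    \<open>d\<close>.\<close>
  have diag: "sum \<phi> {(x, u, v). odd x \<and> odd u \<and> odd v \<and> x * (u + v) = 2 * n} =
      (\<Sum>d | d dvd n. int d * \<phi>' d)"
    if "\<And>x u v. odd u \<Longrightarrow> odd v \<Longrightarrow> \<phi> (x, u, v) = \<phi>' ((u + v) div 2)" for \<phi> :: "nat \<times> nat \<times> nat \<Rightarrow> int" and \<phi>'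
  proof -
    have fin: "finite {(y, w). odd y \<and> odd w \<and> y + w = 2 * d}" for d :: nat
      by (rule finite_subset[of _ "{..2 * d} \<times> {..2 * d}"]) auto
    have "(\<Sum>d | d dvd n. int d * \<phi>' d) = (\<Sum>d | d dvd n. \<Sum>t\<in>{(y, w). odd y \<and> odd w \<and> y + w = 2 * d}. \<phi>' d)"
    proof (intro sum.cong refl)
      fix d assume "d \<in> {d. d dvd n}"
      then have "odd d" using n by (auto dest: dvd_trans)
      then show "int d * \<phi>' d = (\<Sum>t\<in>{(y, w). odd y \<and> odd w \<and> y + w = 2 * d}. \<phi>' d)"
        using count by simp
    qed
    also have "\<dots> = (\<Sum>(d, t)\<in>Sigma {d. d dvd n} (\<lambda>d. {(y, w). odd y \<and> odd w \<and> y + w = 2 * d}). \<phi>' d)"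
      using n0 fin by (subst sum.Sigma) auto
    also have "\<dots> = sum \<phi> {(x, u, v). odd x \<and> odd u \<and> odd v \<and> x * (u + v) = 2 * n}"
    proof (rule sum.reindex_bij_witness[where j = "\<lambda>(d, u, v). (n div d, u, v)" and i = "\<lambda>(x, u, v). ((u + v) div 2, u, v)"])
      fix t assume t_in: "t \<in> Sigma {d. d dvd n} (\<lambda>d. {(y, w). odd y \<and> odd w \<and> y + w = 2 * d})"
      obtain d u v where t: "t = (d, u, v)" by (rule prod_cases3)
      have h: "d dvd n" "odd u" "odd v" "u + v = 2 * d" using t_in by (simp_all add: t)
      then obtain k where k: "n = d * k" by auto
      have d0: "d > 0" using k n0 by simp
      show "(\<lambda>(x, u, v). ((u + v) div 2, u, v)) ((\<lambda>(d, u, v). (n div d, u, v)) t) = t" using h by (simp add: t)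
      have "odd k" using n k by simp
      then show "(\<lambda>(d, u, v). (n div d, u, v)) t \<in> {(x, u, v). odd x \<and> odd u \<and> odd v \<and> x * (u + v) = 2 * n}"
        using h d0 by (simp add: t k)
      show "\<phi> ((\<lambda>(d, u, v). (n div d, u, v)) t) = (case t of (d, t) \<Rightarrow> \<phi>' d)"
        using that[of u v k] h d0 by (simp add: t k)
    next
      fix t assume t_in: "t \<in> {(x, u, v). odd x \<and> odd u \<and> odd v \<and> x * (u + v) = 2 * n}"
      obtain x u v where t: "t = (x, u, v)" by (rule prod_cases3)
      have h: "odd x" "odd u" "odd v" "x * (u + v) = 2 * n" using t_in by (simp_all add: t)
      have "even (u + v)" using h by simp
      then obtain d where d: "u + v = 2 * d" by (rule evenE)
      have xd: "n = x * d" using h d by simp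
      have "d > 0" using xd n0 by simp
      then show "(\<lambda>(d, u, v). (n div d, u, v)) ((\<lambda>(x, u, v). ((u + v) div 2, u, v)) t) = t"
        using d xd by (simp add: t)
      show "(\<lambda>(x, u, v). ((u + v) div 2, u, v)) t \<in> Sigma {d. d dvd n} (\<lambda>d. {(y, w). odd y \<and> odd w \<and> y + w = 2 * d})"
        using d xd h by (simp add: t)
    qed
    finally show ?thesis by simp
  qed
  have f_eq: "sum ?f {(x, y, z, w) \<in> Q. x = z} = (\<Sum>d | d dvd n. int d * F 0)"
  proof -
    have "sum ?f {(x, y, z, w) \<in> Q. x = z} = sum (\<lambda>t. F 0) {(x, u, v). odd x \<and> odd u \<and> odd v \<and> x * (u + v) = 2 * n}"
      by (rule sum.reindex_bij_witness[where j = "\<lambda>(x, y, z, w). (x, y, w)" and i = "\<lambda>(x, u, v). (x, u, x, v)"])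
         (auto simp: Q_def algebra_simps)
    then show ?thesis using diag[of "\<lambda>t. F 0" "\<lambda>d. F 0"] by simp
  qed
  have g_eq: "sum ?g {(x, y, z, w) \<in> Q. y = w} = (\<Sum>d | d dvd n. int d * F (2 * int d))"
  proof -
    have "sum ?g {(x, y, z, w) \<in> Q. y = w} = sum (\<lambda>(x, u, v). F (int u + int v)) {(x, u, v). odd x \<and> odd u \<and> odd v \<and> x * (u + v) = 2 * n}"
      by (rule sum.reindex_bij_witness[where j = "\<lambda>(x, y, z, w). (y, x, z)" and i = "\<lambda>(x, u, v). (u, x, v, x)"])
         (auto simp: Q_def algebra_simps)
    also have "\<dots> = (\<Sum>d | d dvd n. int d * F (2 * int d))"
    proof (rule diag)
      fix x u v :: nat assume "odd u" "odd v"
      then have "even (u + v)" by simp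
      then obtain d where d: "u + v = 2 * d" by (rule evenE)
      then have iuv: "int u + int v = 2 * int d" by linarith
      then show "(case (x, u, v) of (x, u, v) \<Rightarrow> F (int u + int v)) = F (2 * int ((u + v) div 2))"
        unfolding prod.case iuv d by simp
    qed
    finally show ?thesis .
  qed
  have Fs: "F (int a - int b) = F (int b - int a)" for a b using F[of "int b - int a"] by simp
  have splitx: "sum ?f Q = sum ?f {(x, y, z, w) \<in> Q. x = z} + 2 * sum ?f Qx"
  proof -
    have "sum ?f {(x, y, z, w) \<in> Q. x < z} = sum ?f Qx"
      by (rule sum.reindex_bij_witness[where j = "\<lambda>(x, y, z, w). (z, w, x, y)" and i = "\<lambda>(x, y, z, w). (z, w, x, y)"])
         (auto simp: Qx_def Q_def add.commute Fs)
    moreover have "sum ?f Q = sum ?f {(x, y, z, w) \<in> Q. x = z} + (sum ?f {(x, y, z, w) \<in> Q. x < z} + sum ?f Qx)"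
    proof -
      have "Q = {(x, y, z, w) \<in> Q. x = z} \<union> ({(x, y, z, w) \<in> Q. x < z} \<union> Qx)" by (auto simp: Qx_def)
      moreover have "{(x, y, z, w) \<in> Q. x = z} \<inter> ({(x, y, z, w) \<in> Q. x < z} \<union> Qx) = {}"
        "{(x, y, z, w) \<in> Q. x < z} \<inter> Qx = {}" by (auto simp: Qx_def)
      ultimately show ?thesis using finQ by (metis (no_types, lifting) finite_Un sum.union_disjoint)
    qed
    ultimately show ?thesis by simp
  qed
  have splity: "sum ?g Q = sum ?g {(x, y, z, w) \<in> Q. y = w} + 2 * sum ?g Qy"
  proof -
    have "sum ?g {(x, y, z, w) \<in> Q. y < w} = sum ?g Qy"
      by (rule sum.reindex_bij_witness[where j = "\<lambda>(x, y, z, w). (z, w, x, y)" and i = "\<lambda>(x, y, z, w). (z, w, x, y)"])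
         (auto simp: Qy_def Q_def add.commute)
    moreover have "sum ?g Q = sum ?g {(x, y, z, w) \<in> Q. y = w} + (sum ?g {(x, y, z, w) \<in> Q. y < w} + sum ?g Qy)"
    proof -
      have "Q = {(x, y, z, w) \<in> Q. y = w} \<union> ({(x, y, z, w) \<in> Q. y < w} \<union> Qy)" by (auto simp: Qy_def)
      moreover have "{(x, y, z, w) \<in> Q. y = w} \<inter> ({(x, y, z, w) \<in> Q. y < w} \<union> Qy) = {}"
        "{(x, y, z, w) \<in> Q. y < w} \<inter> Qy = {}" by (auto simp: Qy_def)
      ultimately show ?thesis using finQ by (metis (no_types, lifting) finite_Un sum.union_disjoint)
    qed
    ultimately show ?thesis by simp
  qed
  have "(\<Sum>(x, y, z, w)\<in>Q. F (int x - int z) - F (int x + int z)) = sum ?f Q - sum ?g Q"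
    by (simp add: case_prod_unfold sum_subtractf)
  also have "\<dots> = (\<Sum>d | d dvd n. int d * F 0) - (\<Sum>d | d dvd n. int d * F (2 * int d))"
    unfolding splitx splity f_eq g_eq A B D by simp
  finally show ?thesis by (simp add: right_diff_distrib sum_subtractf)
qed

section \<open>Divisor sums of the characters\<close>

definition divisor_chi :: "int \<Rightarrow> nat \<Rightarrow> int" where
  "divisor_chi D m = (\<Sum>d | d dvd m. chi D d)"

lemma divisor_chi_1 [simp]: "divisor_chi D 1 = 1" "divisor_chi D (Suc 0) = 1"
  by (simp_all add: divisor_chi_def chi_def)

lemma divisor_chi_mult_prime:
  "prime p \<Longrightarrow> m > 0 \<Longrightarrow> divisor_chi D (p * m) =
    (1 + chi D p) * divisor_chi D m - (if p dvd m then chi D p * divisor_chi D (m div p) else 0)"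
  unfolding divisor_chi_def by (rule sum_dvd_mult_prime) (auto simp: chi_mult)

lemma card_form_reps_1:
  assumes "D = 1 \<or> D = 2"
  shows "card (form_reps D 1) = (if D = 1 then 4 else 2)"
proof -
  have b: "x \<in> {-1, 0, 1}" if "x\<^sup>2 \<le> 1" for x :: int
  proof -
    have "\<bar>x\<bar> \<le> 1" using that by (simp add: abs_square_le_1)
    then show ?thesis by auto
  qed
  have "x \<in> {-1, 0, 1} \<and> y \<in> {-1, 0, 1}" if "x\<^sup>2 + D * y\<^sup>2 = 1" for x y
  proof -
    have "y\<^sup>2 \<le> D * y\<^sup>2" using assms by auto
    moreover have "0 \<le> y\<^sup>2" "0 \<le> x\<^sup>2" by simp_all
    ultimately have "x\<^sup>2 \<le> 1" "y\<^sup>2 \<le> 1" using that by linarith+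
    then show ?thesis using b by blast
  qed
  then have "form_reps D 1 = {t \<in> {-1, 0, 1} \<times> {-1, 0, 1}. (fst t)\<^sup>2 + D * (snd t)\<^sup>2 = 1}"
    by (auto simp: form_reps_def)
  also have "\<dots> = (if D = 1 then {(-1, 0), (0, -1), (0, 1), (1, 0)} else {(-1, 0), (1, 0)})"
    using assms by auto
  finally show ?thesis by simp
qed

text \<open>Both sides obey the same recursion at every odd prime: character value 1 is the split
  case, -1 the inert one. The constant is the count for \<open>m = 1\<close>, that is the number of
  units, 4 or 2.\<close>

lemma card_form_reps:
  assumes D: "D = 1 \<or> D = 2" and "odd m"
  shows "int (card (form_reps D m)) = (if D = 1 then 4 else 2) * divisor_chi D m"
proof -
  have "m > 0" using \<open>odd m\<close> by (rule odd_pos)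
  then have "odd m \<longrightarrow> ?thesis"
  proof (induction m rule: nat_prime_induct)
    case one
    show ?case using card_form_reps_1[OF D] by simp
  next
    case (mult p m)
    let ?w = "if D = 1 then 4 else 2 :: int"
    show ?case
    proof
      assume "odd (p * m)"
      then have p: "odd p" "odd m" by simp_all
      have IH: "int (card (form_reps D m)) = ?w * divisor_chi D m" using mult.IH[of m] p by simp
      have IH': "int (card (form_reps D (m div p))) = ?w * divisor_chi D (m div p)" if "p dvd m"
      proof -
        have "m div p dvd m" using that by (metis dvd_div_mult_self dvd_triv_left)
        moreover from this have "odd (m div p)" using p(2) by (meson dvd_trans)
        ultimately show ?thesis using mult.IH by blast
      qed
      consider "chi D p = 1" | "chi D p = -1" using chi_odd_cases[OF p(1)] by blast
      then show "int (card (form_reps D (p * m))) = ?w * divisor_chi D (p * m)"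
      proof cases
        case 1
        then obtain t where "int p dvd t\<^sup>2 + D" using chi_residue[OF mult.hyps(1) p(1) D] by blast
        then obtain a b where ab: "a\<^sup>2 + D * b\<^sup>2 = int p" using represent_prime[OF mult.hyps(1) p(1) _ D] by blast
        have "p > 2" using prime_ge_2_nat[OF mult.hyps(1)] p(1) by (cases "p = 2") auto
        then have nd: "\<not> int p dvd D" using D zdvd_imp_le[of "int p" D] by auto
        have "card (form_reps D (p * m)) + (if p dvd m then card (form_reps D (m div p)) else 0) =
            2 * card (form_reps D m)"
          using D by (intro card_form_reps_split[OF mult.hyps(1) p(1) ab _ nd]) auto
        then have "int (card (form_reps D (p * m))) + (if p dvd m then int (card (form_reps D (m div p))) else 0) =
            2 * int (card (form_reps D m))"
          by (auto split: if_splits)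
        then show ?thesis using IH IH' 1 divisor_chi_mult_prime[OF mult.hyps(1,2), of D]
          by (cases "p dvd m"; cases "D = 1") simp_all
      next
        case 2
        then have nr: "\<not> (\<exists>t. int p dvd t\<^sup>2 + D)" using chi_residue[OF mult.hyps(1) p(1) D] by auto
        have "card (form_reps D (p * m)) = (if p dvd m then card (form_reps D (m div p)) else 0)"
          by (rule card_form_reps_inert[OF mult.hyps(1) inert_of_non_residue[OF mult.hyps(1) nr]])
        then show ?thesis using IH' 2 divisor_chi_mult_prime[OF mult.hyps(1,2), of D]
          by (cases "p dvd m") simp_all
      qed
    qed
  qed
  then show ?thesis using assms by simp
qed

lemma divisor_chi_coprime_mult:
  assumes "a > 0" "b > 0" "coprime a b"
  shows "divisor_chi D (a * b) = divisor_chi D a * divisor_chi D b"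
proof -
  have "coprime a b \<longrightarrow> ?thesis" using \<open>a > 0\<close>
  proof (induction a rule: nat_prime_induct)
    case one
    show ?case using divisor_chi_1 by simp
  next
    case (mult p a)
    show ?case
    proof
      assume "coprime (p * a) b"
      then have pb: "coprime p b" and ab: "coprime a b" by simp_all
      have nd: "\<not> p dvd b"
      proof
        assume "p dvd b"
        then have "is_unit p" using pb by (meson coprime_common_divisor dvd_refl)
        then show False using mult.hyps(1) by (simp add: prime_nat_iff)
      qed
      then have iff: "p dvd a * b \<longleftrightarrow> p dvd a" using mult.hyps(1) by (simp add: prime_dvd_mult_iff)
      have IH: "divisor_chi D (a * b) = divisor_chi D a * divisor_chi D b" using mult.IH[of a] ab by simp
      have IH': "divisor_chi D (a * b div p) = divisor_chi D (a div p) * divisor_chi D b" if "p dvd a"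
      proof -
        obtain c where c: "a = p * c" using \<open>p dvd a\<close> by (rule dvdE)
        have "c dvd a" "coprime c b" using ab by (simp_all add: c)
        then have "divisor_chi D (c * b) = divisor_chi D c * divisor_chi D b" using mult.IH[of c] by blast
        then show ?thesis using c mult.hyps by (simp add: mult.assoc prime_gt_0_nat)
      qed
      have "divisor_chi D (p * (a * b)) = (1 + chi D p) * divisor_chi D (a * b) -
          (if p dvd a then chi D p * divisor_chi D (a * b div p) else 0)"
        using divisor_chi_mult_prime[OF mult.hyps(1), of "a * b" D] mult.hyps(2) \<open>b > 0\<close> iff by simp
      also have "\<dots> = divisor_chi D (p * a) * divisor_chi D b"
        unfolding divisor_chi_mult_prime[OF mult.hyps(1,2)] IH by (simp add: IH' algebra_simps)
      finally show "divisor_chi D (p * a * b) = divisor_chi D (p * a) * divisor_chi D b"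
        by (simp add: mult.assoc)
    qed
  qed
  then show ?thesis using assms by simp
qed

lemma divisor_chi_prime_power_rec:
  assumes "prime p"
  shows "divisor_chi D (p ^ Suc (Suc i)) =
    (1 + chi D p) * divisor_chi D (p ^ Suc i) - chi D p * divisor_chi D (p ^ i)"
  using divisor_chi_mult_prime[OF assms, of "p ^ Suc i" D] assms by (simp add: prime_gt_0_nat)

lemma divisor_chi_prime: "prime p \<Longrightarrow> divisor_chi D p = 1 + chi D p"
  using divisor_chi_mult_prime[of p 1 D] by (auto simp: prime_nat_iff)

text \<open>By the three-term recursion the right-hand side is unchanged if one exponent moves from
  \<open>l\<close> to \<open>i\<close>, which reduces the claim to \<open>l = 0\<close>.\<close>

lemma divisor_chi_prime_power_add:
  assumes "prime p"
  shows "divisor_chi D (p ^ (Suc i + Suc l)) = divisor_chi D (p ^ Suc i) * divisor_chi D (p ^ Suc l)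
    - chi D p * divisor_chi D (p ^ i) * divisor_chi D (p ^ l)"
proof (induction l arbitrary: i)
  case 0
  show ?case
    using divisor_chi_prime_power_rec[OF assms, of D i] divisor_chi_prime[OF assms, of D] by (simp add: mult.commute)
next
  case (Suc l)
  have "divisor_chi D (p ^ (Suc i + Suc (Suc l))) = divisor_chi D (p ^ (Suc (Suc i) + Suc l))" by simp
  also have "\<dots> = divisor_chi D (p ^ Suc (Suc i)) * divisor_chi D (p ^ Suc l) - chi D p * divisor_chi D (p ^ Suc i) * divisor_chi D (p ^ l)"
    by (rule Suc)
  also have "\<dots> = divisor_chi D (p ^ Suc i) * divisor_chi D (p ^ Suc (Suc l)) - chi D p * divisor_chi D (p ^ i) * divisor_chi D (p ^ Suc l)"
    unfolding divisor_chi_prime_power_rec[OF assms] by (simp add: algebra_simps del: power_Suc)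
  finally show ?case .
qed

text \<open>Hecke's multiplication rule, with one correction term because \<open>p\<close> is the
  only possible common prime: split off the powers of \<open>p\<close> and treat the remaining
  coprime factors multiplicatively.\<close>

lemma divisor_chi_mult:
  assumes p: "prime p" and "a > 0" "b > 0" and common: "\<And>r. prime r \<Longrightarrow> r dvd a \<Longrightarrow> r dvd b \<Longrightarrow> r = p"
  shows "divisor_chi D (a * b) = divisor_chi D a * divisor_chi D b -
    (if p dvd a \<and> p dvd b then chi D p * divisor_chi D (a div p) * divisor_chi D (b div p) else 0)"
proof (cases "p dvd a \<and> p dvd b")
  case False
  have "coprime a b"
  proof (rule ccontr)
    assume "\<not> coprime a b"
    then have "gcd a b \<noteq> 1" unfolding coprime_iff_gcd_eq_1 .
    then obtain r where "prime r" "r dvd gcd a b" using prime_factor_nat by blast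
    then have "r = p" "r dvd a" "r dvd b" using common[of r] by simp_all
    then show False using False by simp
  qed
  then have "divisor_chi D (a * b) = divisor_chi D a * divisor_chi D b"
    by (rule divisor_chi_coprime_mult[OF assms(2,3)])
  then show ?thesis by (simp only: False if_False diff_0_right)
next
  case True
  have pu: "\<not> is_unit p" and p0: "p > 0" using prime_gt_1_nat[OF p] by simp_all
  obtain i a' where a: "a = p ^ i * a'" "\<not> p dvd a'"
    using multiplicity_decompose'[of a p] pu \<open>a > 0\<close> by blast
  obtain l b' where b: "b = p ^ l * b'" "\<not> p dvd b'"
    using multiplicity_decompose'[of b p] pu \<open>b > 0\<close> by blast
  have "i \<noteq> 0" using True a by (cases i) auto
  then obtain i' where i: "i = Suc i'" using not0_implies_Suc by blast
  have "l \<noteq> 0" using True b by (cases l) auto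
  then obtain l' where l: "l = Suc l'" using not0_implies_Suc by blast
  have pos: "a' > 0" "b' > 0" using a(1) b(1) assms(2,3) by (auto intro!: Nat.gr0I)
  have copa: "coprime (p ^ j) a'" and copb: "coprime (p ^ j) b'" for j
    using prime_imp_coprime[OF p a(2)] prime_imp_coprime[OF p b(2)] by simp_all
  have cop: "coprime a' b'"
  proof (rule ccontr)
    assume "\<not> coprime a' b'"
    then have "gcd a' b' \<noteq> 1" unfolding coprime_iff_gcd_eq_1 .
    then obtain r where r: "prime r" "r dvd gcd a' b'" using prime_factor_nat by blast
    then have "r dvd a" "r dvd b" unfolding a(1) b(1) by simp_all
    then have "r = p" by (rule common[OF r(1)])
    then show False using r a(2) by simp
  qed
  have 1: "divisor_chi D (p ^ j * a') = divisor_chi D (p ^ j) * divisor_chi D a'"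
    "divisor_chi D (p ^ j * b') = divisor_chi D (p ^ j) * divisor_chi D b'" for j
    using pos p0 copa copb by (simp_all add: divisor_chi_coprime_mult)
  have "a * b = p ^ (i + l) * (a' * b')" by (simp add: a b power_add)
  moreover have "coprime (p ^ (i + l)) (a' * b')" using copa[of "i + l"] copb[of "i + l"] by simp
  then have "divisor_chi D (p ^ (i + l) * (a' * b')) = divisor_chi D (p ^ (i + l)) * divisor_chi D (a' * b')"
    using pos p0 by (intro divisor_chi_coprime_mult) simp_all
  moreover have "divisor_chi D (a' * b') = divisor_chi D a' * divisor_chi D b'"
    by (rule divisor_chi_coprime_mult[OF pos cop])
  ultimately have "divisor_chi D (a * b) = divisor_chi D (p ^ (Suc i' + Suc l')) * (divisor_chi D a' * divisor_chi D b')"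
    by (simp only: i l)
  moreover have "divisor_chi D a = divisor_chi D (p ^ Suc i') * divisor_chi D a'"
    "divisor_chi D b = divisor_chi D (p ^ Suc l') * divisor_chi D b'"
    unfolding a(1) b(1) i l by (rule 1)+
  moreover have "a div p = p ^ i' * a'" "b div p = p ^ l' * b'" using p0 by (simp_all add: a b i l mult.assoc)
  then have "divisor_chi D (a div p) = divisor_chi D (p ^ i') * divisor_chi D a'"
    "divisor_chi D (b div p) = divisor_chi D (p ^ l') * divisor_chi D b'"
    by (simp_all only: 1)
  ultimately show ?thesis
    by (simp only: True if_True simp_thms divisor_chi_prime_power_add[OF p]) (simp only: algebra_simps)
qed

section \<open>Squares and twice squares\<close>

text \<open>For odd \<open>n\<close> these are the numbers \<open>n - u\<close> with
  \<open>u\<close> even and \<open>|u| < n\<close>; the complement \<open>2 n - a\<close> is then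
  \<open>n + u\<close>.\<close>

definition odd_part :: "nat \<Rightarrow> nat set" where
  "odd_part n = {a. odd a \<and> a < 2 * n}"

lemma finite_odd_part [simp]: "finite (odd_part n)"
  by (rule finite_subset[of _ "{..2 * n}"]) (auto simp: odd_part_def)

lemma odd_part_complement: "a \<in> odd_part n \<Longrightarrow> 2 * n - a \<in> odd_part n"
  by (auto simp: odd_part_def odd_pos)

text \<open>On even \<open>t\<close> this is \<open>cos (\<pi> t / 2)\<close> for \<open>D = 1\<close> and \<open>2 cos (\<pi> t / 4)\<close> for \<open>D = 2\<close>: on odd
  arguments the characters are \<open>sin (\<pi> x / 2)\<close> and \<open>\<surd>2 sin (\<pi> x / 4)\<close>.\<close>

definition cos_kernel :: "int \<Rightarrow> int \<Rightarrow> int" where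
  "cos_kernel D t = (if D = 1 then (if 4 dvd t then 1 else -1)
     else (if 8 dvd t then 2 else if 4 dvd t then -2 else 0))"

text \<open>The formula \<open>2 sin \<alpha> sin \<beta> = cos (\<alpha> - \<beta>) - cos (\<alpha>
  + \<beta>)\<close>, verified on odd residues modulo 8. It brings products of characters into the
  shape required by \<open>liouville_sum\<close>.\<close>

lemma chi_product_cos_kernel:
  assumes "odd x" "odd z"
  shows "2 * (chi D x * chi D z) = cos_kernel D (int x - int z) - cos_kernel D (int x + int z)"
proof -
  define r s where "r = x mod 8" and "s = z mod 8"
  have rs: "r \<in> {1, 3, 5, 7}" "s \<in> {1, 3, 5, 7}"
    using assms unfolding r_def s_def insert_iff empty_iff by presburger+
  have m: "int x mod 8 = int r" "int z mod 8 = int s" by (simp_all add: r_def s_def zmod_int)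
  have dvds: "4 dvd int x - int z \<longleftrightarrow> 4 dvd int r - int s" "8 dvd int x - int z \<longleftrightarrow> 8 dvd int r - int s"
    "4 dvd int x + int z \<longleftrightarrow> 4 dvd int r + int s" "8 dvd int x + int z \<longleftrightarrow> 8 dvd int r + int s"
    using m by presburger+
  have kernel: "cos_kernel D (int x - int z) = cos_kernel D (int r - int s)"
    "cos_kernel D (int x + int z) = cos_kernel D (int r + int s)"
    by (simp_all only: cos_kernel_def dvds)
  have chis: "chi D x = chi D r" "chi D z = chi D s" by (simp_all only: r_def s_def chi_mod_8)
  show ?thesis unfolding kernel chis
    using rs by (elim insertE emptyE; simp add: chi_def cos_kernel_def)
qed

text \<open>Expanding the divisor sums turns the convolution into a sum over
  \<open>x y + z w = 2 n\<close>. The result is the same for both \<open>D\<close>, because the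
  kernel difference between 0 and \<open>2 d\<close> is 2 in either case for odd
  \<open>d\<close>.\<close>

lemma sum_divisor_chi_odd_part:
  assumes n: "odd n" and D: "D = 1 \<or> D = 2"
  shows "(\<Sum>a\<in>odd_part n. divisor_chi D a * divisor_chi D (2 * n - a)) = (\<Sum>d | d dvd n. int d)"
proof -
  define Q where "Q = {(x, y, z, w). odd x \<and> odd y \<and> odd z \<and> odd w \<and> x * y + z * w = 2 * n}"
  have pos: "a > 0" "2 * n - a > 0" if "a \<in> odd_part n" for a
    using that by (auto simp: odd_part_def odd_pos)
  have "(\<Sum>a\<in>odd_part n. divisor_chi D a * divisor_chi D (2 * n - a)) =
      (\<Sum>a\<in>odd_part n. \<Sum>(x, z)\<in>{x. x dvd a} \<times> {z. z dvd 2 * n - a}. chi D x * chi D z)"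
    by (simp add: divisor_chi_def sum_product sum.cartesian_product)
  also have "\<dots> = (\<Sum>(a, t)\<in>Sigma (odd_part n) (\<lambda>a. {x. x dvd a} \<times> {z. z dvd 2 * n - a}). case t of (x, z) \<Rightarrow> chi D x * chi D z)"
    using pos by (intro sum.Sigma) auto
  also have "\<dots> = (\<Sum>(x, y, z, w)\<in>Q. chi D x * chi D z)"
  proof (rule sum.reindex_bij_witness[where j = "\<lambda>(a, x, z). (x, a div x, z, (2 * n - a) div z)" and i = "\<lambda>(x, y, z, w). (x * y, x, z)"])
    fix t assume t_in: "t \<in> Sigma (odd_part n) (\<lambda>a. {x. x dvd a} \<times> {z. z dvd 2 * n - a})"
    obtain a x z where t: "t = (a, x, z)" by (rule prod_cases3)
    have h: "a \<in> odd_part n" "x dvd a" "z dvd 2 * n - a" using t_in by (simp_all add: t)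
    show "(\<lambda>(x, y, z, w). (x * y, x, z)) ((\<lambda>(a, x, z). (x, a div x, z, (2 * n - a) div z)) t) = t"
      using h by (simp add: t)
    have oa: "odd a" "odd (2 * n - a)" "a < 2 * n" using h(1) odd_part_complement[OF h(1)] by (simp_all add: odd_part_def)
    obtain y where y: "a = x * y" using h(2) by (rule dvdE)
    obtain w where w: "2 * n - a = z * w" using h(3) by (rule dvdE)
    have "odd (x * y)" using oa(1) unfolding y .
    moreover have "odd (z * w)" using oa(2) unfolding w .
    ultimately have odds: "odd x" "odd y" "odd z" "odd w" by simp_all
    have "x * y + z * w = 2 * n" using y w oa(3) by simp
    moreover have "a div x = y" "(2 * n - a) div z = w" using odds y w by (simp_all add: odd_pos)
    ultimately show "(\<lambda>(a, x, z). (x, a div x, z, (2 * n - a) div z)) t \<in> Q"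
      using odds by (simp add: t Q_def)
    show "(case (\<lambda>(a, x, z). (x, a div x, z, (2 * n - a) div z)) t of (x, y, z, w) \<Rightarrow> chi D x * chi D z) =
        (case t of (a, t) \<Rightarrow> case t of (x, z) \<Rightarrow> chi D x * chi D z)"
      by (simp add: t)
  next
    fix t assume t_in: "t \<in> Q"
    obtain x y z w where t: "t = (x, y, z, w)" by (rule prod_cases4)
    have h: "odd x" "odd y" "odd z" "odd w" "x * y + z * w = 2 * n" using t_in by (simp_all add: t Q_def)
    have e: "2 * n - x * y = z * w" using h(5) by simp
    have "0 < z * w" using h by (simp add: odd_pos)
    then have lt: "x * y < 2 * n" using h(5) by linarith
    show "(\<lambda>(a, x, z). (x, a div x, z, (2 * n - a) div z)) ((\<lambda>(x, y, z, w). (x * y, x, z)) t) = t"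
      using h(1,3) by (simp add: t e odd_pos)
    show "(\<lambda>(x, y, z, w). (x * y, x, z)) t \<in> Sigma (odd_part n) (\<lambda>a. {x. x dvd a} \<times> {z. z dvd 2 * n - a})"
      using h lt by (simp add: t e odd_part_def)
  qed
  finally have 1: "(\<Sum>a\<in>odd_part n. divisor_chi D a * divisor_chi D (2 * n - a)) = (\<Sum>(x, y, z, w)\<in>Q. chi D x * chi D z)" .
  have "2 * (\<Sum>(x, y, z, w)\<in>Q. chi D x * chi D z) =
      (\<Sum>(x, y, z, w)\<in>Q. cos_kernel D (int x - int z) - cos_kernel D (int x + int z))"
    unfolding sum_distrib_left
    by (intro sum.cong refl) (auto simp: Q_def chi_product_cos_kernel[symmetric])
  also have "\<dots> = (\<Sum>d | d dvd n. int d * (cos_kernel D 0 - cos_kernel D (2 * int d)))"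
    unfolding Q_def by (rule liouville_sum[OF n]) (simp add: cos_kernel_def)
  also have "\<dots> = (\<Sum>d | d dvd n. 2 * int d)"
  proof (intro sum.cong refl)
    fix d assume "d \<in> {d. d dvd n}"
    then have "odd d" using n by (auto dest: dvd_trans)
    then have "\<not> 4 dvd 2 * int d" "\<not> 8 dvd 2 * int d" by presburger+
    then show "int d * (cos_kernel D 0 - cos_kernel D (2 * int d)) = 2 * int d"
      using D by (auto simp: cos_kernel_def)
  qed
  finally show ?thesis using 1 by (simp add: sum_distrib_left[symmetric])
qed

lemma sum_divisors_prime_power:
  assumes "prime p"
  shows "(\<Sum>d | d dvd p ^ Suc k. int d) = (\<Sum>d | d dvd p ^ k. int d) + int p ^ Suc k"
proof (induction k)
  case 0
  have "{d. d dvd p} = {1, p}" using assms by (auto simp: prime_nat_iff)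
  moreover have "p \<noteq> 1" using assms by auto
  ultimately show ?case by simp
next
  case (Suc k)
  have "(\<Sum>d | d dvd p * p ^ Suc k. int d) =
      (1 + int p) * (\<Sum>d | d dvd p ^ Suc k. int d) - int p * (\<Sum>d | d dvd p ^ k. int d)"
    using sum_dvd_mult_prime[OF assms, of "p ^ Suc k" int] assms by (simp add: prime_gt_0_nat)
  then show ?case using Suc by (simp add: algebra_simps)
qed

text \<open>A common prime of \<open>a\<close> and \<open>2 p^k - a\<close> divides
  \<open>2 p^k\<close> and is odd, so it is \<open>p\<close> and \<open>divisor_chi_mult\<close>
  applies. The corrections come from \<open>a = p b\<close> and form the same convolution at
  \<open>p^(k-1)\<close>.\<close>

lemma sum_divisor_chi_mult_odd_part:
  assumes p: "prime p" "odd p" and D: "D = 1 \<or> D = 2"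
  shows "(\<Sum>a\<in>odd_part (p ^ k). divisor_chi D (a * (2 * p ^ k - a))) =
    (\<Sum>d | d dvd p ^ k. int d) - (if k = 0 then 0 else chi D p * (\<Sum>d | d dvd p ^ (k - 1). int d))"
proof -
  let ?n = "p ^ k"
  have common: "r = p" if "a \<in> odd_part ?n" "prime r" "r dvd a" "r dvd 2 * ?n - a" for a r
  proof -
    have "r dvd a + (2 * ?n - a)" using that by (intro dvd_add)
    then have "r dvd 2 * ?n" using that(1) by (simp add: odd_part_def)
    moreover have "r \<noteq> 2" using that by (auto simp: odd_part_def)
    then have "\<not> r dvd 2" using that(2) by (metis primes_dvd_imp_eq two_is_prime_nat)
    ultimately have "r dvd ?n" using that(2) by (simp add: prime_dvd_mult_iff)
    then have "r dvd p" using that(2) prime_dvd_power by blast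
    then show ?thesis using that(2) p(1) primes_dvd_imp_eq by blast
  qed
  define c where "c a = (if p dvd a \<and> p dvd 2 * ?n - a then chi D p * divisor_chi D (a div p) * divisor_chi D ((2 * ?n - a) div p) else 0)" for a
  have "(\<Sum>a\<in>odd_part ?n. divisor_chi D (a * (2 * ?n - a))) =
      (\<Sum>a\<in>odd_part ?n. divisor_chi D a * divisor_chi D (2 * ?n - a) - c a)"
  proof (intro sum.cong refl)
    fix a assume a: "a \<in> odd_part ?n"
    then have "a > 0" "2 * ?n - a > 0" by (auto simp: odd_part_def odd_pos)
    then show "divisor_chi D (a * (2 * ?n - a)) = divisor_chi D a * divisor_chi D (2 * ?n - a) - c a"
      unfolding c_def using common[OF a] by (intro divisor_chi_mult[OF p(1)]) auto
  qed
  also have "\<dots> = (\<Sum>d | d dvd ?n. int d) - (\<Sum>a\<in>odd_part ?n. c a)"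
    unfolding sum_subtractf using sum_divisor_chi_odd_part[OF _ D, of ?n] p(2) by simp
  also have "(\<Sum>a\<in>odd_part ?n. c a) = (if k = 0 then 0 else chi D p * (\<Sum>d | d dvd p ^ (k - 1). int d))"
  proof (cases k)
    case 0
    have "c a = 0" if "a \<in> odd_part ?n" for a
    proof -
      have "a < p" using that 0 prime_ge_2_nat[OF p(1)] by (auto simp: odd_part_def)
      moreover have "a > 0" using that by (auto simp: odd_part_def odd_pos)
      ultimately have "\<not> p dvd a" by (auto dest: dvd_imp_le)
      then show ?thesis by (simp add: c_def)
    qed
    then show ?thesis using 0 by simp
  next
    case (Suc j)
    let ?m = "p ^ j"
    have p0: "p > 0" using p(1) by (rule prime_gt_0_nat)
    have "(\<Sum>a\<in>odd_part ?n. c a) = (\<Sum>a\<in>(*) p ` odd_part ?m. c a)"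
    proof (rule sum.mono_neutral_right)
      show "(*) p ` odd_part ?m \<subseteq> odd_part ?n" using p(2) p0 by (auto simp: odd_part_def Suc)
      show "\<forall>a\<in>odd_part ?n - (*) p ` odd_part ?m. c a = 0"
      proof
        fix a assume a: "a \<in> odd_part ?n - (*) p ` odd_part ?m"
        have "\<not> p dvd a"
        proof
          assume "p dvd a"
          then obtain b where b: "a = p * b" by (rule dvdE)
          have "p * b < p * (2 * ?m)" "odd b" using a b by (simp_all add: odd_part_def Suc)
          then have "b \<in> odd_part ?m" by (simp add: odd_part_def)
          then show False using a b by blast
        qed
        then show "c a = 0" by (simp add: c_def)
      qed
    qed simp
    also have "\<dots> = (\<Sum>b\<in>odd_part ?m. c (p * b))"
      using p0 by (subst sum.reindex) (auto simp: inj_on_def)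
    also have "\<dots> = (\<Sum>b\<in>odd_part ?m. chi D p * (divisor_chi D b * divisor_chi D (2 * ?m - b)))"
    proof (intro sum.cong refl)
      fix b
      have "2 * ?n - p * b = p * (2 * ?m - b)" by (simp add: Suc diff_mult_distrib2)
      then show "c (p * b) = chi D p * (divisor_chi D b * divisor_chi D (2 * ?m - b))"
        using p0 by (simp add: c_def)
    qed
    also have "\<dots> = chi D p * (\<Sum>d | d dvd ?m. int d)"
      unfolding sum_distrib_left[symmetric] using sum_divisor_chi_odd_part[OF _ D, of ?m] p(2) by simp
    finally show ?thesis using Suc by simp
  qed
  finally show ?thesis .
qed

section \<open>Lattice points on spheres\<close>

definition sphere :: "nat \<Rightarrow> (int \<times> int \<times> int) set" where
  "sphere N = {(x, y, z). x\<^sup>2 + y\<^sup>2 + z\<^sup>2 = int N}"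

lemma sphere_bound:
  assumes "x\<^sup>2 + y\<^sup>2 + z\<^sup>2 = int N"
  shows "x \<in> {- int N..int N}"
proof -
  have "\<bar>x\<bar> \<le> x\<^sup>2"
    by (metis abs_ge_zero abs_mult_self_eq int_one_le_iff_zero_less le_less mult_le_cancel_left1 not_less power2_eq_square)
  moreover have "0 \<le> y\<^sup>2" "0 \<le> z\<^sup>2" by simp_all
  ultimately have "\<bar>x\<bar> \<le> int N" using assms by linarith
  then show ?thesis by auto
qed

lemma sphere_subset: "sphere N \<subseteq> {- int N..int N} \<times> {- int N..int N} \<times> {- int N..int N}"
proof
  fix t assume t_in: "t \<in> sphere N"
  obtain x y z where t: "t = (x, y, z)" by (rule prod_cases3)
  have "x\<^sup>2 + y\<^sup>2 + z\<^sup>2 = int N" using t_in by (simp add: t sphere_def)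
  then show "t \<in> {- int N..int N} \<times> {- int N..int N} \<times> {- int N..int N}"
    using sphere_bound[of x y z N] sphere_bound[of y x z N] sphere_bound[of z x y N] by (simp add: t add_ac)
qed

lemma finite_sphere: "finite (sphere N)"
  by (rule finite_subset[OF sphere_subset]) simp

lemma sum_mult_sign_int:
  fixes f :: "nat \<Rightarrow> real"
  shows "(\<Sum>x\<le>N. mult_sign x * f x) = (\<Sum>x\<in>{- int N..int N}. (-1) ^ nat \<bar>x\<bar> * f (nat \<bar>x\<bar>))"
proof (induction N)
  case 0
  show ?case by (simp add: mult_sign_def)
next
  case (Suc N)
  have "{- int (Suc N)..int (Suc N)} = insert (- int (Suc N)) (insert (int (Suc N)) {- int N..int N})" by auto
  moreover have "(\<Sum>x\<in>insert (- int (Suc N)) (insert (int (Suc N)) {- int N..int N}). (-1) ^ nat \<bar>x\<bar> * f (nat \<bar>x\<bar>)) =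
     2 * ((-1) ^ Suc N * f (Suc N)) + (\<Sum>x\<in>{- int N..int N}. (-1) ^ nat \<bar>x\<bar> * f (nat \<bar>x\<bar>))"
    by (simp add: nat_add_distrib del: of_nat_Suc)
  ultimately show ?case using Suc by (simp add: mult_sign_def)
qed

text \<open>All signs agree, since \<open>x + y + z\<close> has the parity of
  \<open>x^2 + y^2 + z^2 = N\<close>.\<close>

lemma three_squares_sum_eq_card_sphere: "three_squares_sum N = (-1) ^ N * real (card (sphere N))"
proof -
  let ?I = "{- int N..int N}"
  let ?s = "\<lambda>x. (-1::real) ^ nat \<bar>x\<bar>"
  have "three_squares_sum N = (\<Sum>x\<le>N. mult_sign x * (\<Sum>y\<le>N. mult_sign y * (\<Sum>z\<le>N. mult_sign z *
      (if x\<^sup>2 + y\<^sup>2 + z\<^sup>2 = N then 1 else 0))))"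
    unfolding three_squares_sum_def sum_distrib_left by (intro sum.cong refl) simp
  also have "\<dots> = (\<Sum>x\<in>?I. \<Sum>y\<in>?I. \<Sum>z\<in>?I. ?s x * (?s y * (?s z *
      (if (nat \<bar>x\<bar>)\<^sup>2 + (nat \<bar>y\<bar>)\<^sup>2 + (nat \<bar>z\<bar>)\<^sup>2 = N then 1 else 0))))"
    by (simp only: sum_mult_sign_int) (simp only: sum_distrib_left)
  also have "\<dots> = (\<Sum>x\<in>?I. \<Sum>y\<in>?I. \<Sum>z\<in>?I. if (x, y, z) \<in> sphere N then (-1) ^ N else 0)"
  proof (intro sum.cong refl)
    fix x y z :: int
    have iff: "(nat \<bar>x\<bar>)\<^sup>2 + (nat \<bar>y\<bar>)\<^sup>2 + (nat \<bar>z\<bar>)\<^sup>2 = N \<longleftrightarrow> (x, y, z) \<in> sphere N"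
    proof -
      have "(nat \<bar>x\<bar>)\<^sup>2 + (nat \<bar>y\<bar>)\<^sup>2 + (nat \<bar>z\<bar>)\<^sup>2 = N \<longleftrightarrow>
        int ((nat \<bar>x\<bar>)\<^sup>2 + (nat \<bar>y\<bar>)\<^sup>2 + (nat \<bar>z\<bar>)\<^sup>2) = int N" by (simp only: of_nat_eq_iff)
      also have "\<dots> \<longleftrightarrow> (x, y, z) \<in> sphere N" by (simp add: sphere_def)
      finally show ?thesis .
    qed
    have "?s x * (?s y * ?s z) = (-1) ^ N" if "(nat \<bar>x\<bar>)\<^sup>2 + (nat \<bar>y\<bar>)\<^sup>2 + (nat \<bar>z\<bar>)\<^sup>2 = N"
      unfolding that[symmetric] by (auto simp: minus_one_power_iff)
    then show "?s x * (?s y * (?s z * (if (nat \<bar>x\<bar>)\<^sup>2 + (nat \<bar>y\<bar>)\<^sup>2 + (nat \<bar>z\<bar>)\<^sup>2 = N then 1 else 0))) =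
        (if (x, y, z) \<in> sphere N then (-1) ^ N else 0)"
      using iff by simp
  qed
  also have "\<dots> = (\<Sum>t\<in>?I \<times> ?I \<times> ?I. if t \<in> sphere N then (-1) ^ N else 0)"
    by (simp add: sum.cartesian_product)
  also have "\<dots> = (\<Sum>t\<in>sphere N. (-1) ^ N)"
    using sphere_subset[of N] by (intro sum.mono_neutral_cong_right) auto
  finally show ?thesis by simp
qed

text \<open>Double counting of pairs of a point and an even coordinate; by symmetry each coordinate
  is even equally often.\<close>

lemma card_sphere_even:
  assumes "\<And>x y z. (x, y, z) \<in> sphere N \<Longrightarrow>
    of_bool (even x) + of_bool (even y) + of_bool (even z) = (c::nat)"
  shows "3 * card {(x, y, z) \<in> sphere N. even x} = c * card (sphere N)"
proof -
  let ?T = "sphere N"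
  have card: "card {(x, y, z) \<in> ?T. P x y z} = (\<Sum>t\<in>?T. of_bool (case t of (x, y, z) \<Rightarrow> P x y z))" for P
  proof -
    have "{(x, y, z) \<in> ?T. P x y z} = {t \<in> ?T. case t of (x, y, z) \<Rightarrow> P x y z}" by auto
    then show ?thesis using finite_sphere[of N] by (simp add: of_bool_def sum.inter_filter[symmetric])
  qed
  have y: "card {(x, y, z) \<in> ?T. even y} = card {(x, y, z) \<in> ?T. even x}"
    by (rule bij_betw_same_card[OF bij_betw_byWitness[where f = "\<lambda>(x, y, z). (y, x, z)" and f' = "\<lambda>(x, y, z). (y, x, z)"]])
       (auto simp: sphere_def add_ac)
  have z: "card {(x, y, z) \<in> ?T. even z} = card {(x, y, z) \<in> ?T. even x}"
    by (rule bij_betw_same_card[OF bij_betw_byWitness[where f = "\<lambda>(x, y, z). (z, y, x)" and f' = "\<lambda>(x, y, z). (z, y, x)"]])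
       (auto simp: sphere_def add_ac)
  have "3 * card {(x, y, z) \<in> ?T. even x} =
      card {(x, y, z) \<in> ?T. even x} + card {(x, y, z) \<in> ?T. even y} + card {(x, y, z) \<in> ?T. even z}"
    using y z by simp
  also have "\<dots> = (\<Sum>t\<in>?T. of_bool (case t of (x, y, z) \<Rightarrow> even x) + of_bool (case t of (x, y, z) \<Rightarrow> even y) +
      of_bool (case t of (x, y, z) \<Rightarrow> even z))"
    unfolding card sum.distrib ..
  also have "\<dots> = (\<Sum>t\<in>?T. c)"
  proof (intro sum.cong refl)
    fix t assume "t \<in> ?T"
    then show "of_bool (case t of (x, y, z) \<Rightarrow> even x) + of_bool (case t of (x, y, z) \<Rightarrow> even y) +
      of_bool (case t of (x, y, z) \<Rightarrow> even z) = c"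
      using assms by (cases t) simp
  qed
  finally show ?thesis by simp
qed

text \<open>For odd \<open>n\<close>, slicing along an even coordinate makes
  \<open>n^2 - u^2\<close> odd, as \<open>card_form_reps\<close> requires.\<close>

definition even_slices :: "int \<Rightarrow> nat \<Rightarrow> (int \<times> int \<times> int) set" where
  "even_slices D n = {(u, v, w). even u \<and> u\<^sup>2 + v\<^sup>2 + D * w\<^sup>2 = (int n)\<^sup>2}"

lemma card_even_slices:
  assumes n: "odd n" and D: "D = 1 \<or> D = 2"
  shows "int (card (even_slices D n)) =
    (if D = 1 then 4 else 2) * (\<Sum>a\<in>odd_part n. divisor_chi D (a * (2 * n - a)))"
proof -
  have D0: "D > 0" using D by auto
  have "bij_betw (\<lambda>(a, v, w). (int n - int a, v, w)) (Sigma (odd_part n) (\<lambda>a. form_reps D (a * (2 * n - a)))) (even_slices D n)"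
  proof (rule bij_betw_byWitness[where f' = "\<lambda>(u, v, w). (nat (int n - u), v, w)"])
    have key: "int (a * (2 * n - a)) = (int n)\<^sup>2 - (int n - int a)\<^sup>2" if "a \<le> 2 * n" for a
      using that by (simp add: of_nat_diff power2_eq_square algebra_simps)
    show "\<forall>t\<in>Sigma (odd_part n) (\<lambda>a. form_reps D (a * (2 * n - a))).
        (\<lambda>(u, v, w). (nat (int n - u), v, w)) ((\<lambda>(a, v, w). (int n - int a, v, w)) t) = t"
      by auto
    have bound: "\<bar>u\<bar> < int n" if "(u, v, w) \<in> even_slices D n" for u v w
    proof -
      have h: "even u" "u\<^sup>2 + v\<^sup>2 + D * w\<^sup>2 = (int n)\<^sup>2" using that by (simp_all add: even_slices_def)
      have "0 \<le> v\<^sup>2" "0 \<le> D * w\<^sup>2" using D0 by simp_all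
      then have "u\<^sup>2 \<le> (int n)\<^sup>2" using h(2) by linarith
      then have "\<bar>u\<bar> \<le> int n" using abs_le_square_iff[of u "int n"] by simp
      moreover have "\<bar>u\<bar> \<noteq> int n"
      proof
        assume "\<bar>u\<bar> = int n"
        then have "even (int n)" using h(1) by (metis even_abs_add_iff even_zero add.right_neutral dvd_abs_iff)
        then show False using n by simp
      qed
      ultimately show ?thesis by simp
    qed
    show "\<forall>t\<in>even_slices D n. (\<lambda>(a, v, w). (int n - int a, v, w)) ((\<lambda>(u, v, w). (nat (int n - u), v, w)) t) = t"
      using bound by fastforce
    show "(\<lambda>(a, v, w). (int n - int a, v, w)) ` Sigma (odd_part n) (\<lambda>a. form_reps D (a * (2 * n - a))) \<subseteq> even_slices D n"
    proof (rule image_subsetI)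
      fix t assume t_in: "t \<in> Sigma (odd_part n) (\<lambda>a. form_reps D (a * (2 * n - a)))"
      obtain a v w where t: "t = (a, v, w)" by (rule prod_cases3)
      have h: "odd a" "a < 2 * n" "v\<^sup>2 + D * w\<^sup>2 = int (a * (2 * n - a))"
        using t_in unfolding t odd_part_def form_reps_def by simp_all
      have "(int n - int a)\<^sup>2 + v\<^sup>2 + D * w\<^sup>2 = (int n)\<^sup>2" using h(3) key[of a] h(2) by linarith
      then show "(\<lambda>(a, v, w). (int n - int a, v, w)) t \<in> even_slices D n"
        using h(1) n by (simp add: t even_slices_def)
    qed
    show "(\<lambda>(u, v, w). (nat (int n - u), v, w)) ` even_slices D n \<subseteq> Sigma (odd_part n) (\<lambda>a. form_reps D (a * (2 * n - a)))"
    proof (rule image_subsetI)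
      fix t assume t_in: "t \<in> even_slices D n"
      obtain u v w where t: "t = (u, v, w)" by (rule prod_cases3)
      have h: "even u" "u\<^sup>2 + v\<^sup>2 + D * w\<^sup>2 = (int n)\<^sup>2" using t_in by (simp_all add: t even_slices_def)
      have b: "\<bar>u\<bar> < int n" using bound t_in t by blast
      define a where "a = nat (int n - u)"
      have a: "int a = int n - u" using b by (simp add: a_def)
      have "a < 2 * n" using a b by linarith
      moreover have "odd (int a)" unfolding a using h(1) n by simp
      then have "odd a" by simp
      moreover have "v\<^sup>2 + D * w\<^sup>2 = int (a * (2 * n - a))"
        using key[of a] h(2) \<open>a < 2 * n\<close> a by simp
      ultimately show "(\<lambda>(u, v, w). (nat (int n - u), v, w)) t \<in> Sigma (odd_part n) (\<lambda>a. form_reps D (a * (2 * n - a)))"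
        by (simp add: t odd_part_def form_reps_def flip: a_def)
    qed
  qed
  then have "card (even_slices D n) = card (Sigma (odd_part n) (\<lambda>a. form_reps D (a * (2 * n - a))))"
    by (rule bij_betw_same_card[THEN sym])
  also have "\<dots> = (\<Sum>a\<in>odd_part n. card (form_reps D (a * (2 * n - a))))"
    using finite_form_reps[OF D0] by simp
  finally have "int (card (even_slices D n)) = (\<Sum>a\<in>odd_part n. int (card (form_reps D (a * (2 * n - a)))))"
    by simp
  also have "\<dots> = (\<Sum>a\<in>odd_part n. (if D = 1 then 4 else 2) * divisor_chi D (a * (2 * n - a)))"
  proof (intro sum.cong refl card_form_reps[OF D])
    fix a assume "a \<in> odd_part n"
    then show "odd (a * (2 * n - a))" using odd_part_complement[of a n] by (simp add: odd_part_def)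
  qed
  finally show ?thesis by (simp only: sum_distrib_left)
qed

lemma square_mod_4: "(x::int)\<^sup>2 mod 4 = of_bool (odd x)"
  using square_cases[of x] by auto

lemma sphere_square_parity:
  assumes n: "odd n" and h: "(x, y, z) \<in> sphere (n\<^sup>2)"
  shows "of_bool (even x) + of_bool (even y) + of_bool (even z) = (2::nat)"
proof -
  have "x\<^sup>2 + y\<^sup>2 + z\<^sup>2 = (int n)\<^sup>2" using h by (simp add: sphere_def)
  moreover have "(int n)\<^sup>2 mod 4 = 1" using square_mod_4[of "int n"] n by simp
  ultimately have "(x\<^sup>2 + y\<^sup>2 + z\<^sup>2) mod 4 = 1" by simp
  then have "(of_bool (odd x) + of_bool (odd y) + of_bool (odd z)) mod 4 = (1::int)"
    unfolding square_mod_4[symmetric] by presburger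
  then show ?thesis by (cases "even x"; cases "even y"; cases "even z") simp_all
qed

lemma sphere_double_square_parity:
  assumes n: "odd n" and h: "(x, y, z) \<in> sphere (2 * n\<^sup>2)"
  shows "of_bool (even x) + of_bool (even y) + of_bool (even z) = (1::nat)"
proof -
  have "x\<^sup>2 + y\<^sup>2 + z\<^sup>2 = 2 * (int n)\<^sup>2" using h by (simp add: sphere_def)
  moreover have "(int n)\<^sup>2 mod 4 = 1" using square_mod_4[of "int n"] n by simp
  ultimately have "(x\<^sup>2 + y\<^sup>2 + z\<^sup>2) mod 4 = 2" by presburger
  then have "(of_bool (odd x) + of_bool (odd y) + of_bool (odd z)) mod 4 = (2::int)"
    unfolding square_mod_4[symmetric] by presburger
  then show ?thesis by (cases "even x"; cases "even y"; cases "even z") simp_all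
qed

text \<open>Two of the three coordinates are even, so the slices contain two thirds of the sphere.
  They number four times the divisor sum, hence the sphere has six times it and the rank difference
  is a third of that.\<close>

lemma rank_diff_square:
  assumes n: "odd n"
  shows "rank_diff (n\<^sup>2) = 2 * of_int (\<Sum>a\<in>odd_part n. divisor_chi 1 (a * (2 * n - a)))"
proof -
  have "int (n\<^sup>2) mod 4 = 1" using square_mod_4[of "int n"] n by simp
  then have "n\<^sup>2 mod 4 = 1" by presburger
  then have "3 * rank_diff (n\<^sup>2) = - three_squares_sum (n\<^sup>2)" by (intro rank_diff_eq_three_squares_sum) simp
  also have "\<dots> = real (card (sphere (n\<^sup>2)))" using n by (simp add: three_squares_sum_eq_card_sphere)
  finally have 1: "3 * rank_diff (n\<^sup>2) = real (card (sphere (n\<^sup>2)))" .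
  have "{(x, y, z) \<in> sphere (n\<^sup>2). even x} = even_slices 1 n" by (auto simp: sphere_def even_slices_def)
  then have "3 * card (even_slices 1 n) = 2 * card (sphere (n\<^sup>2))"
    using card_sphere_even[of "n\<^sup>2" 2, OF sphere_square_parity[OF n]] by simp
  then have "3 * real (card (even_slices 1 n)) = 2 * real (card (sphere (n\<^sup>2)))" by linarith
  moreover have "real (card (even_slices 1 n)) = of_int (int (card (even_slices 1 n)))" by simp
  ultimately show ?thesis using 1 unfolding card_even_slices[OF n, of 1, simplified] by simp
qed

text \<open>Exactly one coordinate is even, say \<open>x = 2 w\<close>. Then
  \<open>y = u + v\<close> and \<open>z = u - v\<close>, and halving the equation yields
  \<open>u^2 + v^2 + 2 w^2 = n^2\<close>, the form with \<open>D = 2\<close>.\<close>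

lemma rank_diff_double_square:
  assumes n: "odd n"
  shows "rank_diff (2 * n\<^sup>2) = - 4 * of_int (\<Sum>a\<in>odd_part n. divisor_chi 2 (a * (2 * n - a)))"
proof -
  let ?N = "2 * n\<^sup>2"
  define K where "K = {(u, v, w). u\<^sup>2 + v\<^sup>2 + 2 * w\<^sup>2 = (int n)\<^sup>2}"
  have "int (n\<^sup>2) mod 4 = 1" using square_mod_4[of "int n"] n by simp
  then have "?N mod 4 = 2" by presburger
  then have "3 * rank_diff ?N = - three_squares_sum ?N" by (intro rank_diff_eq_three_squares_sum) simp
  also have "\<dots> = - real (card (sphere ?N))" by (simp add: three_squares_sum_eq_card_sphere)
  finally have 1: "3 * rank_diff ?N = - real (card (sphere ?N))" .
  have 2: "3 * card {(x, y, z) \<in> sphere ?N. even x} = card (sphere ?N)"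
    using card_sphere_even[of ?N 1, OF sphere_double_square_parity[OF n]] by simp
  have bij: "bij_betw (\<lambda>(u, v, w). (2 * w, u + v, u - v)) K {(x, y, z) \<in> sphere ?N. even x}"
  proof (rule bij_betw_byWitness[where f' = "\<lambda>(x, y, z). ((y + z) div 2, (y - z) div 2, x div 2)"])
    have key: "(2 * w)\<^sup>2 + (u + v)\<^sup>2 + (u - v)\<^sup>2 = 2 * (u\<^sup>2 + v\<^sup>2 + 2 * w\<^sup>2)" for u v w :: int
      by (simp add: power2_eq_square algebra_simps)
    show "\<forall>t\<in>K. (\<lambda>(x, y, z). ((y + z) div 2, (y - z) div 2, x div 2)) ((\<lambda>(u, v, w). (2 * w, u + v, u - v)) t) = t"
      by auto
    show "(\<lambda>(u, v, w). (2 * w, u + v, u - v)) ` K \<subseteq> {(x, y, z) \<in> sphere ?N. even x}"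
    proof (rule image_subsetI)
      fix t assume t_in: "t \<in> K"
      obtain u v w where t: "t = (u, v, w)" by (rule prod_cases3)
      have h: "u\<^sup>2 + v\<^sup>2 + 2 * w\<^sup>2 = (int n)\<^sup>2" using t_in by (simp add: t K_def)
      have "(2 * w)\<^sup>2 + (u + v)\<^sup>2 + (u - v)\<^sup>2 = 2 * (int n)\<^sup>2" unfolding key h ..
      then show "(\<lambda>(u, v, w). (2 * w, u + v, u - v)) t \<in> {(x, y, z) \<in> sphere ?N. even x}"
        by (simp add: t sphere_def)
    qed
    have param: "\<exists>u v w. t = (2 * w, u + v, u - v) \<and> (u, v, w) \<in> K" if "t \<in> {(x, y, z) \<in> sphere ?N. even x}" for t
    proof -
      obtain x y z where t: "t = (x, y, z)" by (rule prod_cases3)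
      have h: "x\<^sup>2 + y\<^sup>2 + z\<^sup>2 = 2 * (int n)\<^sup>2" "even x" using that by (simp_all add: t sphere_def)
      have "even (x\<^sup>2 + y\<^sup>2 + z\<^sup>2)" using h(1) by simp
      then have "even (y + z)" using h(2) by simp
      then obtain u where u: "y + z = 2 * u" by (rule evenE)
      obtain w where w: "x = 2 * w" using h(2) by (rule evenE)
      have yz: "y = u + (u - z)" "z = u - (u - z)" using u by simp_all
      have "2 * (u\<^sup>2 + (u - z)\<^sup>2 + 2 * w\<^sup>2) = 2 * (int n)\<^sup>2"
        using h(1) key[of w u "u - z"] unfolding w yz(1)[symmetric] yz(2)[symmetric] by simp
      then have "(u, u - z, w) \<in> K" by (simp add: K_def)
      then show ?thesis using w yz t by blast
    qed
    show "\<forall>t\<in>{(x, y, z) \<in> sphere ?N. even x}. (\<lambda>(u, v, w). (2 * w, u + v, u - v)) ((\<lambda>(x, y, z). ((y + z) div 2, (y - z) div 2, x div 2)) t) = t"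
      using param by fastforce
    show "(\<lambda>(x, y, z). ((y + z) div 2, (y - z) div 2, x div 2)) ` {(x, y, z) \<in> sphere ?N. even x} \<subseteq> K"
      using param by fastforce
  qed
  have 3: "card K = card {(x, y, z) \<in> sphere ?N. even x}" by (rule bij_betw_same_card[OF bij])
  \<comment> \<open>As \<open>n\<close> is odd, exactly one of \<open>u\<close> and \<open>v\<close>
    is even; exchanging them identifies the two halves of \<open>K\<close>.\<close>
  have 4: "card K = 2 * card (even_slices 2 n)"
  proof -
    let ?v = "{(u, v, w). even v \<and> (u, v, w) \<in> K}"
    have e: "even_slices 2 n = {(u, v, w). even u \<and> (u, v, w) \<in> K}" by (auto simp: even_slices_def K_def)
    have par: "even u \<noteq> even v" if "(u, v, w) \<in> K" for u v w
    proof -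
      have "u\<^sup>2 + v\<^sup>2 + 2 * w\<^sup>2 = (int n)\<^sup>2" using that by (simp add: K_def)
      moreover have "odd ((int n)\<^sup>2)" using n by simp
      ultimately have "odd (u\<^sup>2 + v\<^sup>2 + 2 * w\<^sup>2)" by simp
      then show ?thesis by auto
    qed
    have finK: "finite K"
    proof -
      have "finite {(x, y, z) \<in> sphere ?N. even x}" using finite_sphere[of ?N] by (rule rev_finite_subset) auto
      then show ?thesis using bij_betw_finite[OF bij] by simp
    qed
    have K: "K = even_slices 2 n \<union> ?v" "even_slices 2 n \<inter> ?v = {}" unfolding e using par by auto
    have "finite (even_slices 2 n)" "finite ?v" using finK by (auto intro: finite_subset simp: e)
    from card_Un_disjoint[OF this K(2)] have "card K = card (even_slices 2 n) + card ?v"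
      by (simp only: K(1)[symmetric])
    moreover have "card ?v = card (even_slices 2 n)"
      by (rule bij_betw_same_card[OF bij_betw_byWitness[where f = "\<lambda>(u, v, w). (v, u, w)" and f' = "\<lambda>(u, v, w). (v, u, w)"]])
         (auto simp: e K_def add_ac)
    ultimately show ?thesis by simp
  qed
  have "6 * card (even_slices 2 n) = card (sphere ?N)" using 2 3 4 by simp
  then have "6 * real (card (even_slices 2 n)) = real (card (sphere ?N))" by linarith
  moreover have "real (card (even_slices 2 n)) = of_int (int (card (even_slices 2 n)))" by simp
  ultimately show ?thesis using 1 unfolding card_even_slices[OF n, of 2, simplified] by simp
qed

text \<open>With character value 1 the two sums over divisors differ by the top divisor
  \<open>p^k\<close>; with -1 they add, and multiplying by \<open>p - 1\<close> turns both into
  geometric closed forms.\<close>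

lemma chi_sum_value:
  fixes p k :: nat
  assumes p: "prime p"
  defines "S \<equiv> \<lambda>c. (\<Sum>d | d dvd p ^ k. int d) - (if k = 0 then 0 else c * (\<Sum>d | d dvd p ^ (k - 1). int d))"
  shows "S 1 = int p ^ k" and "(int p - 1) * S (-1) = int p ^ k * (int p + 1) - 2"
proof -
  have s: "(int p - 1) * (\<Sum>d | d dvd p ^ j. int d) = int p ^ Suc j - 1" for j
  proof (induction j)
    case (Suc j)
    then show ?case unfolding sum_divisors_prime_power[OF p] by (simp add: algebra_simps)
  qed simp
  show "S 1 = int p ^ k"
    using sum_divisors_prime_power[OF p, of "k - 1"] by (cases k) (simp_all add: S_def)
  show "(int p - 1) * S (-1) = int p ^ k * (int p + 1) - 2"
  proof (cases k)
    case 0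
    then show ?thesis by (simp add: S_def)
  next
    case (Suc j)
    have "(int p - 1) * S (-1) = (int p - 1) * (\<Sum>d | d dvd p ^ k. int d) + (int p - 1) * (\<Sum>d | d dvd p ^ j. int d)"
      unfolding S_def Suc by (simp add: algebra_simps)
    then show ?thesis unfolding s by (simp add: Suc algebra_simps)
  qed
qed

theorem corollary1p3:
  fixes p k :: nat
  assumes "prime p" and "odd p"
  shows "([p = 1] (mod 4) \<longrightarrow>
            real (p_even (p ^ (2 * k))) - real (p_odd (p ^ (2 * k))) = 2 * real p ^ k)
       \<and> ([p = 3] (mod 4) \<longrightarrow>
            real (p_even (p ^ (2 * k))) - real (p_odd (p ^ (2 * k)))
              = (2 * real p ^ k * (real p + 1) - 4) / (real p - 1))
       \<and> ([p = 1] (mod 8) \<or> [p = 3] (mod 8) \<longrightarrow>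
            real (p_even (2 * p ^ (2 * k))) - real (p_odd (2 * p ^ (2 * k)))
              = - 4 * real p ^ k)
       \<and> ([p = 5] (mod 8) \<or> [p = 7] (mod 8) \<longrightarrow>
            real (p_even (2 * p ^ (2 * k))) - real (p_odd (2 * p ^ (2 * k)))
              = (- 4 * real p ^ k * (real p + 1) + 8) / (real p - 1))"
proof -
  \<comment> \<open>All four formulas are values of this one function, at the character value 1 or
    -1 of \<open>p\<close> for \<open>D = 1\<close> and for \<open>D = 2\<close>.\<close>
  define S where "S c = (\<Sum>d | d dvd p ^ k. int d) - (if k = 0 then 0 else c * (\<Sum>d | d dvd p ^ (k - 1). int d))" for c
  have S1: "real_of_int (S 1) = real p ^ k"
    using chi_sum_value(1)[OF assms(1), of k] by (simp add: S_def)
  have p1: "real p - 1 > 0" using prime_gt_1_nat[OF assms(1)] by simp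
  have "real_of_int ((int p - 1) * S (-1)) = real_of_int (int p ^ k * (int p + 1) - 2)"
    using chi_sum_value(2)[OF assms(1), of k] by (simp add: S_def)
  then have "(real p - 1) * real_of_int (S (-1)) = real p ^ k * (real p + 1) - 2" by simp
  then have S2: "real_of_int (S (-1)) = (real p ^ k * (real p + 1) - 2) / (real p - 1)"
    using p1 by (simp add: eq_divide_eq mult.commute)
  have pw: "p ^ (2 * k) = (p ^ k)\<^sup>2" by (simp add: power_mult[symmetric] mult.commute)
  have odd: "odd (p ^ k)" using assms(2) by simp
  have 1: "real (p_even (p ^ (2 * k))) - real (p_odd (p ^ (2 * k))) = 2 * real_of_int (S (chi 1 p))"
    using rank_diff_square[OF odd] sum_divisor_chi_mult_odd_part[OF assms, of 1 k]
    by (simp add: pw rank_diff_def S_def)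
  have 2: "real (p_even (2 * p ^ (2 * k))) - real (p_odd (2 * p ^ (2 * k))) = - 4 * real_of_int (S (chi 2 p))"
    using rank_diff_double_square[OF odd] sum_divisor_chi_mult_odd_part[OF assms, of 2 k]
    by (simp add: pw rank_diff_def S_def)
  have "chi 1 p = 1" if "[p = 1] (mod 4)" using that by (simp add: chi_def cong_def)
  moreover have "chi 1 p = -1" if "[p = 3] (mod 4)" using that by (simp add: chi_def cong_def)
  moreover have "chi 2 p = 1" if "[p = 1] (mod 8) \<or> [p = 3] (mod 8)" using that by (auto simp: chi_def cong_def)
  moreover have "chi 2 p = -1" if "[p = 5] (mod 8) \<or> [p = 7] (mod 8)" using that by (auto simp: chi_def cong_def)
  ultimately show ?thesis unfolding 1 2
    by (simp add: S1 S2 diff_divide_distrib right_diff_distrib)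
qed

end
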